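(* Under the setting and notation of the context, suppose Assumption $(\mathcal A_1)$ holds and put $\bar S=\sum_{j=1}^{\bar n}\bar A_j$. Then, as $x\to+\infty$, $$\mathbb P[X^{(1)}\ge x]=\frac{C}{\bar S}(\log x)^{-\frac{1+\bar n}{2}}x^{\sum_{i=1}^{\bar n}\bar A_i\left(\log\frac{\bar S}{|\bar A_i|}+\bar\mu_i\right)}\exp\left\{-\tfrac12\bar S\log^2x\right\}\left(1+O\left((\log x)^{-1}\right)\right),$$ where $$C=\frac{1}{\sqrt{2\pi\det\bar{\mathfrak B}}}\sqrt{\frac{\bar S}{\prod_{i=1}^{\bar n}|\bar A_i|}}\exp\left\{-\tfrac12\sum_{i,m=1}^{\bar n}\bar a_{im}\left(\log\tfrac{\bar S}{|\bar A_i|}+\bar\mu_i\right)\left(\log\tfrac{\bar S}{|\bar A_m|}+\bar\mu_m\right)\right\}.$$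
   Context: Let $Y=(Y_1,\dots,Y_n)$ be a Gaussian vector with mean $\mu\in\mathbb R^n$ and covariance matrix $\mathfrak B=(b_{ij})$ with $\det\mathfrak B>0$, and $X^{(1)}=e^{Y_1}-\sum_{k=2}^ne^{Y_k}$. Let $\Delta_{1,n}=\{w\in\mathbb R^n: w_1\ge0,\ w_i\le0\ (i=2,\dots,n),\ \sum_iw_i=1\}$ and let $\bar w$ be the unique minimizer of $w^\top\mathfrak Bw$ over $\Delta_{1,n}$. Let $\bar I=\{i:\bar w_i\neq0\}$ (it contains $1$) and $\bar n=|\bar I|$; since $X^{(1)}$ is symmetric in $Y_2,\dots,Y_n$, the coordinates are labeled so that $\bar I=\{1,\dots,\bar n\}$. Set $\bar\mu=(\mu_1,\dots,\mu_{\bar n})$, $\bar{\mathfrak B}=(b_{ij})_{i,j=1}^{\bar n}$, let $\bar a_{ij}$ be the entries of $\bar{\mathfrak B}^{-1}$ and $\bar A_k=\sum_{j=1}^{\bar n}\bar a_{kj}$. Let $e^i$ be the $i$-th standard basis vector. Assumption $(\mathcal A_1)$: for every $i\in\{1,\dots,n\}\setminus\bar I$, $(e^i-\bar w)^\top\mathfrak B\bar w\neq0$. *)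

theory Defs
  imports "HOL-Probability.Probability" "HOL-Library.Landau_Symbols"
    "Jordan_Normal_Form.Gauss_Jordan_Elimination" "Jordan_Normal_Form.Determinant"
begin

text \<open>Conventions: coordinates are 0-based, so the paper's index 1 is index 0 here and
the paper's indices 2..n are 1..n-1. Vectors are functions nat => real (only the values
below n matter), matrices are Jordan_Normal_Form matrices.\<close>

definition minv :: "real mat \<Rightarrow> real mat" where
  "minv A = the (mat_inverse A)"

definition quad_form :: "nat \<Rightarrow> real mat \<Rightarrow> (nat \<Rightarrow> real) \<Rightarrow> (nat \<Rightarrow> real) \<Rightarrow> real" where
  "quad_form n B u v = (\<Sum>i<n. \<Sum>j<n. u i * B $$ (i, j) * v j)"

definition gauss_density :: "nat \<Rightarrow> (nat \<Rightarrow> real) \<Rightarrow> real mat \<Rightarrow> (nat \<Rightarrow> real) \<Rightarrow> real" where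
  "gauss_density n mu B y =
     exp (- (1/2) * quad_form n (minv B) (\<lambda>i. y i - mu i) (\<lambda>i. y i - mu i))
     / sqrt ((2 * pi) ^ n * det B)"

definition Delta1 :: "nat \<Rightarrow> (nat \<Rightarrow> real) set" where
  "Delta1 n = {w. w 0 \<ge> 0 \<and> (\<forall>i\<in>{1..<n}. w i \<le> 0) \<and> (\<Sum>i<n. w i) = 1}"

definition unit_vec :: "nat \<Rightarrow> nat \<Rightarrow> real" where
  "unit_vec i = (\<lambda>k. if k = i then 1 else 0)"

definition Ibar :: "nat \<Rightarrow> (nat \<Rightarrow> real) \<Rightarrow> nat set" where
  "Ibar n w = {i. i < n \<and> w i \<noteq> 0}"

definition idx :: "nat \<Rightarrow> (nat \<Rightarrow> real) \<Rightarrow> nat list" where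
  "idx n w = sorted_list_of_set (Ibar n w)"

definition nbar :: "nat \<Rightarrow> (nat \<Rightarrow> real) \<Rightarrow> nat" where
  "nbar n w = card (Ibar n w)"

definition Bbar :: "nat \<Rightarrow> real mat \<Rightarrow> (nat \<Rightarrow> real) \<Rightarrow> real mat" where
  "Bbar n B w = mat (nbar n w) (nbar n w) (\<lambda>(i, j). B $$ (idx n w ! i, idx n w ! j))"

definition mubar :: "nat \<Rightarrow> (nat \<Rightarrow> real) \<Rightarrow> (nat \<Rightarrow> real) \<Rightarrow> nat \<Rightarrow> real" where
  "mubar n mu w i = mu (idx n w ! i)"

definition abar :: "nat \<Rightarrow> real mat \<Rightarrow> (nat \<Rightarrow> real) \<Rightarrow> nat \<Rightarrow> nat \<Rightarrow> real" where
  "abar n B w i j = minv (Bbar n B w) $$ (i, j)"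

definition Abar :: "nat \<Rightarrow> real mat \<Rightarrow> (nat \<Rightarrow> real) \<Rightarrow> nat \<Rightarrow> real" where
  "Abar n B w k = (\<Sum>j<nbar n w. abar n B w k j)"

definition Sbar :: "nat \<Rightarrow> real mat \<Rightarrow> (nat \<Rightarrow> real) \<Rightarrow> real" where
  "Sbar n B w = (\<Sum>j<nbar n w. Abar n B w j)"

definition Lbar :: "nat \<Rightarrow> (nat \<Rightarrow> real) \<Rightarrow> real mat \<Rightarrow> (nat \<Rightarrow> real) \<Rightarrow> nat \<Rightarrow> real" where
  "Lbar n mu B w i = ln (Sbar n B w / \<bar>Abar n B w i\<bar>) + mubar n mu w i"

definition Cconst :: "nat \<Rightarrow> (nat \<Rightarrow> real) \<Rightarrow> real mat \<Rightarrow> (nat \<Rightarrow> real) \<Rightarrow> real" where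
  "Cconst n mu B w =
     1 / sqrt (2 * pi * det (Bbar n B w))
     * sqrt (Sbar n B w / (\<Prod>i<nbar n w. \<bar>Abar n B w i\<bar>))
     * exp (- (1/2) * (\<Sum>i<nbar n w. \<Sum>m<nbar n w.
                abar n B w i m * Lbar n mu B w i * Lbar n mu B w m))"

definition main_term :: "nat \<Rightarrow> (nat \<Rightarrow> real) \<Rightarrow> real mat \<Rightarrow> (nat \<Rightarrow> real) \<Rightarrow> real \<Rightarrow> real" where
  "main_term n mu B w x =
     Cconst n mu B w / Sbar n B w
     * ln x powr (- (1 + real (nbar n w)) / 2)
     * x powr (\<Sum>i<nbar n w. Abar n B w i * Lbar n mu B w i)
     * exp (- (1/2) * Sbar n B w * (ln x)^2)"

end

theory Submission
  imports Defs "HOL-Real_Asymp.Real_Asymp"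
begin

text \<open>
  Put \<open>t = log x\<close>. The shift \<open>Y = t v + c\<close> with \<open>v = B w / (w\<^sup>T B w)\<close>, \<open>w\<close> the minimizer,
  turns the probability into \<open>exp(- S t\<^sup>2 / 2 + t A\<cdot>\<mu>) E[exp(- t A\<cdot>c); event]\<close>. By optimality and
  Assumption A1, \<open>v = 1\<close> on the active indices and \<open>v < 1\<close> off them, so the inactive coordinates
  perturb the event only inside a slab of exponentially small width, and what is left is an integral
  over the active coordinates of a Gaussian density against \<open>exp(- t A\<cdot>c)\<close> on the region
  \<open>exp(c\<^sub>0) \<ge> 1 + \<Sum> exp(c\<^sub>k)\<close>. Without the Gaussian factor this integral is an explicit
  quotient of Gamma functions, and multiplying the integrand by \<open>exp(\<plusminus> c\<^sub>k)\<close> only shifts their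
  arguments by one. Hence the tilted measure has exact exponential moments, which
  show that it concentrates at scale \<open>t\<^sup>-\<^sup>1\<^sup>/\<^sup>2\<close> with bias \<open>O(1/t)\<close>; the Gaussian factor may then be
  replaced by its value at the concentration point with relative error \<open>O(1/t)\<close>, and Stirling's formula
  with error \<open>O(1/t)\<close> finishes the proof.
\<close>

section \<open>Stirling's formula with error bound\<close>

text \<open>Under the tilted measure the deviation z = c - opt has size t^(-1/2). Bounding the
  linear term of the Gaussian factor by absolute values would therefore leave an error of that
  order, too large for the claim. Its sign must be kept: the linear term is integrated exactly and
  only the remainder is estimated. For the same reason no neighbourhood of the concentration point
  is cut out. The point \<open>opt k = ln (|A k| / S)\<close> minimizes A.c on the region: on the
  boundary, where exp (c_0) = 1 + sum exp (c_k), Lagrange's condition makes |A_k| proportional to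
  exp (c_k), and the constraint fixes the factor as S. This is the origin of the logarithms in
  \<open>Lbar\<close>. The exponent (1 + nbar) / 2 of log x is 1 for the exponential decay across
  the boundary plus (nbar - 1) / 2 for the concentration along it. In the slab estimate the Gaussian
  weight is discarded on the active coordinates, so that closed forms still apply, and kept on the
  inactive ones, where it makes exponentials integrable.\<close>

definition stirling_rem :: "real \<Rightarrow> real" where
  "stirling_rem x = ln (Gamma x) - ((x - 1/2) * ln x - x + ln (2 * pi) / 2)"

lemma stirling_rem_diff:
  assumes "x > 0"
  shows "stirling_rem x - stirling_rem (x + 1) = (x + 1/2) * (ln (x + 1) - ln x) - 1"
proof -
  have "x \<notin> \<int>\<^sub>\<le>\<^sub>0"
    using assms by (auto elim!: nonpos_Ints_cases)
  then have "ln (Gamma (x + 1)) = ln x + ln (Gamma x)"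
    using assms Gamma_plus1[of x] Gamma_real_pos[of x] by (simp add: ln_mult less_imp_neq[symmetric])
  then show ?thesis by (simp add: stirling_rem_def algebra_simps)
qed

text \<open>Midpoint bound for the integral of 1/u over [x, x + 1]: by convexity it is at least 2 /
  (2 x + 1).\<close>

lemma stirling_rem_diff_nonneg:
  assumes "x > 0"
  shows "stirling_rem (x + 1) \<le> stirling_rem x"
proof -
  have "1 = (x + 1/2) * (2 * (x + 1 - x) / (x + (x + 1)))"
    using assms by (simp add: field_simps)
  also have "\<dots> \<le> (x + 1/2) * (ln (x + 1) - ln x)"
    using assms by (intro mult_left_mono ln_inverse_approx_ge) auto
  finally show ?thesis
    using stirling_rem_diff[OF assms] by simp
qed

text \<open>The trapezoidal bound for the same integral leaves 1 / (4 x (x + 1)), written as a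
  difference so that unit shifts telescope.\<close>

lemma stirling_rem_diff_le:
  assumes "x > 0"
  shows "stirling_rem x - stirling_rem (x + 1) \<le> 1 / (4 * x) - 1 / (4 * (x + 1))"
proof -
  have "(x + 1/2) * (ln (x + 1) - ln x) \<le> (x + 1/2) * (1 * (inverse x + inverse (x + 1)) / 2)"
    using assms by (intro mult_left_mono ln_inverse_approx_le) auto
  also have "\<dots> = 1 + (1 / (4 * x) - 1 / (4 * (x + 1)))"
    using assms by (simp add: divide_simps) (simp add: algebra_simps)
  finally show ?thesis
    using stirling_rem_diff[OF assms] by simp
qed

lemma stirling_rem_shift:
  assumes "x > 0"
  shows "stirling_rem (x + real n) \<le> stirling_rem x"
    and "stirling_rem x - stirling_rem (x + real n) \<le> 1 / (4 * x) - 1 / (4 * (x + real n))"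
proof (induction n)
  case (Suc n)
  have eq: "x + real (Suc n) = (x + real n) + 1" by simp
  have pos: "x + real n > 0" using assms by simp
  {
    case 1
    show ?case unfolding eq using stirling_rem_diff_nonneg[OF pos] Suc by linarith
  next
    case 2
    show ?case unfolding eq using stirling_rem_diff_le[OF pos] Suc by linarith
  }
qed auto

text \<open>Gauss's limit formula, in the form of \<open>Gamma_series'\<close>, compares Gamma (x +
  n) / Gamma n with n^x, and Stirling's main terms at x + n and n differ by x ln n + o(1). Every
  real x thus inherits the limit found along the integers.\<close>

lemma stirling_rem_shift_tendsto:
  assumes "x > 0"
  shows "(\<lambda>n. stirling_rem (x + real n) - stirling_rem (real n)) \<longlonglongrightarrow> 0"
proof -
  have xn: "x \<notin> \<int>\<^sub>\<le>\<^sub>0"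
    using assms by (auto elim!: nonpos_Ints_cases)
  have Gx: "Gamma x > 0" using assms by (rule Gamma_real_pos)
  have "(\<lambda>n. ln (Gamma_series' x n)) \<longlonglongrightarrow> ln (Gamma x)"
    using Gamma_series'_LIMSEQ[of x] Gx by (intro tendsto_ln) auto
  then have 1: "(\<lambda>n. ln (Gamma x) - ln (Gamma_series' x n)) \<longlonglongrightarrow> 0"
    by (auto intro: tendsto_eq_intros)
  have 2: "(\<lambda>n. x * ln (real n) - ((x + real n - 1/2) * ln (x + real n) - x - (real n - 1/2) * ln (real n))) \<longlonglongrightarrow> 0"
    by real_asymp
  have "(\<lambda>n. ln (Gamma x) - ln (Gamma_series' x n) +
     (x * ln (real n) - ((x + real n - 1/2) * ln (x + real n) - x - (real n - 1/2) * ln (real n)))) \<longlonglongrightarrow> 0"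
    using tendsto_add[OF 1 2] by simp
  moreover have "\<forall>\<^sub>F n in sequentially. ln (Gamma x) - ln (Gamma_series' x n) +
     (x * ln (real n) - ((x + real n - 1/2) * ln (x + real n) - x - (real n - 1/2) * ln (real n)))
     = stirling_rem (x + real n) - stirling_rem (real n)"
    using eventually_gt_at_top[of 0]
  proof eventually_elim
    case (elim n)
    have f: "fact (n - 1) = Gamma (real n)"
      using elim Gamma_fact[of "n - 1", where 'a=real] by (simp add: of_nat_diff)
    have G: "Gamma (x + real n) > 0" "Gamma (real n) > 0"
      using assms elim by (auto intro: Gamma_real_pos)
    have "Gamma_series' x n = Gamma (real n) * exp (x * ln (real n)) / (Gamma (x + real n) / Gamma x)"
      unfolding Gamma_series'_def f pochhammer_Gamma[OF xn] by simp
    then have "ln (Gamma_series' x n) = ln (Gamma (real n)) + x * ln (real n) - (ln (Gamma (x + real n)) - ln (Gamma x))"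
      using Gx G by (simp add: ln_mult ln_div)
    then show ?case by (simp add: stirling_rem_def algebra_simps)
  qed
  ultimately show ?thesis
    by (rule Lim_transform_eventually)
qed

text \<open>The sequence is monotone and bounded below, so it has a limit L. Legendre's duplication
  formula links the remainders at n, n + 1/2 and 2 n, which all tend to L, and forces L + L - L = 0.
  This is what fixes the constant ln (2 pi) / 2.\<close>

lemma stirling_rem_limit: "(\<lambda>n. stirling_rem (real n)) \<longlonglongrightarrow> 0"
proof -
  have "decseq (\<lambda>n. stirling_rem (real (Suc n)))"
    using stirling_rem_diff_nonneg[of "real (Suc _)"] by (intro decseq_SucI) (simp add: add_ac)
  moreover have "\<forall>n. stirling_rem 1 - 1/4 \<le> stirling_rem (real (Suc n))"
    using stirling_rem_shift(2)[of 1] by (simp add: add_ac) (smt (verit) divide_nonneg_nonneg of_nat_0_le_iff)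
  ultimately obtain L where "(\<lambda>n. stirling_rem (real (Suc n))) \<longlonglongrightarrow> L"
    using decseq_convergent by blast
  then have L: "(\<lambda>n. stirling_rem (real n)) \<longlonglongrightarrow> L"
    by (rule LIMSEQ_imp_Suc)
  have L2: "(\<lambda>n. stirling_rem (real (2 * n))) \<longlonglongrightarrow> L"
    using LIMSEQ_subseq_LIMSEQ[OF L, of "\<lambda>n. 2 * n"] by (simp add: strict_mono_def o_def)
  have Lh: "(\<lambda>n. stirling_rem (1/2 + real n)) \<longlonglongrightarrow> L"
    using tendsto_add[OF stirling_rem_shift_tendsto[of "1/2"] L] by simp
  have lim: "(\<lambda>n. stirling_rem (real n) + stirling_rem (1/2 + real n) - stirling_rem (real (2 * n))) \<longlonglongrightarrow> L + L - L"
    by (intro tendsto_intros L L2 Lh)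
  have "(\<lambda>n. (1 - 2 * real n) * ln 2 + ln pi / 2 - ((real n - 1/2) * ln (real n) - real n + ln (2 * pi) / 2)
        - ((1/2 + real n - 1/2) * ln (1/2 + real n) - (1/2 + real n) + ln (2 * pi) / 2)
        + ((2 * real n - 1/2) * ln (2 * real n) - 2 * real n + ln (2 * pi) / 2)) \<longlonglongrightarrow> 0"
  proof -
    have "(\<lambda>n. (1 - 2 * real n) * ln 2 - ((real n - 1/2) * ln (real n) - real n)
        - ((1/2 + real n - 1/2) * ln (1/2 + real n) - (1/2 + real n))
        + ((2 * real n - 1/2) * ln (2 * real n) - 2 * real n)) \<longlonglongrightarrow> ln 2 / 2"
      by real_asymp
    then have *: "(\<lambda>n. ((1 - 2 * real n) * ln 2 - ((real n - 1/2) * ln (real n) - real n)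
        - ((1/2 + real n - 1/2) * ln (1/2 + real n) - (1/2 + real n))
        + ((2 * real n - 1/2) * ln (2 * real n) - 2 * real n)) + (ln pi / 2 - ln (2 * pi) / 2)) \<longlonglongrightarrow> ln 2 / 2 + (ln pi / 2 - ln (2 * pi) / 2)"
      by (intro tendsto_add tendsto_const)
    have z: "ln 2 / 2 + (ln pi / 2 - ln (2 * pi) / 2) = 0"
      using pi_gt_zero by (simp add: ln_mult add_divide_distrib)
    show ?thesis using *[unfolded z] by (simp add: algebra_simps)
  qed
  moreover have "\<forall>\<^sub>F n in sequentially. (1 - 2 * real n) * ln 2 + ln pi / 2 - ((real n - 1/2) * ln (real n) - real n + ln (2 * pi) / 2)
        - ((1/2 + real n - 1/2) * ln (1/2 + real n) - (1/2 + real n) + ln (2 * pi) / 2)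
        + ((2 * real n - 1/2) * ln (2 * real n) - 2 * real n + ln (2 * pi) / 2)
      = stirling_rem (real n) + stirling_rem (1/2 + real n) - stirling_rem (real (2 * n))"
    using eventually_gt_at_top[of 0]
  proof eventually_elim
    case (elim n)
    have nn: "complex_of_real (real n) \<notin> \<int>\<^sub>\<le>\<^sub>0" "complex_of_real (real n + 1/2) \<notin> \<int>\<^sub>\<le>\<^sub>0"
      using elim by (subst of_real_in_nonpos_Ints_iff; force dest: nonpos_Ints_nonpos)+
    then have "Gamma (complex_of_real (real n)) * Gamma (complex_of_real (real n) + 1/2)
       = exp ((1 - 2 * complex_of_real (real n)) * of_real (ln 2)) * of_real (sqrt pi) * Gamma (2 * complex_of_real (real n))"
      by (intro Gamma_legendre_duplication) auto
    then have "complex_of_real (Gamma (real n) * Gamma (real n + 1/2)) =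
        complex_of_real (exp ((1 - 2 * real n) * ln 2) * sqrt pi * Gamma (2 * real n))"
      by (simp flip: Gamma_complex_of_real exp_of_real)
    then have eq: "Gamma (real n) * Gamma (real n + 1/2) = exp ((1 - 2 * real n) * ln 2) * sqrt pi * Gamma (2 * real n)"
      by (simp only: of_real_eq_iff)
    have G: "Gamma (real n) > 0" "Gamma (real n + 1/2) > 0" "Gamma (2 * real n) > 0"
      using elim by (auto intro!: Gamma_real_pos)
    have "ln (Gamma (real n)) + ln (Gamma (real n + 1/2)) = (1 - 2 * real n) * ln 2 + ln pi / 2 + ln (Gamma (2 * real n))"
      using arg_cong[OF eq, of ln] G by (simp add: ln_mult ln_sqrt)
    then show ?case by (simp add: stirling_rem_def algebra_simps)
  qed
  ultimately have "(\<lambda>n. stirling_rem (real n) + stirling_rem (1/2 + real n) - stirling_rem (real (2 * n))) \<longlonglongrightarrow> 0"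
    by (rule Lim_transform_eventually)
  with lim have "L = 0"
    using LIMSEQ_unique by fastforce
  with L show ?thesis by simp
qed

text \<open>The telescoped bounds between x and x + n are uniform in n; letting n grow removes the
  remainder at x + n.\<close>

lemma stirling_rem_bounds:
  assumes "x > 0"
  shows "0 \<le> stirling_rem x" "stirling_rem x \<le> 1 / (4 * x)"
proof -
  have lim: "(\<lambda>n. stirling_rem (x + real n)) \<longlonglongrightarrow> 0"
    using tendsto_add[OF stirling_rem_shift_tendsto[OF assms] stirling_rem_limit] by simp
  show "0 \<le> stirling_rem x"
    by (rule LIMSEQ_le_const2[OF lim]) (use stirling_rem_shift(1)[OF assms] in auto)
  have "(\<lambda>n. stirling_rem x - stirling_rem (x + real n)) \<longlonglongrightarrow> stirling_rem x - 0"
    by (intro tendsto_intros lim)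
  moreover have "stirling_rem x - stirling_rem (x + real n) \<le> 1 / (4 * x)" for n
    using stirling_rem_shift(2)[OF assms, of n] assms by (smt (verit) divide_nonneg_nonneg of_nat_0_le_iff)
  ultimately show "stirling_rem x \<le> 1 / (4 * x)"
    by (intro LIMSEQ_le_const2[of _ "stirling_rem x" "1 / (4 * x)"]) auto
qed

text \<open>Euler's integral after the substitution t = v exp y. Logarithmic coordinates fit the
  event, which involves the Gaussian vector only through exponentials.\<close>

lemma nn_integral_exp_Gamma:
  assumes q: "q > 0" and v: "v > 0"
  shows "(\<integral>\<^sup>+y. ennreal (exp (q * y - v * exp y)) \<partial>lborel) = ennreal (Gamma q * v powr (-q))"
proof -
  define g :: "real \<Rightarrow> real" where "g y = v * exp y" for y
  have img: "g ` UNIV = {0<..}"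
  proof -
    have "x \<in> range g" if "x > 0" for x
      using that v by (intro image_eqI[of _ _ "ln (x / v)"]) (auto simp: g_def)
    then show ?thesis using v by (auto simp: g_def)
  qed
  have hi: "((\<lambda>t. t powr (q - 1) / exp t) has_integral Gamma q) {0<..}"
    using Gamma_integral_real[OF q]
    by (rule has_integral_spike_set_eq[THEN iffD1, rotated -1]) (auto intro: negligible_subset[of "{0}"])
  have ai: "(\<lambda>t. t powr (q - 1) / exp t) absolutely_integrable_on {0<..}"
    using hi by (intro nonnegative_absolutely_integrable_1) auto
  have "(\<lambda>y. \<bar>v * exp y\<bar> * (g y powr (q - 1) / exp (g y))) absolutely_integrable_on UNIV \<and>
     integral UNIV (\<lambda>y. \<bar>v * exp y\<bar> * (g y powr (q - 1) / exp (g y))) = Gamma q"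
    apply (rule has_absolute_integral_change_of_variables_1'[where f = "\<lambda>t. t powr (q - 1) / exp t" and g = g and S = UNIV, THEN iffD2])
    subgoal by simp
    subgoal unfolding g_def by (auto intro!: derivative_eq_intros)
    subgoal using v by (auto simp: inj_on_def g_def)
    subgoal unfolding img using ai hi by (auto intro: integral_unique)
    done
  moreover have "\<bar>v * exp y\<bar> * (g y powr (q - 1) / exp (g y)) = v powr q * exp (q * y - v * exp y)" for y
    using v by (simp add: g_def powr_def ln_mult algebra_simps flip: exp_add exp_diff exp_minus) (simp add: exp_add exp_diff field_simps)
  ultimately have hi2: "((\<lambda>y. v powr q * exp (q * y - v * exp y)) has_integral Gamma q) UNIV"
    by (auto simp: has_integral_iff absolutely_integrable_on_def)
  then have "((\<lambda>y. v powr (-q) * (v powr q * exp (q * y - v * exp y))) has_integral v powr (-q) * Gamma q) UNIV"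
    by (rule has_integral_mult_right)
  then have "((\<lambda>y. exp (q * y - v * exp y)) has_integral v powr (-q) * Gamma q) UNIV"
    using v by (simp add: powr_minus field_simps)
  then show ?thesis
    by (subst nn_integral_has_integral_lborel) (auto simp: mult.commute)
qed

section \<open>Dirichlet-type integrals over the region\<close>

interpretation lborel_PiM: product_sigma_finite "\<lambda>_::nat. lborel :: real measure"
  by standard

text \<open>The inverted Dirichlet integral: with x_k = exp (c k) it is the integral of prod
  x_k^(\<beta> k - 1) times (1 + sum x_k)^(-\<theta>) over positive x_k.\<close>

definition dirichlet_int :: "nat set \<Rightarrow> real \<Rightarrow> (nat \<Rightarrow> real) \<Rightarrow> real" where
  "dirichlet_int K \<theta> \<beta> = (\<Prod>k\<in>K. Gamma (\<beta> k)) * Gamma (\<theta> - sum \<beta> K) / Gamma \<theta>"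

text \<open>Writing \<open>\<Gamma>(\<theta>) u\<^sup>-\<^sup>\<theta>\<close> as an integral over an auxiliary variable makes the integrand a product over
  the coordinates.\<close>

lemma nn_integral_dirichlet:
  assumes K: "finite K" and \<beta>: "\<And>k. k \<in> K \<Longrightarrow> \<beta> k > 0" and \<theta>: "sum \<beta> K < \<theta>"
  shows "(\<integral>\<^sup>+c. ennreal (exp (\<Sum>k\<in>K. \<beta> k * c k) * (1 + (\<Sum>k\<in>K. exp (c k))) powr (-\<theta>)) \<partial>PiM K (\<lambda>_. lborel))
     = ennreal (dirichlet_int K \<theta> \<beta>)"
proof -
  interpret finite_product_sigma_finite "\<lambda>_::nat. lborel :: real measure" K
    by standard (rule K)
  interpret pair_sigma_finite "PiM K (\<lambda>_. lborel :: real measure)" "lborel :: real measure"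
    by standard
  have \<theta>0: "\<theta> > 0"
    using sum_nonneg[of K \<beta>] \<beta> \<theta> by force
  define F where "F = (\<lambda>(c :: nat \<Rightarrow> real) y. exp (\<Sum>k\<in>K. \<beta> k * c k) * exp (\<theta> * y - (1 + (\<Sum>k\<in>K. exp (c k))) * exp y))"
  have 1: "ennreal (Gamma \<theta>) * ennreal (exp (\<Sum>k\<in>K. \<beta> k * c k) * (1 + (\<Sum>k\<in>K. exp (c k))) powr (-\<theta>))
     = (\<integral>\<^sup>+y. ennreal (F c y) \<partial>lborel)" for c :: "nat \<Rightarrow> real"
  proof -
    have v: "1 + (\<Sum>k\<in>K. exp (c k)) > 0"
      by (smt (verit) exp_gt_zero sum_nonneg)
    have "(\<integral>\<^sup>+y. ennreal (F c y) \<partial>lborel) = ennreal (exp (\<Sum>k\<in>K. \<beta> k * c k)) *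
       (\<integral>\<^sup>+y. ennreal (exp (\<theta> * y - (1 + (\<Sum>k\<in>K. exp (c k))) * exp y)) \<partial>lborel)"
      unfolding F_def by (simp add: ennreal_mult nn_integral_cmult)
    also have "\<dots> = ennreal (exp (\<Sum>k\<in>K. \<beta> k * c k)) * ennreal (Gamma \<theta> * (1 + (\<Sum>k\<in>K. exp (c k))) powr (-\<theta>))"
      by (subst nn_integral_exp_Gamma[OF \<theta>0 v]) simp
    finally show ?thesis
      using Gamma_real_pos[OF \<theta>0] by (simp add: ennreal_mult[symmetric] mult_ac)
  qed
  have "ennreal (Gamma \<theta>) * (\<integral>\<^sup>+c. ennreal (exp (\<Sum>k\<in>K. \<beta> k * c k) * (1 + (\<Sum>k\<in>K. exp (c k))) powr (-\<theta>)) \<partial>PiM K (\<lambda>_. lborel))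
     = (\<integral>\<^sup>+c. (\<integral>\<^sup>+y. ennreal (F c y) \<partial>lborel) \<partial>PiM K (\<lambda>_. lborel))"
    unfolding 1[symmetric] by (subst nn_integral_cmult) auto
  \<comment> \<open>Tonelli: for fixed y the integrand factorizes over K, each factor being a Gamma
    integral with v = exp y. The leftover powers of exp y turn the outer integral into Gamma
    (\<theta> - sum \<beta> K).\<close>
  also have "\<dots> = (\<integral>\<^sup>+y. (\<integral>\<^sup>+c. ennreal (F c y) \<partial>PiM K (\<lambda>_. lborel)) \<partial>lborel)"
    by (rule Fubini'[symmetric]) (simp add: F_def)
  also have "\<dots> = (\<integral>\<^sup>+y. ennreal ((\<Prod>k\<in>K. Gamma (\<beta> k)) * exp ((\<theta> - sum \<beta> K) * y - 1 * exp y)) \<partial>lborel)"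
  proof (rule nn_integral_cong)
    fix y :: real
    have "F c y = exp (\<theta> * y - exp y) * (\<Prod>k\<in>K. exp (\<beta> k * c k - exp y * exp (c k)))" for c
      unfolding F_def exp_sum[OF K, symmetric]
      by (simp add: sum_subtractf sum_distrib_left sum_distrib_right algebra_simps flip: exp_add)
    then have "(\<integral>\<^sup>+c. ennreal (F c y) \<partial>PiM K (\<lambda>_. lborel))
      = ennreal (exp (\<theta> * y - exp y)) * (\<integral>\<^sup>+c. (\<Prod>k\<in>K. ennreal (exp (\<beta> k * c k - exp y * exp (c k)))) \<partial>PiM K (\<lambda>_. lborel))"
      by (subst nn_integral_cmult[symmetric]) (auto simp: ennreal_mult prod_ennreal prod_nonneg)
    also have "(\<integral>\<^sup>+c. (\<Prod>k\<in>K. ennreal (exp (\<beta> k * c k - exp y * exp (c k)))) \<partial>PiM K (\<lambda>_. lborel))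
       = (\<Prod>k\<in>K. ennreal (Gamma (\<beta> k) * exp y powr (- \<beta> k)))"
      by (subst lborel_PiM.product_nn_integral_prod[OF K])
         (auto intro!: prod.cong nn_integral_exp_Gamma \<beta>)
    also have "\<dots> = ennreal (\<Prod>k\<in>K. Gamma (\<beta> k) * exp (- (\<beta> k * y)))"
      using \<beta> by (subst prod_ennreal) (auto simp: powr_def less_imp_le)
    also have "(\<Prod>k\<in>K. Gamma (\<beta> k) * exp (- (\<beta> k * y))) = (\<Prod>k\<in>K. Gamma (\<beta> k)) * exp (- sum \<beta> K * y)"
      by (simp add: prod.distrib exp_sum[OF K, symmetric] sum_negf sum_distrib_right)
    finally show "(\<integral>\<^sup>+c. ennreal (F c y) \<partial>PiM K (\<lambda>_. lborel)) =
       ennreal ((\<Prod>k\<in>K. Gamma (\<beta> k)) * exp ((\<theta> - sum \<beta> K) * y - 1 * exp y))"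
      using \<beta> by (simp add: ennreal_mult[symmetric] prod_nonneg less_imp_le algebra_simps flip: exp_add)
  qed
  also have "\<dots> = ennreal (\<Prod>k\<in>K. Gamma (\<beta> k)) * ennreal (Gamma (\<theta> - sum \<beta> K) * 1 powr (- (\<theta> - sum \<beta> K)))"
    using \<beta> \<theta> by (subst nn_integral_exp_Gamma[symmetric])
      (auto simp: ennreal_mult prod_nonneg less_imp_le nn_integral_cmult)
  also have "\<dots> = ennreal (Gamma \<theta>) * ennreal (dirichlet_int K \<theta> \<beta>)"
    using \<beta> \<theta> \<theta>0 Gamma_real_pos[OF \<theta>0]
    by (simp add: dirichlet_int_def ennreal_mult[symmetric] prod_nonneg less_imp_le less_imp_neq[symmetric])
  finally show ?thesis
    using Gamma_real_pos[OF \<theta>0] by (subst (asm) ennreal_mult_cancel_left) (auto simp: ennreal_eq_0_iff)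
qed

lemma nn_integral_exp_ray:
  fixes v \<theta> :: real
  assumes "v > 0" "\<theta> > 0"
  shows "(\<integral>\<^sup>+y. ennreal (indicator {y. v \<le> exp y} y * exp (- (\<theta> * y))) \<partial>lborel) = ennreal (v powr (-\<theta>) / \<theta>)"
proof -
  have "((\<lambda>y. exp (- \<theta> * y)) has_integral exp (- \<theta> * ln v) / \<theta>) {ln v..}"
    using assms(2) by (rule has_integral_exp_minus_to_infinity)
  moreover have "{ln v..} = {y. v \<le> exp y}"
    using assms ln_le_cancel_iff[of v "exp _"] by (auto simp del: ln_le_cancel_iff)
  ultimately show ?thesis
    using nn_integral_has_integral_lebesgue[of "{y. v \<le> exp y}" "\<lambda>y. exp (- \<theta> * y)" "exp (- \<theta> * ln v) / \<theta>"]
    using assms by (simp add: powr_def)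
qed

text \<open>On the slab the integrand is at most v^(-\<theta>), and the interval of y has length ln
  (v + W) - ln v <= W / v <= W because v >= 1.\<close>

lemma nn_integral_exp_slab:
  fixes v \<theta> W :: real
  assumes v: "v \<ge> 1" and \<theta>: "\<theta> > 0" and W: "W \<ge> 0"
  shows "(\<integral>\<^sup>+y. ennreal (indicator {y. v \<le> exp y \<and> exp y < v + W} y * exp (- (\<theta> * y))) \<partial>lborel) \<le> ennreal (W * v powr (-\<theta>))"
proof -
  have "(\<integral>\<^sup>+y. ennreal (indicator {y. v \<le> exp y \<and> exp y < v + W} y * exp (- (\<theta> * y))) \<partial>lborel)
     \<le> (\<integral>\<^sup>+y. ennreal (v powr (-\<theta>)) * indicator {ln v .. ln (v + W)} y \<partial>lborel)"
  proof (intro nn_integral_mono)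
    fix y
    have "ln v \<le> y" "y \<le> ln (v + W)" "exp (- (\<theta> * y)) \<le> v powr (-\<theta>)" if "v \<le> exp y" "exp y < v + W"
    proof -
      have "ln v \<le> ln (exp y)" using that v by (subst ln_le_cancel_iff) auto
      then show a: "ln v \<le> y" by simp
      have "ln (exp y) \<le> ln (v + W)" using that v W by (subst ln_le_cancel_iff) auto
      then show "y \<le> ln (v + W)" by simp
      show "exp (- (\<theta> * y)) \<le> v powr (-\<theta>)" using a v \<theta> by (simp add: powr_def)
    qed
    then show "ennreal (indicator {y. v \<le> exp y \<and> exp y < v + W} y * exp (- (\<theta> * y))) \<le> ennreal (v powr (-\<theta>)) * indicator {ln v .. ln (v + W)} y"
      by (auto simp: indicator_def intro!: ennreal_leI)
  qed
  also have "\<dots> = ennreal (v powr (-\<theta>)) * ennreal (ln (v + W) - ln v)"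
    using v W by (simp add: nn_integral_cmult)
  also have "\<dots> \<le> ennreal (v powr (-\<theta>)) * ennreal W"
  proof (intro mult_left_mono ennreal_leI)
    have "ln (v + W) - ln v = ln ((v + W) / v)" using v W by (simp add: ln_div)
    also have "\<dots> \<le> (v + W) / v - 1" using v W by (intro ln_le_minus_one) auto
    also have "\<dots> = W / v" using v by (simp add: field_simps)
    also have "\<dots> \<le> W / 1" using v W by (intro divide_left_mono) auto
    finally show "ln (v + W) - ln v \<le> W" by simp
  qed auto
  finally show ?thesis using W by (simp add: ennreal_mult[symmetric] mult.commute)
qed

text \<open>Coordinate i is integrated first, the others entering only through the sum of their
  exponentials. P stays open so that the region and the slab share this step.\<close>

lemma nn_integral_insert_region:
  fixes i :: nat and P :: "real \<Rightarrow> real \<Rightarrow> bool"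
  assumes K: "finite K" "i \<notin> K" and PM[measurable]: "Measurable.pred (borel \<Otimes>\<^sub>M borel) (\<lambda>z. P (fst z) (snd z))"
  shows "(\<integral>\<^sup>+c. ennreal (indicator {c. P (\<Sum>k\<in>K. exp (c k)) (c i)} c * exp (- (\<theta> * c i) + (\<Sum>k\<in>K. \<beta> k * c k))) \<partial>PiM (insert i K) (\<lambda>_. lborel))
   = (\<integral>\<^sup>+c. ennreal (exp (\<Sum>k\<in>K. \<beta> k * c k)) * (\<integral>\<^sup>+y. ennreal (indicator {y. P (\<Sum>k\<in>K. exp (c k)) y} y * exp (- (\<theta> * y))) \<partial>lborel) \<partial>PiM K (\<lambda>_. lborel))"
proof -
  have [measurable]: "Measurable.pred M (\<lambda>x. P (f x) (g x))" if [measurable]: "f \<in> borel_measurable M" "g \<in> borel_measurable M" for f g and M :: "'b measure"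
    using measurable_compose[OF measurable_Pair[OF that] PM] by simp
  have ne: "k \<noteq> i" if "k \<in> K" for k using that K by auto
  have *: "\<And>c y. (\<Sum>k\<in>K. exp (if k = i then y else c k)) = (\<Sum>k\<in>K. exp (c k :: real))"
     "\<And>c y. (\<Sum>k\<in>K. \<beta> k * (if k = i then y else c k)) = (\<Sum>k\<in>K. \<beta> k * c k)"
    using ne by (auto intro!: sum.cong)
  show ?thesis
    apply (subst lborel_PiM.product_nn_integral_insert[OF K])
    subgoal by measurable
    apply (intro nn_integral_cong)
    apply (subst nn_integral_cmult[symmetric])
    subgoal by measurable
    apply (intro nn_integral_cong)
    by (auto simp: indicator_def * ennreal_mult[symmetric] algebra_simps simp flip: exp_add)
qed

lemma nn_integral_region:
  assumes K: "finite K" "i \<notin> K" and \<beta>: "\<And>k. k \<in> K \<Longrightarrow> \<beta> k > 0" and \<theta>: "sum \<beta> K < \<theta>"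
  shows "(\<integral>\<^sup>+c. ennreal (indicator {c. 1 + (\<Sum>k\<in>K. exp (c k)) \<le> exp (c i)} c * exp (- (\<theta> * c i) + (\<Sum>k\<in>K. \<beta> k * c k))) \<partial>PiM (insert i K) (\<lambda>_. lborel))
     = ennreal (dirichlet_int K \<theta> \<beta> / \<theta>)"
proof -
  have \<theta>0: "\<theta> > 0"
    using sum_nonneg[of K \<beta>] \<beta> \<theta> by force
  have v: "1 + (\<Sum>k\<in>K. exp (c k)) > 0" for c :: "nat \<Rightarrow> real"
    by (smt (verit) exp_gt_zero sum_nonneg)
  have "(\<integral>\<^sup>+c. ennreal (indicator {c. 1 + (\<Sum>k\<in>K. exp (c k)) \<le> exp (c i)} c * exp (- (\<theta> * c i) + (\<Sum>k\<in>K. \<beta> k * c k))) \<partial>PiM (insert i K) (\<lambda>_. lborel))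
    = (\<integral>\<^sup>+c. ennreal (1 / \<theta>) * ennreal (exp (\<Sum>k\<in>K. \<beta> k * c k) * (1 + (\<Sum>k\<in>K. exp (c k))) powr (-\<theta>)) \<partial>PiM K (\<lambda>_. lborel))"
    apply (subst nn_integral_insert_region[OF K, where P = "\<lambda>s y. 1 + s \<le> exp y"])
    subgoal by measurable
    using \<theta>0 by (auto intro!: nn_integral_cong simp: nn_integral_exp_ray[OF v] ennreal_mult[symmetric])
  also have "\<dots> = ennreal (1 / \<theta>) * ennreal (dirichlet_int K \<theta> \<beta>)"
    by (subst nn_integral_cmult) (auto simp: nn_integral_dirichlet[OF K(1) \<beta> \<theta>])
  finally show ?thesis using \<theta>0 by (simp add: ennreal_mult'[symmetric])
qed

text \<open>Compared with the full region, the factor 1 / \<theta> is replaced by W. The loss is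
  affordable: \<theta> will be linear in t, while W will carry an exponentially small
  factor.\<close>

lemma nn_integral_slab:
  assumes K: "finite K" "i \<notin> K" and \<beta>: "\<And>k. k \<in> K \<Longrightarrow> \<beta> k > 0" and \<theta>: "sum \<beta> K < \<theta>" and W: "W \<ge> 0"
  shows "(\<integral>\<^sup>+c. ennreal (indicator {c. 1 + (\<Sum>k\<in>K. exp (c k)) \<le> exp (c i) \<and> exp (c i) < 1 + (\<Sum>k\<in>K. exp (c k)) + W} c * exp (- (\<theta> * c i) + (\<Sum>k\<in>K. \<beta> k * c k))) \<partial>PiM (insert i K) (\<lambda>_. lborel))
     \<le> ennreal (W * dirichlet_int K \<theta> \<beta>)"
proof -
  have \<theta>0: "\<theta> > 0"
    using sum_nonneg[of K \<beta>] \<beta> \<theta> by force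
  have v: "1 + (\<Sum>k\<in>K. exp (c k)) \<ge> 1" for c :: "nat \<Rightarrow> real"
    by (smt (verit) exp_gt_zero sum_nonneg)
  have "(\<integral>\<^sup>+c. ennreal (indicator {c. 1 + (\<Sum>k\<in>K. exp (c k)) \<le> exp (c i) \<and> exp (c i) < 1 + (\<Sum>k\<in>K. exp (c k)) + W} c * exp (- (\<theta> * c i) + (\<Sum>k\<in>K. \<beta> k * c k))) \<partial>PiM (insert i K) (\<lambda>_. lborel))
    \<le> (\<integral>\<^sup>+c. ennreal W * ennreal (exp (\<Sum>k\<in>K. \<beta> k * c k) * (1 + (\<Sum>k\<in>K. exp (c k))) powr (-\<theta>)) \<partial>PiM K (\<lambda>_. lborel))"
    apply (subst nn_integral_insert_region[OF K, where P = "\<lambda>s y. 1 + s \<le> exp y \<and> exp y < 1 + s + W"])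
    subgoal by measurable
    apply (rule nn_integral_mono)
    apply (rule order_trans[OF mult_left_mono[OF nn_integral_exp_slab[OF v \<theta>0 W]]])
    using W by (auto simp: ennreal_mult[symmetric] mult_ac)
  also have "\<dots> = ennreal W * ennreal (dirichlet_int K \<theta> \<beta>)"
    by (subst nn_integral_cmult) (auto simp: nn_integral_dirichlet[OF K(1) \<beta> \<theta>])
  finally show ?thesis using W by (simp add: ennreal_mult'[symmetric])
qed

section \<open>Elementary bounds for exponentials\<close>

text \<open>The fourth power is there because the square of the exponent contains the square of a
  quadratic form. The right side is 64 (exp y - exp (-y))^2 with y = |z| / 2, and exp y - exp (-y)
  >= y + y^2 / 2.\<close>

lemma square_fourth_le_cosh:
  fixes z :: real
  shows "z^2 + z^4 \<le> 64 * (exp z + exp (-z) - 2)"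
proof -
  define y where "y = \<bar>z\<bar> / 2"
  have y: "y \<ge> 0" by (simp add: y_def)
  have "y + y^2 / 2 \<le> exp y - exp (-y)"
  proof -
    have "exp (-y) \<le> 1" using y by simp
    then show ?thesis using exp_lower_Taylor_quadratic[OF y] by linarith
  qed
  then have "(y + y^2/2)^2 \<le> (exp y - exp (-y))^2"
    using y by (intro power_mono) auto
  also have "\<dots> = exp (2 * y) + exp (- 2 * y) - 2"
    by (simp add: power2_eq_square algebra_simps flip: exp_add)
  also have "\<dots> = exp z + exp (-z) - 2"
    by (auto simp: y_def abs_if)
  finally have "(y + y^2/2)^2 \<le> exp z + exp (-z) - 2" .
  moreover have "(y + y^2/2)^2 \<ge> y^2 + y^4 / 4"
    using y by (simp add: power2_eq_square power4_eq_xxxx algebra_simps)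
  moreover have "y^2 = z^2 / 4" "y^4 = z^4 / 16"
    by (simp_all add: y_def power_divide)
  ultimately have "z^2 / 4 + z^4 / 64 \<le> exp z + exp (-z) - 2" by simp
  then have "64 * (z^2 / 4 + z^4 / 64) \<le> 64 * (exp z + exp (-z) - 2)"
    by (intro mult_left_mono) auto
  moreover have "64 * (z^2 / 4 + z^4 / 64) = 16 * z^2 + z^4" by simp
  moreover have "z^2 + z^4 \<le> 16 * z^2 + z^4" by simp
  ultimately show ?thesis by linarith
qed

text \<open>The right side is the sum of the nonnegative numbers exp z - 1 - z and exp (-z) - 1 +
  z.\<close>

lemma abs_exp_minus_linear_le:
  fixes z :: real
  shows "\<bar>exp z - 1 - z\<bar> \<le> exp z + exp (-z) - 2"
  using exp_ge_add_one_self[of z] exp_ge_add_one_self[of "-z"] by linarith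

text \<open>The remainder has no quadratic bound as u tends to minus infinity; the floor -\<kappa>
  limits the loss to a factor exp \<kappa>.\<close>

lemma abs_exp_remainder_le:
  fixes u \<kappa> :: real
  assumes "\<kappa> \<ge> 0" "u \<ge> - \<kappa>"
  shows "\<bar>exp (-u) - 1 + u\<bar> \<le> exp \<kappa> * u^2"
proof -
  have nn: "exp (-u) - 1 + u \<ge> 0" using exp_ge_add_one_self[of "-u"] by simp
  show ?thesis
  proof (cases "u \<ge> 0")
    case True
    have "exp (-u) \<le> 1 / (1 + u)"
      using exp_ge_add_one_self[of u] True by (simp add: exp_minus field_simps)
    also have "\<dots> \<le> 1 - u + u^2"
      using True by (simp add: field_simps power2_eq_square)
    finally have "exp (-u) - 1 + u \<le> 1 * u^2" by simp
    also have "\<dots> \<le> exp \<kappa> * u^2" using assms by (intro mult_right_mono) auto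
    finally show ?thesis using nn by simp
  next
    case False
    have "exp (-u) * ((1 - u) * (1 + u)) \<le> exp (-u) * ((1 - u) * exp u)"
      using False exp_ge_add_one_self[of u] by (intro mult_left_mono) auto
    also have "\<dots> = 1 - u" by (simp add: algebra_simps flip: exp_add)
    finally have "exp (-u) - 1 + u \<le> exp (-u) * u^2"
      by (simp add: algebra_simps power2_eq_square)
    also have "\<dots> \<le> exp \<kappa> * u^2" using assms by (intro mult_right_mono) auto
    finally show ?thesis using nn by simp
  qed
qed

text \<open>The linear term is expressed through \<open>exp (z k) - 1\<close> and the remainder through \<open>exp (z k) + exp (- z k) - 2\<close>,
  because these are the functions whose integrals under the tilted measure are known in closed form.\<close>

lemma exp_quadratic_expansion:
  fixes P :: "'i \<Rightarrow> 'i \<Rightarrow> real" and \<beta> :: "'i \<Rightarrow> real"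
  assumes I: "finite I" and \<kappa>: "\<kappa> \<ge> 0"
    and lower: "\<And>z. - \<kappa> \<le> (\<Sum>k\<in>I. \<beta> k * z k) + (\<Sum>k\<in>I. \<Sum>l\<in>I. P k l * z k * z l) / 2"
  obtains C where "C \<ge> 0"
    and "\<And>z. \<bar>exp (- ((\<Sum>k\<in>I. \<beta> k * z k) + (\<Sum>k\<in>I. \<Sum>l\<in>I. P k l * z k * z l) / 2)) - 1 + (\<Sum>k\<in>I. \<beta> k * (exp (z k) - 1))\<bar>
           \<le> C * (\<Sum>k\<in>I. exp (z k) + exp (- z k) - 2)"
proof -
  \<comment> \<open>With s the sum of the |z k|, the linear part is at most b s and the quadratic
    part at most p s^2. Cauchy-Schwarz gives s^2 <= n sum z^2 and s^4 <= n^3 sum z^4, both at most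
    \<open>G\<close> times the sum of exp z + exp (-z) - 2. The summands of \<open>C\<close> pay for
    the remainder of the exponential, for the quadratic part, and for replacing z k by exp (z k) -
    1.\<close>
  define b where "b = (\<Sum>k\<in>I. \<bar>\<beta> k\<bar>)"
  define p where "p = (\<Sum>k\<in>I. \<Sum>l\<in>I. \<bar>P k l\<bar>) / 2"
  define n where "n = real (card I)"
  define G where "G = 64 * (n + n^3)"
  define C where "C = exp \<kappa> * ((2 * b^2 + 2 * p^2) * G) + p * G + b"
  have pos: "b \<ge> 0" "p \<ge> 0" "n \<ge> 0" "G \<ge> 0"
    by (auto simp: b_def p_def n_def G_def sum_nonneg)
  have bd: "\<bar>exp (- ((\<Sum>k\<in>I. \<beta> k * z k) + (\<Sum>k\<in>I. \<Sum>l\<in>I. P k l * z k * z l) / 2)) - 1 + (\<Sum>k\<in>I. \<beta> k * (exp (z k) - 1))\<bar>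
           \<le> C * (\<Sum>k\<in>I. exp (z k) + exp (- z k) - 2)" for z
  proof -
    define E where "E = (\<Sum>k\<in>I. exp (z k) + exp (- z k) - 2)"
    define s where "s = (\<Sum>k\<in>I. \<bar>z k\<bar>)"
    define lin where "lin = (\<Sum>k\<in>I. \<beta> k * z k)"
    define q where "q = (\<Sum>k\<in>I. \<Sum>l\<in>I. P k l * z k * z l) / 2"
    have s0: "s \<ge> 0" by (simp add: s_def sum_nonneg)
    have zs: "\<bar>z k\<bar> \<le> s" if "k \<in> I" for k
      unfolding s_def using that I by (intro member_le_sum) auto
    have z24: "(\<Sum>k\<in>I. (z k)^2 + (z k)^4) \<le> 64 * E"
      unfolding E_def sum_distrib_left by (intro sum_mono square_fourth_le_cosh)
    have z2: "(\<Sum>k\<in>I. (z k)^2) \<le> 64 * E" and z4: "(\<Sum>k\<in>I. (z k)^4) \<le> 64 * E"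
      using z24 sum_nonneg[of I "\<lambda>k. (z k)^2"] sum_nonneg[of I "\<lambda>k. (z k)^4"] by (auto simp: sum.distrib)
    have E0: "E \<ge> 0" using z2 sum_nonneg[of I "\<lambda>k. (z k)^2"] by auto
    have s2: "s^2 \<le> n * (\<Sum>k\<in>I. (z k)^2)"
      using sum_squared_le_sum_of_squares[of "\<lambda>k. \<bar>z k\<bar>" I] I by (simp add: s_def n_def mult.commute)
    have s2E: "s^2 \<le> G * E"
    proof -
      have "n * (\<Sum>k\<in>I. (z k)^2) \<le> n * (64 * E)" using z2 pos by (intro mult_left_mono)
      also have "\<dots> \<le> G * E" using pos E0 by (simp add: G_def algebra_simps)
      finally show ?thesis using s2 by simp
    qed
    have s4E: "s^4 \<le> G * E"
    proof -
      have "s^4 = (s^2)^2" by simp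
      also have "\<dots> \<le> (n * (\<Sum>k\<in>I. (z k)^2))^2" using s2 by (intro power_mono) auto
      also have "\<dots> = n^2 * (\<Sum>k\<in>I. (z k)^2)^2" by (simp add: power_mult_distrib)
      also have "\<dots> \<le> n^2 * (n * (\<Sum>k\<in>I. ((z k)^2)^2))"
        using sum_squared_le_sum_of_squares[of "\<lambda>k. (z k)^2" I] I by (intro mult_left_mono) (simp_all add: n_def mult.commute)
      also have "\<dots> = n^3 * (\<Sum>k\<in>I. (z k)^4)" by (simp add: power2_eq_square power3_eq_cube power4_eq_xxxx mult.assoc)
      also have "\<dots> \<le> n^3 * (64 * E)" using z4 pos by (intro mult_left_mono) auto
      also have "\<dots> \<le> G * E" using pos E0 by (simp add: G_def algebra_simps)
      finally show ?thesis .
    qed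
    have lin: "\<bar>lin\<bar> \<le> b * s"
      unfolding lin_def b_def sum_distrib_right
      by (rule order_trans[OF sum_abs]) (auto intro!: sum_mono mult_left_mono zs simp: abs_mult)
    have q: "\<bar>q\<bar> \<le> p * s^2"
    proof -
      have "\<bar>\<Sum>k\<in>I. \<Sum>l\<in>I. P k l * z k * z l\<bar> \<le> (\<Sum>k\<in>I. \<Sum>l\<in>I. \<bar>P k l * z k * z l\<bar>)"
        by (rule order_trans[OF sum_abs]) (intro sum_mono sum_abs)
      also have "\<dots> \<le> (\<Sum>k\<in>I. \<Sum>l\<in>I. \<bar>P k l\<bar> * s^2)"
        using zs by (intro sum_mono) (auto simp: abs_mult power2_eq_square mult.assoc intro!: mult_left_mono mult_mono s0)
      finally show ?thesis by (simp add: q_def p_def sum_distrib_right)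
    qed
    have u2: "(lin + q)^2 \<le> (2 * b^2 + 2 * p^2) * G * E"
    proof -
      have "(lin + q)^2 \<le> 2 * lin^2 + 2 * q^2"
        using zero_le_power2[of "lin - q"] by (simp add: power2_eq_square algebra_simps)
      also have "lin^2 \<le> (b * s)^2" using lin s0 pos by (metis abs_ge_zero power2_abs power_mono)
      also have "q^2 \<le> (p * s^2)^2" using q s0 pos by (metis abs_ge_zero power2_abs power_mono)
      finally have "(lin + q)^2 \<le> 2 * b^2 * s^2 + 2 * p^2 * s^4"
        by (simp add: power_mult_distrib)
      also have "\<dots> \<le> 2 * b^2 * (G * E) + 2 * p^2 * (G * E)"
        using s2E s4E by (intro add_mono mult_left_mono) auto
      finally show ?thesis by (simp add: algebra_simps)
    qed
    have r1: "\<bar>exp (- (lin + q)) - 1 + (lin + q)\<bar> \<le> exp \<kappa> * ((2 * b^2 + 2 * p^2) * G * E)"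
      using lower[of z] u2 by (intro order_trans[OF abs_exp_remainder_le[OF \<kappa>]] mult_left_mono) (auto simp: lin_def q_def)
    have r2: "\<bar>q\<bar> \<le> p * (G * E)"
      using q mult_left_mono[OF s2E, of p] pos by linarith
    have r3: "\<bar>\<Sum>k\<in>I. \<beta> k * (exp (z k) - 1 - z k)\<bar> \<le> b * E"
    proof -
      have bk: "\<bar>\<beta> k\<bar> \<le> b" if "k \<in> I" for k
        unfolding b_def using that I by (intro member_le_sum) auto
      have "\<bar>\<Sum>k\<in>I. \<beta> k * (exp (z k) - 1 - z k)\<bar> \<le> (\<Sum>k\<in>I. b * (exp (z k) + exp (- z k) - 2))"
        using bk pos abs_exp_minus_linear_le
        by (intro order_trans[OF sum_abs] sum_mono) (auto simp: abs_mult intro!: mult_mono)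
      then show ?thesis by (simp add: E_def sum_distrib_left)
    qed
    have "exp (- (lin + q)) - 1 + (\<Sum>k\<in>I. \<beta> k * (exp (z k) - 1))
      = (exp (- (lin + q)) - 1 + (lin + q)) - q + (\<Sum>k\<in>I. \<beta> k * (exp (z k) - 1 - z k))"
      by (simp add: lin_def algebra_simps sum_subtractf sum.distrib)
    then have "\<bar>exp (- (lin + q)) - 1 + (\<Sum>k\<in>I. \<beta> k * (exp (z k) - 1))\<bar>
      \<le> exp \<kappa> * ((2 * b^2 + 2 * p^2) * G * E) + p * (G * E) + b * E"
      using r1 r2 r3 by linarith
    also have "\<dots> = C * E" by (simp add: C_def algebra_simps)
    finally show ?thesis by (simp add: lin_def q_def E_def)
  qed
  show ?thesis
    by (rule that[OF _ bd]) (use pos in \<open>auto simp: C_def\<close>)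
qed

lemma dirichlet_int_pos:
  assumes "\<And>k. k \<in> K \<Longrightarrow> \<beta> k > 0" "sum \<beta> K < \<theta>"
  shows "dirichlet_int K \<theta> \<beta> > 0"
proof -
  have "\<theta> > 0"
    using sum_nonneg[of K \<beta>] assms by force
  then show ?thesis
    using assms by (auto simp: dirichlet_int_def intro!: divide_pos_pos mult_pos_pos prod_pos)
qed

text \<open>Bochner form of the region integral, since the moments are later combined with
  coefficients of either sign.\<close>

lemma has_bochner_integral_region:
  assumes K: "finite K" "i \<notin> K" and \<beta>: "\<And>k. k \<in> K \<Longrightarrow> \<beta> k > 0" and \<theta>: "sum \<beta> K < \<theta>"
  shows "has_bochner_integral (PiM (insert i K) (\<lambda>_. lborel))
     (\<lambda>c. indicator {c. 1 + (\<Sum>k\<in>K. exp (c k)) \<le> exp (c i)} c * exp (- (\<theta> * c i) + (\<Sum>k\<in>K. \<beta> k * c k)))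
     (dirichlet_int K \<theta> \<beta> / \<theta>)"
proof (rule has_bochner_integral_nn_integral)
  have \<theta>0: "\<theta> > 0"
    using sum_nonneg[of K \<beta>] \<beta> \<theta> by force
  show "0 \<le> dirichlet_int K \<theta> \<beta> / \<theta>"
    using \<theta>0 dirichlet_int_pos[OF \<beta> \<theta>] by simp
  show "(\<lambda>c. indicator {c. 1 + (\<Sum>k\<in>K. exp (c k)) \<le> exp (c i)} c * exp (- (\<theta> * c i) + (\<Sum>k\<in>K. \<beta> k * c k)))
    \<in> borel_measurable (PiM (insert i K) (\<lambda>_. lborel))"
  proof -
    have [measurable]: "Measurable.pred (PiM (insert i K) (\<lambda>_. lborel)) (\<lambda>c. 1 + (\<Sum>k\<in>K. exp (c k)) \<le> exp (c i :: real))"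
      unfolding pred_def by (rule borel_measurable_le) measurable
    show ?thesis by measurable
  qed
qed (use nn_integral_region[OF assms] in auto)

section \<open>Moments of the tilted measure\<close>

lemma Gamma_real_add_one: "Gamma (x + 1) = x * Gamma x" if "x > 0" for x :: real
  using that by (intro Gamma_plus1) (auto elim!: nonpos_Ints_cases)

lemma sum_fun_upd_add:
  fixes \<beta> :: "'i \<Rightarrow> real"
  assumes "finite K" "k \<in> K"
  shows "(\<Sum>j\<in>K. (\<beta>(k := \<beta> k + e)) j * c j) = (\<Sum>j\<in>K. \<beta> j * c j) + e * c k"
  using assms by (simp add: sum.remove[of K k] algebra_simps)

text \<open>The effect of multiplying the integrand by exp (c k): Gamma (x + 1) = x Gamma x is
  applied to the raised weight and to the lowered difference \<theta> - sum.\<close>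

lemma dirichlet_int_shift_weight:
  assumes K: "finite K" "k \<in> K" and \<beta>: "\<And>k. k \<in> K \<Longrightarrow> \<beta> k > 0" and \<theta>: "sum \<beta> K + 1 < \<theta>"
  shows "dirichlet_int K \<theta> (\<beta>(k := \<beta> k + 1)) = dirichlet_int K \<theta> \<beta> * (\<beta> k / (\<theta> - sum \<beta> K - 1))"
proof -
  have s: "sum (\<beta>(k := \<beta> k + 1)) K = sum \<beta> K + 1"
    using sum_fun_upd_add[OF K, of \<beta> 1 "\<lambda>_. 1"] by simp
  have p: "(\<Prod>j\<in>K. Gamma ((\<beta>(k := \<beta> k + 1)) j)) = \<beta> k * (\<Prod>j\<in>K. Gamma (\<beta> j))"
    using K \<beta> by (simp add: prod.remove[of K k] Gamma_real_add_one)
  have g: "Gamma (\<theta> - sum \<beta> K) = (\<theta> - sum \<beta> K - 1) * Gamma (\<theta> - sum \<beta> K - 1)"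
    using Gamma_real_add_one[of "\<theta> - sum \<beta> K - 1"] \<theta> by simp
  have s': "\<theta> - (sum \<beta> K + 1) = \<theta> - sum \<beta> K - 1" by simp
  show ?thesis
    unfolding dirichlet_int_def s p g s' using \<theta> by simp
qed

text \<open>The effect of multiplying the integrand by exp (c i). The division by the exponent is
  kept because the region integral has that form.\<close>

lemma dirichlet_int_shift_exponent:
  assumes K: "finite K" and \<beta>: "\<And>k. k \<in> K \<Longrightarrow> \<beta> k > 0" and \<theta>: "sum \<beta> K + 1 < \<theta>"
  shows "dirichlet_int K (\<theta> - 1) \<beta> / (\<theta> - 1) = dirichlet_int K \<theta> \<beta> / (\<theta> - sum \<beta> K - 1)"
proof -
  have \<theta>1: "\<theta> > 1"
    using sum_nonneg[of K \<beta>] \<beta> \<theta> by force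
  have g: "Gamma (\<theta> - sum \<beta> K) = (\<theta> - sum \<beta> K - 1) * Gamma (\<theta> - sum \<beta> K - 1)"
    using Gamma_real_add_one[of "\<theta> - sum \<beta> K - 1"] \<theta> by simp
  have g': "Gamma \<theta> = (\<theta> - 1) * Gamma (\<theta> - 1)"
    using Gamma_real_add_one[of "\<theta> - 1"] \<theta>1 by simp
  have s': "\<theta> - 1 - sum \<beta> K = \<theta> - sum \<beta> K - 1" by simp
  show ?thesis
    unfolding dirichlet_int_def g g' s' using \<theta> by (simp add: mult_ac)
qed

text \<open>The event after the shift and division by exp t, with the contribution of the inactive
  coordinates dropped.\<close>

definition region :: "nat set \<Rightarrow> nat \<Rightarrow> (nat \<Rightarrow> real) set" where
  "region K i = {c. 1 + (\<Sum>k\<in>K. exp (c k)) \<le> exp (c i)}"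

definition tilt :: "nat set \<Rightarrow> nat \<Rightarrow> (nat \<Rightarrow> real) \<Rightarrow> real \<Rightarrow> (nat \<Rightarrow> real) \<Rightarrow> real" where
  "tilt K i A t c = indicator (region K i) c * exp (- (t * (\<Sum>k\<in>insert i K. A k * c k)))"

text \<open>Total mass of \<open>tilt\<close> in closed form, as
  \<open>has_bochner_integral_tilt\<close> confirms.\<close>

definition tilt_mass :: "nat set \<Rightarrow> nat \<Rightarrow> (nat \<Rightarrow> real) \<Rightarrow> real \<Rightarrow> real" where
  "tilt_mass K i A t = dirichlet_int K (t * A i) (\<lambda>k. - (t * A k)) / (t * A i)"

lemma region_measurable[measurable]: "Measurable.pred (PiM (insert i K) (\<lambda>_. lborel)) (\<lambda>c. c \<in> region K i)"
  unfolding region_def mem_Collect_eq pred_def by (rule borel_measurable_le) measurable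

text \<open>These signs, inherited from the minimizer, make the weights - t A k positive and the
  last Gamma argument equal to t S > 0, so that the Dirichlet formula applies.\<close>

locale region_tilt =
  fixes K :: "nat set" and i :: nat and A :: "nat \<Rightarrow> real"
  assumes K: "finite K" "i \<notin> K" and Aneg: "\<And>k. k \<in> K \<Longrightarrow> A k < 0" and S_pos: "sum A (insert i K) > 0"
begin

abbreviation I where "I \<equiv> insert i K"
abbreviation S where "S \<equiv> sum A I"
abbreviation L where "L \<equiv> PiM I (\<lambda>_. lborel :: real measure)"

definition opt :: "nat \<Rightarrow> real" where "opt k = ln (\<bar>A k\<bar> / S)"

lemma S_eq: "S = A i + sum A K" using K by simp

lemma A_i: "A i \<ge> S" "A i > 0"
  using sum_nonpos[of K A] Aneg S_pos unfolding S_eq by force+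

lemma A_nz: "k \<in> I \<Longrightarrow> A k \<noteq> 0"
  using Aneg A_i by fastforce

lemma weights:
  assumes "t > 0"
  shows "\<And>k. k \<in> K \<Longrightarrow> - (t * A k) > 0" "t * A i - (\<Sum>k\<in>K. - (t * A k)) = t * S" "(\<Sum>k\<in>K. - (t * A k)) < t * A i"
proof -
  show "t * A i - (\<Sum>k\<in>K. - (t * A k)) = t * S"
    by (simp add: S_eq sum_negf sum_distrib_left distrib_left)
  then show "(\<Sum>k\<in>K. - (t * A k)) < t * A i"
    using mult_pos_pos[OF assms S_pos] by linarith
qed (use assms Aneg in \<open>auto simp: mult_less_0_iff\<close>)

lemma tilt_mass_pos: "t > 0 \<Longrightarrow> tilt_mass K i A t > 0"
  unfolding tilt_mass_def using A_i weights by (intro divide_pos_pos dirichlet_int_pos) auto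

lemma tilt_eq: "tilt K i A t c = indicator (region K i) c * exp (- (t * A i * c i) + (\<Sum>k\<in>K. - (t * A k) * c k))"
  unfolding tilt_def using K by (simp add: sum_negf sum_distrib_left algebra_simps)

lemma tilt_nonneg: "tilt K i A t c \<ge> 0"
  by (simp add: tilt_def)

lemma tilt_measurable[measurable]: "tilt K i A t \<in> borel_measurable L"
proof -
  show ?thesis unfolding tilt_def by measurable
qed

lemma has_bochner_integral_tilt:
  assumes "t > 0"
  shows "has_bochner_integral L (tilt K i A t) (tilt_mass K i A t)"
  using has_bochner_integral_region[OF K weights(1,3)[OF assms]]
  unfolding tilt_mass_def tilt_eq[abs_def] region_def by simp

text \<open>One argument shifts by one, and exp (- opt k) = S / |A k| cancels the dependence on k,
  so the same ratio appears for every k. The condition t S > 1 keeps the lowered parameter t S - 1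
  positive.\<close>

lemma has_bochner_integral_tilt_exp_pos:
  assumes t: "t > 0" "t * S > 1" and k: "k \<in> I"
  shows "has_bochner_integral L (\<lambda>c. tilt K i A t c * exp (c k - opt k)) (tilt_mass K i A t * (t * S / (t * S - 1)))"
proof -
  let ?\<beta> = "\<lambda>k. - (t * A k)"
  have sum1: "sum ?\<beta> K + 1 < t * A i" using weights(2)[OF t(1)] t by linarith
  have e: "exp (- opt k) = S / \<bar>A k\<bar>"
    unfolding opt_def using S_pos A_nz[OF k] by (simp add: exp_minus)
  have TS: "t * A i - sum ?\<beta> K - 1 = t * S - 1" using weights(2)[OF t(1)] by simp
  show ?thesis
  proof (cases "k = i")
    case True
    have "has_bochner_integral L (\<lambda>c. indicator (region K i) c * exp (- ((t * A i - 1) * c i) + (\<Sum>k\<in>K. ?\<beta> k * c k)))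
       (dirichlet_int K (t * A i - 1) ?\<beta> / (t * A i - 1))"
      unfolding region_def using K weights[OF t(1)] sum1 by (intro has_bochner_integral_region) auto
    then have "has_bochner_integral L (\<lambda>c. indicator (region K i) c * exp (- ((t * A i - 1) * c i) + (\<Sum>k\<in>K. ?\<beta> k * c k)) * exp (- opt k))
       (dirichlet_int K (t * A i - 1) ?\<beta> / (t * A i - 1) * exp (- opt k))"
      by (rule has_bochner_integral_mult_left)
    moreover have "indicator (region K i) c * exp (- ((t * A i - 1) * c i) + (\<Sum>k\<in>K. ?\<beta> k * c k)) * exp (- opt k)
      = tilt K i A t c * exp (c k - opt k)" for c
      unfolding tilt_eq True by (simp add: algebra_simps flip: exp_add)
    moreover have "dirichlet_int K (t * A i - 1) ?\<beta> / (t * A i - 1) * exp (- opt k) = tilt_mass K i A t * (t * S / (t * S - 1))"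
      unfolding e tilt_mass_def using sum1 weights(1)[OF t(1)] K A_i t
      by (subst dirichlet_int_shift_exponent) (auto simp: TS True)
    ultimately show ?thesis by simp
  next
    case False
    then have kK: "k \<in> K" using k by simp
    let ?\<beta>' = "?\<beta>(k := ?\<beta> k + 1)"
    have s: "sum ?\<beta>' K = sum ?\<beta> K + 1"
      using sum_fun_upd_add[OF K(1) kK, of ?\<beta> 1 "\<lambda>_. 1"] by simp
    have "has_bochner_integral L (\<lambda>c. indicator (region K i) c * exp (- (t * A i * c i) + (\<Sum>k\<in>K. ?\<beta>' k * c k)))
       (dirichlet_int K (t * A i) ?\<beta>' / (t * A i))"
      unfolding region_def using K weights(1)[OF t(1)] weights(1)[OF t(1) kK] sum1 s by (intro has_bochner_integral_region) auto
    then have "has_bochner_integral L (\<lambda>c. indicator (region K i) c * exp (- (t * A i * c i) + (\<Sum>k\<in>K. ?\<beta>' k * c k)) * exp (- opt k))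
       (dirichlet_int K (t * A i) ?\<beta>' / (t * A i) * exp (- opt k))"
      by (rule has_bochner_integral_mult_left)
    moreover have "indicator (region K i) c * exp (- (t * A i * c i) + (\<Sum>k\<in>K. ?\<beta>' k * c k)) * exp (- opt k)
      = tilt K i A t c * exp (c k - opt k)" for c
      unfolding tilt_eq sum_fun_upd_add[OF K(1) kK, of ?\<beta>] by (simp add: algebra_simps flip: exp_add)
    moreover have "dirichlet_int K (t * A i) ?\<beta>' / (t * A i) * exp (- opt k) = tilt_mass K i A t * (t * S / (t * S - 1))"
      unfolding e tilt_mass_def using sum1 weights(1)[OF t(1)] K A_i t Aneg[OF kK]
      by (subst dirichlet_int_shift_weight[OF K(1) kK]) (auto simp: TS abs_of_neg simp del: sum.insert)
    ultimately show ?thesis by simp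
  qed
qed

text \<open>The ratio now depends on k: it is t A i / (t A i + 1) for k = i and t |A k| / (t |A k| -
  1) on K. One bound covers both cases.\<close>

lemma has_bochner_integral_tilt_exp_neg:
  assumes t: "t > 0" "t * \<bar>A k\<bar> > 1" and k: "k \<in> I"
  obtains \<rho> where "has_bochner_integral L (\<lambda>c. tilt K i A t c * exp (- (c k - opt k))) (tilt_mass K i A t * \<rho>)"
    "\<bar>\<rho> - 1\<bar> \<le> 1 / (t * \<bar>A k\<bar> - 1)"
proof -
  let ?\<beta> = "\<lambda>k. - (t * A k)"
  have e: "exp (opt k) = \<bar>A k\<bar> / S"
    unfolding opt_def using S_pos A_nz[OF k] by simp
  show ?thesis
  proof (cases "k = i")
    case True
    have "has_bochner_integral L (\<lambda>c. indicator (region K i) c * exp (- ((t * A i + 1) * c i) + (\<Sum>k\<in>K. ?\<beta> k * c k)))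
       (dirichlet_int K (t * A i + 1) ?\<beta> / (t * A i + 1))"
      unfolding region_def using K weights[OF t(1)] by (intro has_bochner_integral_region) auto
    then have "has_bochner_integral L (\<lambda>c. indicator (region K i) c * exp (- ((t * A i + 1) * c i) + (\<Sum>k\<in>K. ?\<beta> k * c k)) * exp (opt k))
       (dirichlet_int K (t * A i + 1) ?\<beta> / (t * A i + 1) * exp (opt k))"
      by (rule has_bochner_integral_mult_left)
    moreover have "indicator (region K i) c * exp (- ((t * A i + 1) * c i) + (\<Sum>k\<in>K. ?\<beta> k * c k)) * exp (opt k)
      = tilt K i A t c * exp (- (c k - opt k))" for c
      unfolding tilt_eq True by (simp add: algebra_simps flip: exp_add)
    moreover have "dirichlet_int K (t * A i + 1) ?\<beta> / (t * A i + 1) * exp (opt k) = tilt_mass K i A t * (t * A i / (t * A i + 1))"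
    proof -
      \<comment> \<open>The exponent shift is used one unit above t A i and solved for the larger
        exponent.\<close>
      have "dirichlet_int K (t * A i + 1 - 1) ?\<beta> / (t * A i + 1 - 1) = dirichlet_int K (t * A i + 1) ?\<beta> / (t * A i + 1 - sum ?\<beta> K - 1)"
        using K weights[OF t(1)] by (intro dirichlet_int_shift_exponent) auto
      moreover have "t * A i + 1 - sum ?\<beta> K - 1 = t * S" using weights(2)[OF t(1)] by simp
      ultimately have "dirichlet_int K (t * A i + 1) ?\<beta> = tilt_mass K i A t * (t * S)"
        using t S_pos by (simp add: tilt_mass_def field_simps)
      moreover have "exp (opt k) = A i / S" using e True A_i by simp
      ultimately show ?thesis using S_pos by simp
    qed
    ultimately have "has_bochner_integral L (\<lambda>c. tilt K i A t c * exp (- (c k - opt k))) (tilt_mass K i A t * (t * A i / (t * A i + 1)))"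
      by (simp only:)
    moreover have "\<bar>t * A i / (t * A i + 1) - 1\<bar> \<le> 1 / (t * \<bar>A k\<bar> - 1)"
    proof -
      have tA: "t * A i > 0" using t A_i by simp
      then have "t * A i / (t * A i + 1) - 1 = - (1 / (t * A i + 1))"
        by (simp add: divide_simps)
      then have "\<bar>t * A i / (t * A i + 1) - 1\<bar> = 1 / (t * A i + 1)"
        using tA by simp
      also have "\<dots> \<le> 1 / (t * \<bar>A k\<bar> - 1)"
        using t A_i True by (intro divide_left_mono) auto
      finally show ?thesis .
    qed
    ultimately show ?thesis using that by blast
  next
    case False
    then have kK: "k \<in> K" using k by simp
    \<comment> \<open>The weight is lowered by adding - 1 so that \<open>sum_fun_upd_add\<close>
      applies; the weight shift is then read backwards from \<open>?\<beta>'\<close>.\<close>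
    let ?\<beta>' = "?\<beta>(k := ?\<beta> k + - 1)"
    have Ak: "\<bar>A k\<bar> = - A k" using Aneg[OF kK] by simp
    have s: "sum ?\<beta>' K = sum ?\<beta> K - 1"
      using sum_fun_upd_add[OF K(1) kK, of ?\<beta> "- 1" "\<lambda>_. 1"] by simp
    have pos': "?\<beta>' j > 0" if "j \<in> K" for j
      using t Ak weights(1)[OF t(1) that] by (auto simp: algebra_simps)
    have "has_bochner_integral L (\<lambda>c. indicator (region K i) c * exp (- (t * A i * c i) + (\<Sum>k\<in>K. ?\<beta>' k * c k)))
       (dirichlet_int K (t * A i) ?\<beta>' / (t * A i))"
      unfolding region_def using weights(3)[OF t(1)] s by (intro has_bochner_integral_region K pos') auto
    then have "has_bochner_integral L (\<lambda>c. indicator (region K i) c * exp (- (t * A i * c i) + (\<Sum>k\<in>K. ?\<beta>' k * c k)) * exp (opt k))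
       (dirichlet_int K (t * A i) ?\<beta>' / (t * A i) * exp (opt k))"
      by (rule has_bochner_integral_mult_left)
    moreover have "indicator (region K i) c * exp (- (t * A i * c i) + (\<Sum>k\<in>K. ?\<beta>' k * c k)) * exp (opt k)
      = tilt K i A t c * exp (- (c k - opt k))" for c
      unfolding tilt_eq sum_fun_upd_add[OF K(1) kK, of ?\<beta>] by (simp add: algebra_simps flip: exp_add)
    moreover have "dirichlet_int K (t * A i) ?\<beta>' / (t * A i) * exp (opt k) = tilt_mass K i A t * (t * \<bar>A k\<bar> / (t * \<bar>A k\<bar> - 1))"
    proof -
      have "dirichlet_int K (t * A i) (?\<beta>'(k := ?\<beta>' k + 1)) = dirichlet_int K (t * A i) ?\<beta>' * (?\<beta>' k / (t * A i - sum ?\<beta>' K - 1))"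
        using weights(3)[OF t(1)] s by (intro dirichlet_int_shift_weight K(1) kK pos') auto
      moreover have "?\<beta>'(k := ?\<beta>' k + 1) = ?\<beta>" by auto
      moreover have "t * A i - sum ?\<beta>' K - 1 = t * S" using weights(2)[OF t(1)] s by simp
      ultimately have "dirichlet_int K (t * A i) ?\<beta> = dirichlet_int K (t * A i) ?\<beta>' * ((t * \<bar>A k\<bar> - 1) / (t * S))"
        using Ak by simp
      then have "dirichlet_int K (t * A i) ?\<beta>' = dirichlet_int K (t * A i) ?\<beta> * (t * S / (t * \<bar>A k\<bar> - 1))"
        using t S_pos by simp
      then show ?thesis unfolding e tilt_mass_def using S_pos by simp
    qed
    ultimately have "has_bochner_integral L (\<lambda>c. tilt K i A t c * exp (- (c k - opt k))) (tilt_mass K i A t * (t * \<bar>A k\<bar> / (t * \<bar>A k\<bar> - 1)))"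
      by simp
    moreover have "\<bar>t * \<bar>A k\<bar> / (t * \<bar>A k\<bar> - 1) - 1\<bar> \<le> 1 / (t * \<bar>A k\<bar> - 1)"
      using t(2) by (simp add: field_simps abs_if)
    ultimately show ?thesis using that by blast
  qed
qed
end

section \<open>Gaussian weights under the tilted measure\<close>

context region_tilt begin

text \<open>Expansion about \<open>opt\<close>: the linear term enters as exp (c k - opt k) - 1,
  whose tilted mean is exactly 1 / (t S - 1). The remainder is dominated by functions whose tilted
  means are O(1/t) by the two moment lemmas.\<close>

lemma laplace_tilt:
  fixes P :: "nat \<Rightarrow> nat \<Rightarrow> real" and m :: "nat \<Rightarrow> real"
  defines "q \<equiv> \<lambda>d. \<Sum>k\<in>I. \<Sum>l\<in>I. P k l * d k * d l"
  defines "\<phi> \<equiv> \<lambda>c. exp (- q (\<lambda>k. c k - m k) / 2)"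
  assumes q_nonneg: "\<And>d. q d \<ge> 0"
  obtains C T V where "T > 0"
    and "\<And>t. t \<ge> T \<Longrightarrow> has_bochner_integral L (\<lambda>c. tilt K i A t c * \<phi> c) (V t)"
    and "\<And>t. t \<ge> T \<Longrightarrow> \<bar>V t - \<phi> opt * tilt_mass K i A t\<bar> \<le> C / t * tilt_mass K i A t"
proof -
  define d0 where "d0 = (\<lambda>k. opt k - m k)"
  \<comment> \<open>Gradient of q / 2 at \<open>d0\<close>, symmetrized because P is an arbitrary
    array. \<open>\<kappa>\<close> serves as the floor of the expansion: nonnegativity of q at d0 +
    z bounds the rest of the exponent below by -\<kappa>.\<close>
  define \<beta> where "\<beta> k = (\<Sum>l\<in>I. (P k l + P l k) * d0 l) / 2" for k
  define \<kappa> where "\<kappa> = q d0 / 2"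
  have fin: "finite I" using K by simp
  have qadd: "q (\<lambda>k. d0 k + z k) / 2 = q d0 / 2 + ((\<Sum>k\<in>I. \<beta> k * z k) + q z / 2)" for z
  proof -
    have "q (\<lambda>k. d0 k + z k) = q d0 + (\<Sum>k\<in>I. \<Sum>l\<in>I. P k l * d0 k * z l) + (\<Sum>k\<in>I. \<Sum>l\<in>I. P k l * z k * d0 l) + q z"
      by (simp add: q_def sum.distrib algebra_simps)
    also have "(\<Sum>k\<in>I. \<Sum>l\<in>I. P k l * d0 k * z l) = (\<Sum>k\<in>I. \<Sum>l\<in>I. P l k * d0 l * z k)"
      by (rule sum.swap)
    finally have "q (\<lambda>k. d0 k + z k) = q d0 + ((\<Sum>k\<in>I. \<Sum>l\<in>I. P l k * d0 l * z k) + (\<Sum>k\<in>I. \<Sum>l\<in>I. P k l * z k * d0 l)) + q z"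
      by linarith
    also have "(\<Sum>k\<in>I. \<Sum>l\<in>I. P l k * d0 l * z k) + (\<Sum>k\<in>I. \<Sum>l\<in>I. P k l * z k * d0 l) = (\<Sum>k\<in>I. 2 * (\<beta> k * z k))"
      unfolding sum.distrib[symmetric] by (rule sum.cong) (simp_all add: \<beta>_def sum_distrib_left algebra_simps)
    finally show ?thesis
      by (simp add: sum_distrib_left[symmetric] del: sum.insert)
  qed
  have \<kappa>: "\<kappa> \<ge> 0" using q_nonneg by (simp add: \<kappa>_def)
  have lower: "- \<kappa> \<le> (\<Sum>k\<in>I. \<beta> k * z k) + (\<Sum>k\<in>I. \<Sum>l\<in>I. P k l * z k * z l) / 2" for z
    using qadd[of z] q_nonneg[of "\<lambda>k. d0 k + z k"] by (simp add: \<kappa>_def q_def)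
  obtain C where C: "C \<ge> 0"
    and bd: "\<And>z. \<bar>exp (- ((\<Sum>k\<in>I. \<beta> k * z k) + (\<Sum>k\<in>I. \<Sum>l\<in>I. P k l * z k * z l) / 2)) - 1 + (\<Sum>k\<in>I. \<beta> k * (exp (z k) - 1))\<bar>
           \<le> C * (\<Sum>k\<in>I. exp (z k) + exp (- z k) - 2)"
    using exp_quadratic_expansion[OF fin \<kappa> lower] by blast
  define \<psi> where "\<psi> c = exp (- ((\<Sum>k\<in>I. \<beta> k * (c k - opt k)) + q (\<lambda>k. c k - opt k) / 2))" for c
  have \<phi>\<psi>: "\<phi> c = \<phi> opt * \<psi> c" for c
  proof -
    have "(\<lambda>k. d0 k + (c k - opt k)) = (\<lambda>k. c k - m k)" by (simp add: d0_def)
    from qadd[of "\<lambda>k. c k - opt k", unfolded this] have eq: "- q (\<lambda>k. c k - m k) / 2 = - q d0 / 2 + - ((\<Sum>k\<in>I. \<beta> k * (c k - opt k)) + q (\<lambda>k. c k - opt k) / 2)"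
      by linarith
    show ?thesis unfolding \<phi>_def \<psi>_def eq exp_add d0_def ..
  qed
  \<comment> \<open>A common lower bound for S and all |A k|. From T = 2 / a on, t b - 1 >= t a / 2
    for each such b, so every moment exists and its ratio differs from 1 by at most 2 / (a
    t).\<close>
  define a where "a = Min ((\<lambda>k. \<bar>A k\<bar>) ` I \<union> {S})"
  have a: "a > 0" "a \<le> S" "\<And>k. k \<in> I \<Longrightarrow> a \<le> \<bar>A k\<bar>"
  proof -
    have f: "finite ((\<lambda>k. \<bar>A k\<bar>) ` I \<union> {S})" using fin by simp
    show "a > 0" unfolding a_def using f A_nz S_pos by (subst Min_gr_iff) auto
    show "a \<le> S" unfolding a_def using f by (intro Min_le) auto
    show "a \<le> \<bar>A k\<bar>" if "k \<in> I" for k unfolding a_def using f that by (intro Min_le) auto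
  qed
  define T where "T = 2 / a"
  have Tpos: "T > 0" using a by (simp add: T_def)
  have ta: "t * b \<ge> 2" "1 / (t * b - 1) \<le> 2 / (a * t)" if "t \<ge> T" "a \<le> b" for t b
  proof -
    have t: "t > 0" using that Tpos by simp
    have ta: "t * a \<ge> 2" using that a by (simp add: T_def field_simps mult.commute)
    also have "t * a \<le> t * b" using that t by simp
    finally show tb: "t * b \<ge> 2" .
    have "t * a / 2 \<le> t * a - 1" using ta by linarith
    also have "\<dots> \<le> t * b - 1" using that t by simp
    finally have "1 / (t * b - 1) \<le> 1 / (t * a / 2)"
      using tb ta by (intro divide_left_mono mult_pos_pos) linarith+
    moreover have "1 / (t * a / 2) = 2 / (a * t)" by (simp add: mult.commute)
    ultimately show "1 / (t * b - 1) \<le> 2 / (a * t)" by (simp only:)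
  qed
  \<comment> \<open>The first summand pays for the linear term; in the second each coordinate
    contributes 2 / a from each of its two exponentials.\<close>
  define D where "D = (\<Sum>k\<in>I. \<bar>\<beta> k\<bar>) * (2 / a) + C * (card I * (4 / a))"
  have q_meas[measurable]: "(\<lambda>c. q (\<lambda>k. c k - y k)) \<in> borel_measurable L" for y
    unfolding q_def by measurable
  have \<psi>_meas[measurable]: "\<psi> \<in> borel_measurable L"
    unfolding \<psi>_def by measurable
  have \<phi>_meas[measurable]: "\<phi> \<in> borel_measurable L"
    unfolding \<phi>_def by measurable
  have key: "integrable L (\<lambda>c. tilt K i A t c * \<psi> c) \<and>
     \<bar>(\<integral>c. tilt K i A t c * \<psi> c \<partial>L) - tilt_mass K i A t\<bar> \<le> D / t * tilt_mass K i A t" if t: "t \<ge> T" for t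
  proof -
    have t0: "t > 0" using t Tpos by simp
    let ?w = "tilt K i A t" and ?N = "tilt_mass K i A t"
    have N: "?N > 0" by (rule tilt_mass_pos[OF t0])
    define \<rho>p where "\<rho>p = t * S / (t * S - 1)"
    have tS: "t * S \<ge> 2" using ta[OF t a(2)] by simp
    have "\<rho>p - 1 = 1 / (t * S - 1)"
    proof -
      have "x / (x - 1) - 1 = 1 / (x - 1)" if "x \<ge> 2" for x :: real
        using that by (simp add: divide_simps)
      from this[OF tS] show ?thesis by (simp add: \<rho>p_def)
    qed
    then have \<rho>p: "\<bar>\<rho>p - 1\<bar> \<le> 2 / (a * t)"
      using ta(2)[OF t a(2)] tS by simp
    have pos: "has_bochner_integral L (\<lambda>c. ?w c * exp (c k - opt k)) (?N * \<rho>p)" if "k \<in> I" for k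
      unfolding \<rho>p_def by (rule has_bochner_integral_tilt_exp_pos[OF t0 _ that]) (use tS in linarith)
    have "\<exists>\<rho>. has_bochner_integral L (\<lambda>c. ?w c * exp (- (c k - opt k))) (?N * \<rho>) \<and> \<bar>\<rho> - 1\<bar> \<le> 2 / (a * t)" if kI: "k \<in> I" for k
    proof -
      have tk: "1 < t * \<bar>A k\<bar>" using ta(1)[OF t a(3)[OF kI]] by simp
      obtain \<rho> where "has_bochner_integral L (\<lambda>c. ?w c * exp (- (c k - opt k))) (?N * \<rho>)" "\<bar>\<rho> - 1\<bar> \<le> 1 / (t * \<bar>A k\<bar> - 1)"
        using has_bochner_integral_tilt_exp_neg[OF t0 tk kI] by blast
      then show ?thesis using ta(2)[OF t a(3)[OF kI]] order_trans by blast
    qed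
    then have "\<forall>k\<in>I. \<exists>\<rho>. has_bochner_integral L (\<lambda>c. ?w c * exp (- (c k - opt k))) (?N * \<rho>) \<and> \<bar>\<rho> - 1\<bar> \<le> 2 / (a * t)"
      by blast
    from bchoice[OF this] obtain \<rho>m where neg: "\<And>k. k \<in> I \<Longrightarrow> has_bochner_integral L (\<lambda>c. ?w c * exp (- (c k - opt k))) (?N * \<rho>m k)"
      and \<rho>m: "\<And>k. k \<in> I \<Longrightarrow> \<bar>\<rho>m k - 1\<bar> \<le> 2 / (a * t)"
      by blast
    have base: "has_bochner_integral L ?w ?N" by (rule has_bochner_integral_tilt[OF t0])
    have lin: "has_bochner_integral L (\<lambda>c. ?w c - (\<Sum>k\<in>I. \<beta> k * (?w c * exp (c k - opt k) - ?w c))) (?N - (\<Sum>k\<in>I. \<beta> k * (?N * \<rho>p - ?N)))"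
      by (intro has_bochner_integral_diff base has_bochner_integral_sum has_bochner_integral_mult_right pos)
    have err: "has_bochner_integral L (\<lambda>c. C * (\<Sum>k\<in>I. ?w c * exp (c k - opt k) + ?w c * exp (- (c k - opt k)) - 2 * ?w c))
       (C * (\<Sum>k\<in>I. ?N * \<rho>p + ?N * \<rho>m k - 2 * ?N))"
      by (intro has_bochner_integral_diff has_bochner_integral_add base has_bochner_integral_sum has_bochner_integral_mult_right pos neg)
    have pt: "\<bar>?w c * \<psi> c - (?w c - (\<Sum>k\<in>I. \<beta> k * (?w c * exp (c k - opt k) - ?w c)))\<bar>
       \<le> C * (\<Sum>k\<in>I. ?w c * exp (c k - opt k) + ?w c * exp (- (c k - opt k)) - 2 * ?w c)" for c
    proof -
      have "?w c * \<psi> c - (?w c - (\<Sum>k\<in>I. \<beta> k * (?w c * exp (c k - opt k) - ?w c)))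
        = ?w c * (\<psi> c - 1 + (\<Sum>k\<in>I. \<beta> k * (exp (c k - opt k) - 1)))"
        unfolding ring_distribs sum_distrib_left by (simp add: algebra_simps)
      then have "\<bar>?w c * \<psi> c - (?w c - (\<Sum>k\<in>I. \<beta> k * (?w c * exp (c k - opt k) - ?w c)))\<bar>
        = ?w c * \<bar>\<psi> c - 1 + (\<Sum>k\<in>I. \<beta> k * (exp (c k - opt k) - 1))\<bar>"
        using tilt_nonneg by (simp add: abs_mult)
      also have "\<dots> \<le> ?w c * (C * (\<Sum>k\<in>I. exp (c k - opt k) + exp (- (c k - opt k)) - 2))"
        using bd[of "\<lambda>k. c k - opt k"] tilt_nonneg unfolding \<psi>_def q_def by (intro mult_left_mono) auto
      also have "\<dots> = C * (\<Sum>k\<in>I. ?w c * exp (c k - opt k) + ?w c * exp (- (c k - opt k)) - 2 * ?w c)"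
        unfolding mult.left_commute[of _ C] sum_distrib_left by (simp only: ring_distribs mult_ac)
      finally show ?thesis .
    qed
    have int_diff: "integrable L (\<lambda>c. ?w c * \<psi> c - (?w c - (\<Sum>k\<in>I. \<beta> k * (?w c * exp (c k - opt k) - ?w c))))"
    proof (rule Bochner_Integration.integrable_bound)
      show "integrable L (\<lambda>c. C * (\<Sum>k\<in>I. ?w c * exp (c k - opt k) + ?w c * exp (- (c k - opt k)) - 2 * ?w c))"
        using err by (rule integrable.intros)
      show "(\<lambda>c. ?w c * \<psi> c - (?w c - (\<Sum>k\<in>I. \<beta> k * (?w c * exp (c k - opt k) - ?w c)))) \<in> borel_measurable L"
        by measurable
      show "AE c in L. norm (?w c * \<psi> c - (?w c - (\<Sum>k\<in>I. \<beta> k * (?w c * exp (c k - opt k) - ?w c))))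
         \<le> norm (C * (\<Sum>k\<in>I. ?w c * exp (c k - opt k) + ?w c * exp (- (c k - opt k)) - 2 * ?w c))"
        using pt by (intro AE_I2) (auto intro: order_trans[OF _ abs_ge_self])
    qed
    have int_lin: "integrable L (\<lambda>c. ?w c - (\<Sum>k\<in>I. \<beta> k * (?w c * exp (c k - opt k) - ?w c)))"
      using lin by (rule integrable.intros)
    have int: "integrable L (\<lambda>c. ?w c * \<psi> c)"
      using Bochner_Integration.integrable_add[OF int_diff int_lin] by simp
    have "\<bar>(\<integral>c. ?w c * \<psi> c \<partial>L) - (?N - (\<Sum>k\<in>I. \<beta> k * (?N * \<rho>p - ?N)))\<bar>
      = \<bar>\<integral>c. ?w c * \<psi> c - (?w c - (\<Sum>k\<in>I. \<beta> k * (?w c * exp (c k - opt k) - ?w c))) \<partial>L\<bar>"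
      using int int_lin has_bochner_integral_integral_eq[OF lin] by simp
    also have "\<dots> \<le> (\<integral>c. \<bar>?w c * \<psi> c - (?w c - (\<Sum>k\<in>I. \<beta> k * (?w c * exp (c k - opt k) - ?w c)))\<bar> \<partial>L)"
      by (rule integral_abs_bound)
    also have "\<dots> \<le> (\<integral>c. C * (\<Sum>k\<in>I. ?w c * exp (c k - opt k) + ?w c * exp (- (c k - opt k)) - 2 * ?w c) \<partial>L)"
      using err by (intro integral_mono integrable_abs int_diff pt) (rule integrable.intros)
    also have "\<dots> = C * (\<Sum>k\<in>I. ?N * \<rho>p + ?N * \<rho>m k - 2 * ?N)"
      by (rule has_bochner_integral_integral_eq[OF err])
    finally have 1: "\<bar>(\<integral>c. ?w c * \<psi> c \<partial>L) - (?N - (\<Sum>k\<in>I. \<beta> k * (?N * \<rho>p - ?N)))\<bar> \<le> C * (\<Sum>k\<in>I. ?N * \<rho>p + ?N * \<rho>m k - 2 * ?N)" .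
    have 2: "C * (\<Sum>k\<in>I. ?N * \<rho>p + ?N * \<rho>m k - 2 * ?N) \<le> C * (card I * (4 / a)) / t * ?N"
    proof -
      have "(\<Sum>k\<in>I. ?N * \<rho>p + ?N * \<rho>m k - 2 * ?N) \<le> (\<Sum>k\<in>I. ?N * (4 / (a * t)))"
      proof (rule sum_mono)
        fix k assume "k \<in> I"
        then have "\<rho>p + \<rho>m k - 2 \<le> 4 / (a * t)"
          using \<rho>p \<rho>m[of k] by linarith
        then have "?N * (\<rho>p + \<rho>m k - 2) \<le> ?N * (4 / (a * t))"
          using N by (intro mult_left_mono) auto
        then show "?N * \<rho>p + ?N * \<rho>m k - 2 * ?N \<le> ?N * (4 / (a * t))" by (simp add: algebra_simps)
      qed
      then have "C * (\<Sum>k\<in>I. ?N * \<rho>p + ?N * \<rho>m k - 2 * ?N) \<le> C * (\<Sum>k\<in>I. ?N * (4 / (a * t)))"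
        using C by (intro mult_left_mono) auto
      then show ?thesis by (simp add: mult_ac)
    qed
    have 3: "\<bar>\<Sum>k\<in>I. \<beta> k * (?N * \<rho>p - ?N)\<bar> \<le> (\<Sum>k\<in>I. \<bar>\<beta> k\<bar>) * (2 / a) / t * ?N"
    proof -
      have "\<bar>\<Sum>k\<in>I. \<beta> k * (?N * \<rho>p - ?N)\<bar> = \<bar>sum \<beta> I\<bar> * (?N * \<bar>\<rho>p - 1\<bar>)"
      proof -
        have "(\<Sum>k\<in>I. \<beta> k * (?N * \<rho>p - ?N)) = sum \<beta> I * (?N * (\<rho>p - 1))"
          by (subst sum_distrib_right) (simp add: algebra_simps)
        then show ?thesis using N by (simp add: abs_mult)
      qed
      also have "\<dots> \<le> (\<Sum>k\<in>I. \<bar>\<beta> k\<bar>) * (?N * (2 / (a * t)))"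
        using \<rho>p N by (intro mult_mono sum_abs mult_left_mono) (auto simp: sum_nonneg)
      finally show ?thesis by (simp add: mult_ac)
    qed
    have "\<bar>(\<integral>c. ?w c * \<psi> c \<partial>L) - ?N\<bar> \<le> D / t * ?N"
      using 1 2 3 unfolding D_def add_divide_distrib distrib_right by linarith
    with int show ?thesis by blast
  qed
  define V where "V t = \<phi> opt * (\<integral>c. tilt K i A t c * \<psi> c \<partial>L)" for t
  show ?thesis
  proof (rule that[OF Tpos, of V "\<phi> opt * D"])
    fix t assume t: "t \<ge> T"
    have eq: "tilt K i A t c * \<phi> c = \<phi> opt * (tilt K i A t c * \<psi> c)" for c
      by (simp add: \<phi>\<psi>[of c])
    show "has_bochner_integral L (\<lambda>c. tilt K i A t c * \<phi> c) (V t)"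
      unfolding eq V_def using key[OF t] by (intro has_bochner_integral_mult_right has_bochner_integral_integrable) auto
    have \<phi>0: "\<phi> opt > 0" by (simp add: \<phi>_def)
    have "\<bar>V t - \<phi> opt * tilt_mass K i A t\<bar> = \<phi> opt * \<bar>(\<integral>c. tilt K i A t c * \<psi> c \<partial>L) - tilt_mass K i A t\<bar>"
      using \<phi>0 by (simp add: V_def abs_mult flip: right_diff_distrib)
    also have "\<dots> \<le> \<phi> opt * (D / t * tilt_mass K i A t)"
      using key[OF t] \<phi>0 by (intro mult_left_mono) auto
    finally show "\<bar>V t - \<phi> opt * tilt_mass K i A t\<bar> \<le> \<phi> opt * D / t * tilt_mass K i A t" by simp
  qed
qed
end

section \<open>Stirling asymptotics of the tilted mass\<close>

context region_tilt begin

text \<open>Stirling's main terms inserted into \<open>tilt_mass\<close>. In the power of t, the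
  card K + 1 Gamma factors of the numerator give - (card K + 1) / 2, the one below gives + 1 / 2,
  and the division by t A i gives - 1.\<close>

definition tilt_mass_main :: "real \<Rightarrow> real" where
  "tilt_mass_main t = exp (card K / 2 * ln (2 * pi) - (card K + 2) / 2 * ln t - ln S / 2 - (\<Sum>k\<in>I. ln \<bar>A k\<bar>) / 2
       - t * (\<Sum>k\<in>I. A k * opt k))"

text \<open>The terms in t ln t and the bare terms in t cancel because S and the |A k| over K add up
  to A i. The surviving t A ln A terms assemble into - t sum A k opt k.\<close>

lemma tilt_mass_stirling:
  obtains C where "\<And>t. t > 0 \<Longrightarrow> \<exists>s. tilt_mass K i A t = tilt_mass_main t * exp s \<and> \<bar>s\<bar> \<le> C / t"
proof -
  define C where "C = (\<Sum>k\<in>K. 1 / (4 * \<bar>A k\<bar>)) + 1 / (4 * S) + 1 / (4 * A i)"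
  have "\<exists>s. tilt_mass K i A t = tilt_mass_main t * exp s \<and> \<bar>s\<bar> \<le> C / t" if t: "t > 0" for t
  proof -
    define s where "s = (\<Sum>k\<in>K. stirling_rem (t * \<bar>A k\<bar>)) + stirling_rem (t * S) - stirling_rem (t * A i)"
    have Ak: "- (t * A k) = t * \<bar>A k\<bar>" "t * \<bar>A k\<bar> > 0" "\<bar>A k\<bar> > 0" if "k \<in> K" for k
      using Aneg[OF that] t by (auto simp: abs_of_neg mult_pos_neg)
    have tS: "t * S > 0" and ti: "t * A i > 0" using t S_pos A_i by auto
    have w: "sum (\<lambda>k. - (t * A k)) K = (\<Sum>k\<in>K. t * \<bar>A k\<bar>)" using Ak by (intro sum.cong) auto
    have N: "tilt_mass K i A t = (\<Prod>k\<in>K. Gamma (t * \<bar>A k\<bar>)) * Gamma (t * S) / (Gamma (t * A i) * (t * A i))"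
      unfolding tilt_mass_def dirichlet_int_def weights(2)[OF t] using Ak by (simp cong: prod.cong)
    have lnG: "ln (Gamma x) = (x - 1/2) * ln x - x + ln (2 * pi) / 2 + stirling_rem x" for x :: real
      by (simp add: stirling_rem_def)
    have "ln (tilt_mass K i A t) = (\<Sum>k\<in>K. ln (Gamma (t * \<bar>A k\<bar>))) + ln (Gamma (t * S)) - (ln (Gamma (t * A i)) + ln (t * A i))"
    proof -
      have p: "(\<Prod>k\<in>K. Gamma (t * \<bar>A k\<bar>)) > 0" using Ak by (intro prod_pos) auto
      have "ln (\<Prod>k\<in>K. Gamma (t * \<bar>A k\<bar>)) = (\<Sum>k\<in>K. ln (Gamma (t * \<bar>A k\<bar>)))"
        using Gamma_real_pos[OF Ak(2)] K by (intro ln_prod) force+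
      then show ?thesis
        unfolding N using p Gamma_real_pos[OF tS] Gamma_real_pos[OF ti] ti
        by (subst ln_div, simp, simp, subst (1 2) ln_mult) (auto simp: less_imp_neq[symmetric])
    qed
    also have "(\<Sum>k\<in>K. ln (Gamma (t * \<bar>A k\<bar>))) = (\<Sum>k\<in>K. t * \<bar>A k\<bar> * ln t + t * (\<bar>A k\<bar> * ln \<bar>A k\<bar>) - ln t / 2 - ln \<bar>A k\<bar> / 2 - t * \<bar>A k\<bar> + ln (2 * pi) / 2 + stirling_rem (t * \<bar>A k\<bar>))"
      unfolding lnG using Ak t by (intro sum.cong refl) (simp add: ln_mult algebra_simps add_divide_distrib)
    also have "\<dots> = (\<Sum>k\<in>K. \<bar>A k\<bar>) * (t * ln t - t) + t * (\<Sum>k\<in>K. \<bar>A k\<bar> * ln \<bar>A k\<bar>) - card K * ln t / 2 - (\<Sum>k\<in>K. ln \<bar>A k\<bar>) / 2 + card K * ln (2 * pi) / 2 + (\<Sum>k\<in>K. stirling_rem (t * \<bar>A k\<bar>))"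
      by (simp add: sum.distrib sum_subtractf sum_distrib_left sum_distrib_right sum_divide_distrib algebra_simps)
    finally have lnN: "ln (tilt_mass K i A t) = (\<Sum>k\<in>K. \<bar>A k\<bar>) * (t * ln t - t) + t * (\<Sum>k\<in>K. \<bar>A k\<bar> * ln \<bar>A k\<bar>) - card K * ln t / 2 - (\<Sum>k\<in>K. ln \<bar>A k\<bar>) / 2 + card K * ln (2 * pi) / 2 + (\<Sum>k\<in>K. stirling_rem (t * \<bar>A k\<bar>))
       + ln (Gamma (t * S)) - (ln (Gamma (t * A i)) + ln (t * A i))" .
    have sA: "(\<Sum>k\<in>K. \<bar>A k\<bar>) = A i - S" 
    proof -
      have "(\<Sum>k\<in>K. \<bar>A k\<bar>) = (\<Sum>k\<in>K. - A k)" using Aneg by (intro sum.cong) (auto simp: abs_of_neg)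
      then show ?thesis unfolding S_eq by (simp add: sum_negf)
    qed
    have opt: "(\<Sum>k\<in>I. A k * opt k) = A i * ln (A i) - (\<Sum>k\<in>K. \<bar>A k\<bar> * ln \<bar>A k\<bar>) - S * ln S"
    proof -
      have "(\<Sum>k\<in>K. A k * opt k) = (\<Sum>k\<in>K. \<bar>A k\<bar> * ln S - \<bar>A k\<bar> * ln \<bar>A k\<bar>)"
      proof (intro sum.cong refl)
        fix k assume k: "k \<in> K"
        have "A k * opt k = - \<bar>A k\<bar> * (ln \<bar>A k\<bar> - ln S)"
        proof -
          have "opt k = ln \<bar>A k\<bar> - ln S"
            unfolding opt_def using Ak(3)[OF k] S_pos by (simp add: ln_div)
          then show ?thesis using Aneg[OF k] by simp
        qed
        then show "A k * opt k = \<bar>A k\<bar> * ln S - \<bar>A k\<bar> * ln \<bar>A k\<bar>"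
          by (simp add: algebra_simps)
      qed
      also have "\<dots> = (A i - S) * ln S - (\<Sum>k\<in>K. \<bar>A k\<bar> * ln \<bar>A k\<bar>)"
        by (simp add: sum_subtractf sA flip: sum_distrib_right)
      finally have "(\<Sum>k\<in>K. A k * opt k) = A i * ln S - S * ln S - (\<Sum>k\<in>K. \<bar>A k\<bar> * ln \<bar>A k\<bar>)"
        by (simp only: left_diff_distrib)
      moreover have "opt i = ln (A i) - ln S" using A_i S_pos by (simp add: opt_def ln_div)
      then have "A i * opt i = A i * ln (A i) - A i * ln S" by (simp only: right_diff_distrib)
      moreover have "(\<Sum>k\<in>I. A k * opt k) = A i * opt i + (\<Sum>k\<in>K. A k * opt k)" using K by simp
      ultimately show ?thesis by linarith
    qed
    have lnA: "(\<Sum>k\<in>I. ln \<bar>A k\<bar>) = ln (A i) + (\<Sum>k\<in>K. ln \<bar>A k\<bar>)" using K A_i by simp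
    have "ln (tilt_mass K i A t) = card K / 2 * ln (2 * pi) - (card K + 2) / 2 * ln t - ln S / 2 - (\<Sum>k\<in>I. ln \<bar>A k\<bar>) / 2
       - t * (\<Sum>k\<in>I. A k * opt k) + s"
    proof -
      have "ln (t * S) = ln t + ln S" "ln (t * A i) = ln t + ln (A i)"
        using t S_pos A_i by (simp_all add: ln_mult)
      then show ?thesis
        unfolding lnN lnG opt lnA sA s_def by (simp add: algebra_simps add_divide_distrib del: sum.insert)
    qed
    then have "tilt_mass K i A t = tilt_mass_main t * exp s"
      using tilt_mass_pos[OF t] unfolding tilt_mass_main_def exp_add[symmetric] by (metis exp_ln)
    moreover have "\<bar>s\<bar> \<le> C / t"
    proof -
      have r: "\<bar>stirling_rem (t * x)\<bar> \<le> 1 / (4 * x) / t" if "x > 0" for x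
        using stirling_rem_bounds[of "t * x"] t that by (simp add: mult_ac)
      have "\<bar>\<Sum>k\<in>K. stirling_rem (t * \<bar>A k\<bar>)\<bar> \<le> (\<Sum>k\<in>K. 1 / (4 * \<bar>A k\<bar>) / t)"
        using Ak by (intro order_trans[OF sum_abs] sum_mono r) auto
      also have "\<dots> = (\<Sum>k\<in>K. 1 / (4 * \<bar>A k\<bar>)) / t" by (simp add: sum_divide_distrib)
      finally show ?thesis
        using r[OF S_pos] r[OF A_i(2)] unfolding C_def s_def add_divide_distrib by linarith
    qed
    ultimately show ?thesis by blast
  qed
  then show ?thesis by (rule that)
qed
end

section \<open>Gaussian integrals and marginals\<close>

lemma nn_integral_gaussian_1d:
  fixes d b :: real
  assumes "d > 0"
  shows "(\<integral>\<^sup>+y. ennreal (exp (- d * (y + b)^2 / 2)) \<partial>lborel) = ennreal (sqrt (2 * pi / d))"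
proof -
  have eq: "exp (- d * (y + b)^2 / 2) = sqrt (2 * pi / d) * normal_density (- b) (1 / sqrt d) y" for y
    using assms by (simp add: normal_density_def real_sqrt_divide real_sqrt_mult power_divide field_simps)
  have "(\<integral>\<^sup>+y. ennreal (normal_density (- b) (1 / sqrt d) y) \<partial>lborel) = ennreal 1"
    using assms by (subst nn_integral_eq_integral) (auto simp: integrable_normal_density integral_normal_density)
  then show ?thesis
    unfolding eq using assms by (simp add: ennreal_mult nn_integral_cmult)
qed

text \<open>Block factorization into a unit upper triangular and a lower triangular matrix, with the
  last row and column as the border.\<close>

lemma det_schur_complement:
  fixes P :: "nat \<Rightarrow> nat \<Rightarrow> real"
  assumes d: "P n n \<noteq> 0"
  shows "det (mat (Suc n) (Suc n) (\<lambda>(i, j). P i j)) = P n n * det (mat n n (\<lambda>(i, j). P i j - P i n * P n j / P n n))"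
proof -
  define M where "M = mat (Suc n) (Suc n) (\<lambda>(i, j). P i j)"
  define A where "A = mat n n (\<lambda>(i, j). P i j - P i n * P n j / P n n)"
  define B where "B = mat n 1 (\<lambda>(i, j). P i n / P n n)"
  define C where "C = mat 1 n (\<lambda>(i, j). P n j)"
  define D where "D = mat 1 1 (\<lambda>(i, j). P n n)"
  have car: "A \<in> carrier_mat n n" "B \<in> carrier_mat n 1" "C \<in> carrier_mat 1 n" "D \<in> carrier_mat 1 1"
    by (auto simp: A_def B_def C_def D_def)
  have "M = four_block_mat (1\<^sub>m n) B (0\<^sub>m 1 n) (1\<^sub>m 1) * four_block_mat A (0\<^sub>m n 1) C D"
  proof (subst mult_four_block_mat[where ?nr1.0=n and ?n1.0=n and ?n2.0=1 and ?nr2.0=1 and ?nc1.0=n and ?nc2.0=1])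
    show "M = four_block_mat (1\<^sub>m n * A + B * C) (1\<^sub>m n * 0\<^sub>m n 1 + B * D) (0\<^sub>m 1 n * A + 1\<^sub>m 1 * C) (0\<^sub>m 1 n * 0\<^sub>m n 1 + 1\<^sub>m 1 * D)"
      using car d
      by (intro eq_matI) (auto simp: M_def A_def B_def C_def D_def scalar_prod_def less_Suc_eq)
  qed (use car in auto)
  then have "det M = det (four_block_mat (1\<^sub>m n) B (0\<^sub>m 1 n) (1\<^sub>m 1)) * det (four_block_mat A (0\<^sub>m n 1) C D)"
    by (simp only:) (rule det_mult[of _ "n + 1"]; intro four_block_carrier_mat; use car in simp)
  also have "det (four_block_mat (1\<^sub>m n) B (0\<^sub>m 1 n) (1\<^sub>m 1)) = 1"
    using car by (subst det_four_block_mat_lower_left_zero[where n=n and m=1]) auto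
  also have "det (four_block_mat A (0\<^sub>m n 1) C D) = det A * det D"
    using car by (subst det_four_block_mat_upper_right_zero[where n=n and m=1]) auto
  also have "det D = P n n"
    by (subst det_single) (auto simp: D_def)
  finally show ?thesis by (simp add: M_def A_def mult.commute)
qed

lemma quadratic_complete_square:
  fixes P :: "nat \<Rightarrow> nat \<Rightarrow> real" and z :: "nat \<Rightarrow> real"
  assumes sym: "\<And>i. i < n \<Longrightarrow> P i n = P n i" and d: "P n n \<noteq> 0"
  shows "(\<Sum>i<Suc n. \<Sum>j<Suc n. P i j * z i * z j) =
    (\<Sum>i<n. \<Sum>j<n. (P i j - P i n * P n j / P n n) * z i * z j) + P n n * (z n + (\<Sum>j<n. P n j * z j) / P n n)^2"
proof -
  define b where "b = (\<Sum>j<n. P n j * z j)"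
  have 1: "(\<Sum>i<n. P i n * z i * z n) = b * z n"
    using sym by (simp add: b_def sum_distrib_right)
  have 2: "(\<Sum>i<n. \<Sum>j<n. P i n * P n j / P n n * z i * z j) = b * b / P n n"
    using sym unfolding b_def sum_product sum_divide_distrib by (intro sum.cong) (auto simp: mult_ac)
  have 3: "(\<Sum>j<n. P n j * z n * z j) = b * z n"
    by (simp add: b_def sum_distrib_left mult_ac)
  show ?thesis
    using d 2 by (simp add: sum.distrib sum_subtractf left_diff_distrib 1 3 flip: b_def)
      (simp add: field_simps power2_eq_square)
qed

text \<open>Induction by integrating out the last coordinate: completing the square leaves the Schur
  complement, to which symmetry, positivity and the determinant all pass. The injection f allows
  coordinates labelled by an arbitrary finite set. Positivity of the determinant comes along because
  it is needed on its own for the covariance block.\<close>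

lemma gaussian_integral:
  fixes P :: "nat \<Rightarrow> nat \<Rightarrow> real" and f :: "nat \<Rightarrow> nat"
  assumes "inj_on f {..<n}" and "\<And>i j. i < n \<Longrightarrow> j < n \<Longrightarrow> P i j = P j i"
    and "\<And>z. \<exists>i<n. z i \<noteq> 0 \<Longrightarrow> (\<Sum>i<n. \<Sum>j<n. P i j * z i * z j) > 0"
  shows "det (mat n n (\<lambda>(i, j). P i j)) > 0 \<and>
    (\<integral>\<^sup>+c. ennreal (exp (- (\<Sum>i<n. \<Sum>j<n. P i j * c (f i) * c (f j)) / 2)) \<partial>PiM (f ` {..<n}) (\<lambda>_. lborel))
    = ennreal (sqrt ((2 * pi) ^ n / det (mat n n (\<lambda>(i, j). P i j))))"
  using assms
proof (induction n arbitrary: P)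
  case 0
  then show ?case by (simp add: PiM_empty nn_integral_count_space_finite)
next
  case (Suc n)
  define d where "d = P n n"
  define P' where "P' i j = P i j - P i n * P n j / d" for i j
  have d: "d > 0"
  proof -
    have "0 < (\<Sum>i<Suc n. \<Sum>j<Suc n. P i j * (if i = n then 1 else 0) * (if j = n then 1 else 0))"
      by (rule Suc.prems(3)) auto
    then show ?thesis by (simp add: d_def if_distrib cong: if_cong)
  qed
  have dn: "P n n \<noteq> 0" using d by (simp add: d_def)
  have cs: "(\<Sum>i<Suc n. \<Sum>j<Suc n. P i j * z i * z j) =
    (\<Sum>i<n. \<Sum>j<n. P' i j * z i * z j) + d * (z n + (\<Sum>j<n. P n j * z j) / d)^2" for z
    unfolding P'_def d_def by (rule quadratic_complete_square, rule Suc.prems(2)) (use dn in auto)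
  have detP: "det (mat (Suc n) (Suc n) (\<lambda>(i, j). P i j)) = d * det (mat n n (\<lambda>(i, j). P' i j))"
    unfolding P'_def d_def using dn by (rule det_schur_complement[where P = P])
  have IH: "det (mat n n (\<lambda>(i, j). P' i j)) > 0 \<and>
    (\<integral>\<^sup>+c. ennreal (exp (- (\<Sum>i<n. \<Sum>j<n. P' i j * c (f i) * c (f j)) / 2)) \<partial>PiM (f ` {..<n}) (\<lambda>_. lborel))
    = ennreal (sqrt ((2 * pi) ^ n / det (mat n n (\<lambda>(i, j). P' i j))))"
  proof (rule Suc.IH)
    show "inj_on f {..<n}" using Suc.prems(1) by (auto simp: inj_on_def)
    show "P' i j = P' j i" if "i < n" "j < n" for i j
      using Suc.prems(2)[of i j] Suc.prems(2)[of i n] Suc.prems(2)[of j n] that by (simp add: P'_def)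
    fix z :: "nat \<Rightarrow> real" assume z: "\<exists>i<n. z i \<noteq> 0"
    \<comment> \<open>The last coordinate is chosen to annihilate the completed square, so
      positivity of the large form yields positivity of the Schur complement.\<close>
    define z' where "z' = z(n := - (\<Sum>j<n. P n j * z j) / d)"
    have "0 < (\<Sum>i<Suc n. \<Sum>j<Suc n. P i j * z' i * z' j)"
    proof (rule Suc.prems(3))
      obtain i where "i < n" "z i \<noteq> 0" using z by blast
      then show "\<exists>i<Suc n. z' i \<noteq> 0" by (intro exI[of _ i]) (simp add: z'_def)
    qed
    also have "\<dots> = (\<Sum>i<n. \<Sum>j<n. P' i j * z i * z j)"
      unfolding cs by (simp add: z'_def)
    finally show "(\<Sum>i<n. \<Sum>j<n. P' i j * z i * z j) > 0" .
  qed
  have ins: "f ` {..<Suc n} = insert (f n) (f ` {..<n})" by (simp add: lessThan_Suc)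
  have fn: "f n \<notin> f ` {..<n}"
  proof
    assume "f n \<in> f ` {..<n}"
    then obtain j where "j < n" "f n = f j" by auto
    then show False using inj_onD[OF Suc.prems(1), of n j] by simp
  qed
  have ne: "f j \<noteq> f n" if "j < n" for j using that fn by (metis image_eqI lessThan_iff)
  let ?D = "det (mat n n (\<lambda>(i, j). P' i j))"
  have "(\<integral>\<^sup>+c. ennreal (exp (- (\<Sum>i<Suc n. \<Sum>j<Suc n. P i j * c (f i) * c (f j)) / 2)) \<partial>PiM (f ` {..<Suc n}) (\<lambda>_. lborel))
    = (\<integral>\<^sup>+c. (\<integral>\<^sup>+y. ennreal (exp (- (\<Sum>i<n. \<Sum>j<n. P' i j * c (f i) * c (f j)) / 2)) * ennreal (exp (- d * (y + (\<Sum>j<n. P n j * c (f j)) / d)^2 / 2)) \<partial>lborel) \<partial>PiM (f ` {..<n}) (\<lambda>_. lborel))"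
    unfolding ins
    apply (subst lborel_PiM.product_nn_integral_insert)
    subgoal by simp
    subgoal by (rule fn)
    subgoal
    proof -
      have [measurable]: "(\<lambda>c. c (f j)) \<in> borel_measurable (PiM (insert (f n) (f ` {..<n})) (\<lambda>_. lborel :: real measure))" if "j \<in> {..<Suc n}" for j
        using that measurable_component_singleton[of "f j" "insert (f n) (f ` {..<n})" "\<lambda>_. lborel :: real measure"]
        by (auto simp: less_Suc_eq)
      show ?thesis by measurable
    qed
    apply (intro nn_integral_cong)
    unfolding cs by (simp add: ne ennreal_mult[symmetric] add_divide_distrib diff_divide_distrib flip: exp_add)
  also have "\<dots> = (\<integral>\<^sup>+c. ennreal (exp (- (\<Sum>i<n. \<Sum>j<n. P' i j * c (f i) * c (f j)) / 2)) * ennreal (sqrt (2 * pi / d)) \<partial>PiM (f ` {..<n}) (\<lambda>_. lborel))"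
    by (intro nn_integral_cong, subst nn_integral_cmult) (measurable, simp only: nn_integral_gaussian_1d[OF d])
  also have "\<dots> = ennreal (sqrt ((2 * pi) ^ n / ?D)) * ennreal (sqrt (2 * pi / d))"
  proof -
    have [measurable]: "(\<lambda>c. c (f j)) \<in> borel_measurable (PiM (f ` {..<n}) (\<lambda>_. lborel :: real measure))" if "j \<in> {..<n}" for j
      using that measurable_component_singleton[of "f j" "f ` {..<n}" "\<lambda>_. lborel :: real measure"] by auto
    show ?thesis using IH by (subst nn_integral_multc) auto
  qed
  also have "\<dots> = ennreal (sqrt ((2 * pi) ^ Suc n / (d * ?D)))"
  proof -
    have "sqrt ((2 * pi) ^ n / ?D) * sqrt (2 * pi / d) = sqrt ((2 * pi) ^ Suc n / (d * ?D))"
      unfolding real_sqrt_mult[symmetric] by (simp add: mult_ac)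
    moreover have "0 \<le> sqrt ((2 * pi) ^ n / ?D)" "0 \<le> sqrt (2 * pi / d)"
      using IH d by auto
    ultimately show ?thesis by (simp only: ennreal_mult[symmetric])
  qed
  finally show ?case using IH d detP by simp
qed

section \<open>Translation invariance, inverse pairs and Gaussian marginals\<close>

lemma distr_PiM_translate:
  fixes a :: "nat \<Rightarrow> real"
  assumes J: "finite J"
  shows "distr (PiM J (\<lambda>_. lborel)) (PiM J (\<lambda>_. lborel)) (\<lambda>h. \<lambda>k\<in>J. h k + a k) = PiM J (\<lambda>_. lborel)"
proof (rule lborel_PiM.PiM_eqI[OF J])
  have meas[measurable]: "(\<lambda>h. \<lambda>k\<in>J. h k + a k) \<in> measurable (PiM J (\<lambda>_. lborel)) (PiM J (\<lambda>_. lborel))"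
    by (intro measurable_restrict) measurable
  fix X :: "nat \<Rightarrow> real set" assume X: "\<And>k. k \<in> J \<Longrightarrow> X k \<in> sets lborel"
  have XM: "(\<lambda>x. x + a k) -` X k \<in> sets lborel" if "k \<in> J" for k
    using measurable_sets[of "\<lambda>x. x + a k" lborel lborel "X k"] X[OF that] by simp
  have "emeasure (distr (PiM J (\<lambda>_. lborel)) (PiM J (\<lambda>_. lborel)) (\<lambda>h. \<lambda>k\<in>J. h k + a k)) (Pi\<^sub>E J X)
    = emeasure (PiM J (\<lambda>_. lborel)) ((\<lambda>h. \<lambda>k\<in>J. h k + a k) -` Pi\<^sub>E J X \<inter> space (PiM J (\<lambda>_. lborel)))"
    using J X by (subst emeasure_distr) (auto intro!: sets_PiM_I_finite)
  also have "(\<lambda>h. \<lambda>k\<in>J. h k + a k) -` Pi\<^sub>E J X \<inter> space (PiM J (\<lambda>_. lborel :: real measure)) = Pi\<^sub>E J (\<lambda>k. (\<lambda>x. x + a k) -` X k)"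
    by (auto simp: space_PiM PiE_def Pi_def extensional_def)
  also have "emeasure (PiM J (\<lambda>_. lborel)) (Pi\<^sub>E J (\<lambda>k. (\<lambda>x. x + a k) -` X k)) = (\<Prod>k\<in>J. emeasure lborel ((\<lambda>x. x + a k) -` X k))"
    by (intro lborel_PiM.emeasure_PiM J XM)
  also have "\<dots> = (\<Prod>k\<in>J. emeasure lborel (X k))"
  proof (rule prod.cong)
    fix k assume k: "k \<in> J"
    have eq: "(\<lambda>x. x + a k) = (+) (a k)" by (auto simp: add.commute)
    have "emeasure lborel (X k) = emeasure (distr lborel borel ((+) (a k))) (X k)"
      by (simp add: lborel_distr_plus)
    also have "\<dots> = emeasure lborel ((\<lambda>x. x + a k) -` X k)"
      unfolding eq using X[OF k] by (subst emeasure_distr) auto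
    finally show "emeasure lborel ((\<lambda>x. x + a k) -` X k) = emeasure lborel (X k)" ..
  qed simp
  finally show "emeasure (distr (PiM J (\<lambda>_. lborel)) (PiM J (\<lambda>_. lborel)) (\<lambda>h. \<lambda>k\<in>J. h k + a k)) (Pi\<^sub>E J X) = (\<Prod>k\<in>J. emeasure lborel (X k))" .
qed simp

lemma nn_integral_PiM_translate:
  fixes a :: "nat \<Rightarrow> real"
  assumes J: "finite J" and f: "f \<in> borel_measurable (PiM J (\<lambda>_. lborel))"
  shows "(\<integral>\<^sup>+h. f (\<lambda>k\<in>J. h k + a k) \<partial>PiM J (\<lambda>_. lborel)) = (\<integral>\<^sup>+h. f h \<partial>PiM J (\<lambda>_. lborel))"
proof -
  have meas: "(\<lambda>h. \<lambda>k\<in>J. h k + a k) \<in> measurable (PiM J (\<lambda>_. lborel)) (PiM J (\<lambda>_. lborel))"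
    by (intro measurable_restrict) measurable
  have "(\<integral>\<^sup>+h. f (\<lambda>k\<in>J. h k + a k) \<partial>PiM J (\<lambda>_. lborel))
    = (\<integral>\<^sup>+h. f h \<partial>distr (PiM J (\<lambda>_. lborel)) (PiM J (\<lambda>_. lborel)) (\<lambda>h. \<lambda>k\<in>J. h k + a k))"
    using f by (subst nn_integral_distr[OF meas]) auto
  then show ?thesis by (simp only: distr_PiM_translate[OF J])
qed

text \<open>Covariance B and precision Q as plain arrays. Semidefiniteness together with an inverse
  already gives definiteness of both, as \<open>B_pd\<close> and \<open>Q_pd\<close> show.\<close>

locale psd_inverse_pair =
  fixes n :: nat and B Q :: "nat \<Rightarrow> nat \<Rightarrow> real"
  assumes B_sym: "\<And>i j. i < n \<Longrightarrow> j < n \<Longrightarrow> B i j = B j i"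
    and Q_sym: "\<And>i j. i < n \<Longrightarrow> j < n \<Longrightarrow> Q i j = Q j i"
    and BQ: "\<And>i k. i < n \<Longrightarrow> k < n \<Longrightarrow> (\<Sum>j<n. B i j * Q j k) = (if i = k then 1 else 0)"
    and B_psd: "\<And>z. (\<Sum>i<n. \<Sum>j<n. B i j * z i * z j) \<ge> 0"
begin

definition QF :: "(nat \<Rightarrow> real) \<Rightarrow> real" where "QF z = (\<Sum>i<n. \<Sum>j<n. Q i j * z i * z j)"

lemma QF_cong: "(\<And>k. k < n \<Longrightarrow> z k = z' k) \<Longrightarrow> QF z = QF z'"
  unfolding QF_def by (intro sum.cong) auto

lemma QF_alt: "QF z = (\<Sum>i<n. z i * (\<Sum>j<n. Q i j * z j))"
  unfolding QF_def by (simp add: sum_distrib_left mult_ac)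

lemma QF_add: "QF (\<lambda>k. y k + h k) = QF y + 2 * (\<Sum>i<n. h i * (\<Sum>j<n. Q i j * y j)) + QF h"
proof -
  have "(\<Sum>i<n. \<Sum>j<n. Q i j * y i * h j) = (\<Sum>i<n. \<Sum>j<n. Q j i * y j * h i)"
    by (rule sum.swap)
  also have "\<dots> = (\<Sum>i<n. h i * (\<Sum>j<n. Q i j * y j))"
    unfolding sum_distrib_left using Q_sym by (intro sum.cong refl) (auto simp: mult_ac)
  finally have 1: "(\<Sum>i<n. \<Sum>j<n. Q i j * y i * h j) = (\<Sum>i<n. h i * (\<Sum>j<n. Q i j * y j))" .
  have 2: "(\<Sum>i<n. \<Sum>j<n. Q i j * h i * y j) = (\<Sum>i<n. h i * (\<Sum>j<n. Q i j * y j))"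
    by (simp add: sum_distrib_left mult_ac)
  show ?thesis using 1 2
    unfolding QF_def by (simp add: distrib_left distrib_right sum.distrib)
qed

lemma QB: "i < n \<Longrightarrow> k < n \<Longrightarrow> (\<Sum>j<n. Q i j * B j k) = (if i = k then 1 else 0)"
proof -
  assume ik: "i < n" "k < n"
  have "(\<Sum>j<n. Q i j * B j k) = (\<Sum>j<n. B k j * Q j i)"
    using B_sym Q_sym ik by (intro sum.cong refl) auto
  then show ?thesis using BQ ik by auto
qed

lemma Q_mult_B_mult:
  assumes "i < n"
  shows "(\<Sum>j<n. Q i j * (\<Sum>k<n. B j k * u k)) = u i"
proof -
  have "(\<Sum>j<n. Q i j * (\<Sum>k<n. B j k * u k)) = (\<Sum>k<n. (\<Sum>j<n. Q i j * B j k) * u k)"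
    unfolding sum_distrib_left sum_distrib_right by (subst sum.swap) (simp add: mult_ac)
  also have "\<dots> = (\<Sum>k<n. if i = k then u k else 0)"
    using QB[OF assms] by (intro sum.cong) auto
  finally show ?thesis using assms by simp
qed

lemma B_mult_Q_mult:
  assumes "i < n"
  shows "(\<Sum>j<n. B i j * (\<Sum>k<n. Q j k * u k)) = u i"
proof -
  have "(\<Sum>j<n. B i j * (\<Sum>k<n. Q j k * u k)) = (\<Sum>k<n. (\<Sum>j<n. B i j * Q j k) * u k)"
    unfolding sum_distrib_left sum_distrib_right by (subst sum.swap) (simp add: mult_ac)
  also have "\<dots> = (\<Sum>k<n. if i = k then u k else 0)"
    using BQ[OF assms] by (intro sum.cong) auto
  finally show ?thesis using assms by simp
qed

text \<open>No eigenvalues are used: B is tested on z / M - Q z, where the cross term collapses to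
  |z|^2 because B Q = 1, giving QF z >= 2 |z|^2 / M - (z.Bz) / M^2. With M above the sum of all |B i
  j| the last term is at most |z|^2 / M.\<close>

lemma QF_lower_bound:
  obtains \<kappa> where "\<kappa> > 0" "\<And>z. QF z \<ge> \<kappa> * (\<Sum>i<n. (z i)^2)"
proof -
  define M where "M = 1 + (\<Sum>i<n. \<Sum>j<n. \<bar>B i j\<bar>)"
  have M: "M > 0" unfolding M_def by (smt (verit) abs_ge_zero sum_nonneg)
  have "QF z \<ge> 1 / M * (\<Sum>i<n. (z i)^2)" for z
  proof -
    define s where "s = (\<Sum>i<n. (z i)^2)"
    have zij: "\<bar>z i\<bar> * \<bar>z j\<bar> \<le> s" if "i < n" "j < n" for i j
    proof -
      have "(z k)^2 \<le> s" if "k < n" for k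
        unfolding s_def using that by (intro member_le_sum) auto
      then have "(\<bar>z i\<bar>)^2 \<le> s" "(\<bar>z j\<bar>)^2 \<le> s" using that by auto
      moreover have "2 * (\<bar>z i\<bar> * \<bar>z j\<bar>) \<le> (\<bar>z i\<bar>)^2 + (\<bar>z j\<bar>)^2"
        using zero_le_power2[of "\<bar>z i\<bar> - \<bar>z j\<bar>"] by (simp add: power2_diff)
      ultimately show ?thesis by linarith
    qed
    have s0: "s \<ge> 0" unfolding s_def by (simp add: sum_nonneg)
    define bz where "bz = (\<Sum>i<n. \<Sum>j<n. B i j * z i * z j)"
    have "bz \<le> (\<Sum>i<n. \<Sum>j<n. \<bar>B i j\<bar> * s)"
      unfolding bz_def
    proof (intro sum_mono)
      fix i j assume ij: "i \<in> {..<n}" "j \<in> {..<n}"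
      have "B i j * z i * z j \<le> \<bar>B i j\<bar> * (\<bar>z i\<bar> * \<bar>z j\<bar>)"
        by (rule order_trans[OF abs_ge_self]) (simp add: abs_mult mult.assoc)
      also have "\<dots> \<le> \<bar>B i j\<bar> * s" using zij ij by (intro mult_left_mono) auto
      finally show "B i j * z i * z j \<le> \<bar>B i j\<bar> * s" .
    qed
    also have "\<dots> \<le> M * s" using s0 by (simp add: M_def sum_distrib_right distrib_right)
    finally have bz: "bz \<le> M * s" .
    define w where "w i = (\<Sum>k<n. Q i k * z k)" for i
    define Bz where "Bz i = (\<Sum>j<n. B i j * z j)" for i
    have Bw: "(\<Sum>j<n. B i j * w j) = z i" if "i < n" for i
      unfolding w_def by (rule B_mult_Q_mult[OF that])
    have "0 \<le> (\<Sum>i<n. \<Sum>j<n. B i j * (z i / M - w i) * (z j / M - w j))"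
      by (rule B_psd)
    also have "\<dots> = (\<Sum>i<n. (z i / M - w i) * (\<Sum>j<n. B i j * (z j / M - w j)))"
      by (simp add: sum_distrib_left mult_ac)
    also have "\<dots> = (\<Sum>i<n. (z i / M - w i) * (Bz i / M - z i))"
    proof (intro sum.cong refl)
      fix i assume "i \<in> {..<n}"
      then show "(z i / M - w i) * (\<Sum>j<n. B i j * (z j / M - w j)) = (z i / M - w i) * (Bz i / M - z i)"
        using Bw[of i] by (simp add: Bz_def right_diff_distrib sum_subtractf sum_divide_distrib)
    qed
    also have "\<dots> = (\<Sum>i<n. z i * Bz i) / M^2 - s / M - (\<Sum>i<n. w i * Bz i) / M + (\<Sum>i<n. w i * z i)"
      unfolding s_def
      by (simp add: left_diff_distrib right_diff_distrib sum_subtractf sum_divide_distrib sum.distrib power2_eq_square diff_divide_distrib)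
    also have "(\<Sum>i<n. z i * Bz i) = bz"
      by (simp add: bz_def Bz_def sum_distrib_left mult_ac)
    also have "(\<Sum>i<n. w i * Bz i) = s"
    proof -
      have "(\<Sum>i<n. w i * Bz i) = (\<Sum>i<n. w i * (\<Sum>j<n. B i j * z j))" by (simp add: Bz_def)
      also have "\<dots> = (\<Sum>j<n. \<Sum>i<n. w i * (B i j * z j))"
        unfolding sum_distrib_left by (rule sum.swap)
      also have "\<dots> = (\<Sum>j<n. z j * (\<Sum>i<n. B j i * w i))"
        unfolding sum_distrib_left using B_sym by (intro sum.cong refl) (auto simp: mult_ac)
      also have "\<dots> = s" unfolding s_def using Bw by (intro sum.cong) (auto simp: power2_eq_square)
      finally show ?thesis .
    qed
    also have "(\<Sum>i<n. w i * z i) = QF z" unfolding QF_alt w_def by (simp add: mult.commute)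
    finally have "QF z \<ge> 2 * (s / M) - bz / M^2" by simp
    moreover have "bz / M^2 \<le> s / M"
      using bz M by (simp add: field_simps power2_eq_square)
    ultimately show ?thesis by (simp add: s_def)
  qed
  then show ?thesis using that[of "1 / M"] M by simp
qed

lemma QF_measurable[measurable]:
  "(\<And>k. k < n \<Longrightarrow> (\<lambda>x. g x k) \<in> borel_measurable M) \<Longrightarrow> (\<lambda>x. QF (g x)) \<in> borel_measurable M"
  unfolding QF_def by (auto intro!: borel_measurable_sum borel_measurable_times)

end

text \<open>P inverts the I-block of the covariance B, in general not the I-block of Q: it is the
  precision of the marginal on I.\<close>

locale psd_inverse_sub = psd_inverse_pair +
  fixes I :: "nat set" and P :: "nat \<Rightarrow> nat \<Rightarrow> real"
  assumes I_sub: "I \<subseteq> {..<n}"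
    and BP: "\<And>k l. k \<in> I \<Longrightarrow> l \<in> I \<Longrightarrow> (\<Sum>m\<in>I. B k m * P m l) = (if k = l then 1 else 0)"
begin

definition J where "J = {..<n} - I"

lemma IJ: "I \<inter> J = {}" "finite I" "finite J" "I \<union> J = {..<n}"
  using I_sub finite_subset[OF I_sub] by (auto simp: J_def)

definition qI :: "(nat \<Rightarrow> real) \<Rightarrow> real" where "qI d = (\<Sum>k\<in>I. \<Sum>l\<in>I. P k l * d k * d l)"

lemma qI_cong: "(\<And>k. k \<in> I \<Longrightarrow> d k = d' k) \<Longrightarrow> qI d = qI d'"
  unfolding qI_def by (intro sum.cong) auto

text \<open>Conditional mean of the centred Gaussian vector given its values d on I.\<close>

definition lift :: "(nat \<Rightarrow> real) \<Rightarrow> nat \<Rightarrow> real" where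
  "lift d k = (\<Sum>m\<in>I. B k m * (\<Sum>l\<in>I. P m l * d l))"

definition ext :: "(nat \<Rightarrow> real) \<Rightarrow> nat \<Rightarrow> real" where
  "ext h k = (if k \<in> J then h k else 0)"

text \<open>Since \<open>Q (lift d)\<close> vanishes off \<open>I\<close>, the cross term disappears: this completes the square in the
  coordinates off \<open>I\<close> without any block inverse.\<close>

lemma QF_split:
  "QF (\<lambda>k. if k \<in> I then d k else h k) = qI d + QF (ext (\<lambda>k. h k - lift d k))"
proof -
  define u where "u k = (if k \<in> I then (\<Sum>l\<in>I. P k l * d l) else 0)" for k
  have lift_u: "lift d k = (\<Sum>j<n. B k j * u j)" for k
  proof -
    have "(\<Sum>j<n. B k j * u j) = (\<Sum>j\<in>I. B k j * u j)"
      using I_sub by (intro sum.mono_neutral_right) (auto simp: u_def)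
    then show ?thesis by (simp add: lift_def u_def)
  qed
  have lift_I: "lift d k = d k" if "k \<in> I" for k
  proof -
    have "lift d k = (\<Sum>l\<in>I. (\<Sum>m\<in>I. B k m * P m l) * d l)"
      unfolding lift_def sum_distrib_left sum_distrib_right by (subst sum.swap) (simp add: mult_ac)
    also have "\<dots> = (\<Sum>l\<in>I. if k = l then d l else 0)"
      using BP[OF that] by (intro sum.cong) auto
    finally show ?thesis using that IJ by simp
  qed
  have Q_lift: "(\<Sum>j<n. Q i j * lift d j) = u i" if "i < n" for i
    unfolding lift_u by (rule Q_mult_B_mult[OF that])
  have "QF (\<lambda>k. if k \<in> I then d k else h k) = QF (\<lambda>k. lift d k + ext (\<lambda>k. h k - lift d k) k)"
    by (intro QF_cong) (auto simp: ext_def J_def lift_I)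
  also have "\<dots> = QF (lift d) + 2 * (\<Sum>i<n. ext (\<lambda>k. h k - lift d k) i * u i) + QF (ext (\<lambda>k. h k - lift d k))"
    unfolding QF_add using Q_lift by simp
  also have "(\<Sum>i<n. ext (\<lambda>k. h k - lift d k) i * u i) = 0"
    by (intro sum.neutral) (auto simp: ext_def u_def J_def)
  also have "QF (lift d) = (\<Sum>i<n. lift d i * u i)"
    unfolding QF_alt using Q_lift by simp
  also have "\<dots> = (\<Sum>i\<in>I. lift d i * u i)"
    using I_sub by (intro sum.mono_neutral_right) (auto simp: u_def)
  also have "\<dots> = qI d"
    by (auto simp: lift_I u_def qI_def sum_distrib_left mult_ac intro!: sum.cong)
  finally show ?thesis by simp
qed

text \<open>Filling the other coordinates with \<open>lift d\<close> makes the second square vanish,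
  so qI is a value of QF.\<close>

lemma qI_nonneg: "qI d \<ge> 0"
proof -
  have "QF (\<lambda>k. if k \<in> I then d k else lift d k) = qI d + QF (ext (\<lambda>k. lift d k - lift d k))"
    by (rule QF_split)
  also have "ext (\<lambda>k. lift d k - lift d k) = (\<lambda>k. 0)" by (auto simp: ext_def)
  finally have "qI d = QF (\<lambda>k. if k \<in> I then d k else lift d k)" by (simp add: QF_def)
  moreover obtain \<kappa> where "\<kappa> > 0" "\<And>z. QF z \<ge> \<kappa> * (\<Sum>i<n. (z i)^2)"
    using QF_lower_bound by blast
  ultimately show ?thesis by (smt (verit) mult_nonneg_nonneg sum_nonneg zero_le_power2)
qed

text \<open>After the split, the integral over J is that of a Gaussian whose centre depends on the
  I-coordinates; translation invariance removes this dependence and leaves a constant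
  factor.\<close>

lemma nn_integral_gaussian_marginal:
  assumes G[measurable]: "G \<in> borel_measurable (PiM I (\<lambda>_. lborel))"
  shows "(\<integral>\<^sup>+y. ennreal (exp (- QF (\<lambda>k. y k - m k) / 2)) * G (restrict y I) \<partial>PiM {..<n} (\<lambda>_. lborel))
    = (\<integral>\<^sup>+h. ennreal (exp (- QF (ext h) / 2)) \<partial>PiM J (\<lambda>_. lborel)) *
      (\<integral>\<^sup>+c. ennreal (exp (- qI (\<lambda>k. c k - m k) / 2)) * G c \<partial>PiM I (\<lambda>_. lborel))"
    (is "_ = ?K0 * _")
proof -
  have ext_k[measurable]: "(\<lambda>h. ext h k) \<in> borel_measurable (PiM J (\<lambda>_. lborel))" for k
    by (cases "k \<in> J") (auto simp: ext_def)
  have ext_meas[measurable]: "(\<lambda>h. QF (ext h)) \<in> borel_measurable (PiM J (\<lambda>_. lborel))"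
    by (rule QF_measurable) (rule ext_k)
  have [measurable]: "(\<lambda>y. G (restrict y I)) \<in> borel_measurable (PiM (I \<union> J) (\<lambda>_. lborel))"
    by (rule measurable_compose[OF measurable_restrict_subset G]) simp
  have [measurable]: "(\<lambda>y. QF (\<lambda>k. y k - m k)) \<in> borel_measurable (PiM (I \<union> J) (\<lambda>_. lborel))"
    unfolding IJ by (rule QF_measurable) measurable
  have [measurable]: "(\<lambda>c. qI (\<lambda>k. c k - m k)) \<in> borel_measurable (PiM I (\<lambda>_. lborel))"
    unfolding qI_def by measurable
  have "(\<integral>\<^sup>+y. ennreal (exp (- QF (\<lambda>k. y k - m k) / 2)) * G (restrict y I) \<partial>PiM (I \<union> J) (\<lambda>_. lborel))
    = (\<integral>\<^sup>+c. (\<integral>\<^sup>+h. ennreal (exp (- QF (\<lambda>k. merge I J (c, h) k - m k) / 2)) * G (restrict (merge I J (c, h)) I) \<partial>PiM J (\<lambda>_. lborel)) \<partial>PiM I (\<lambda>_. lborel))"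
    by (rule lborel_PiM.product_nn_integral_fold[OF IJ(1-3)]) measurable
  also have "\<dots> = (\<integral>\<^sup>+c. ?K0 * (ennreal (exp (- qI (\<lambda>k. c k - m k) / 2)) * G c) \<partial>PiM I (\<lambda>_. lborel))"
  proof (rule nn_integral_cong)
    fix c :: "nat \<Rightarrow> real" assume c: "c \<in> space (PiM I (\<lambda>_. lborel))"
    define d where "d k = c k - m k" for k
    have "(\<integral>\<^sup>+h. ennreal (exp (- QF (\<lambda>k. merge I J (c, h) k - m k) / 2)) * G (restrict (merge I J (c, h)) I) \<partial>PiM J (\<lambda>_. lborel))
      = (\<integral>\<^sup>+h. (ennreal (exp (- qI d / 2)) * G c) * ennreal (exp (- QF (ext (\<lambda>k\<in>J. h k + (- m k - lift d k))) / 2)) \<partial>PiM J (\<lambda>_. lborel))"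
    proof (rule nn_integral_cong)
      fix h :: "nat \<Rightarrow> real"
      have 1: "restrict (merge I J (c, h)) I = c"
        using c IJ by (auto simp: space_PiM PiE_def extensional_def merge_def restrict_def)
      have "QF (\<lambda>k. merge I J (c, h) k - m k) = QF (\<lambda>k. if k \<in> I then d k else h k - m k)"
        by (intro QF_cong) (auto simp: merge_def d_def J_def)
      also have "\<dots> = qI d + QF (ext (\<lambda>k. h k - m k - lift d k))" by (rule QF_split)
      also have "ext (\<lambda>k. h k - m k - lift d k) = ext (\<lambda>k\<in>J. h k + (- m k - lift d k))"
        by (auto simp: ext_def)
      finally have 2: "exp (- QF (\<lambda>k. merge I J (c, h) k - m k) / 2) = exp (- qI d / 2) * exp (- QF (ext (\<lambda>k\<in>J. h k + (- m k - lift d k))) / 2)"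
        by (simp add: field_simps flip: exp_add)
      show "ennreal (exp (- QF (\<lambda>k. merge I J (c, h) k - m k) / 2)) * G (restrict (merge I J (c, h)) I)
        = (ennreal (exp (- qI d / 2)) * G c) * ennreal (exp (- QF (ext (\<lambda>k\<in>J. h k + (- m k - lift d k))) / 2))"
        unfolding 1 2 by (simp add: ennreal_mult mult_ac)
    qed
    also have "\<dots> = (ennreal (exp (- qI d / 2)) * G c) * (\<integral>\<^sup>+h. ennreal (exp (- QF (ext (\<lambda>k\<in>J. h k + (- m k - lift d k))) / 2)) \<partial>PiM J (\<lambda>_. lborel))"
    proof (rule nn_integral_cmult)
      have [measurable]: "(\<lambda>h. QF (ext (\<lambda>k\<in>J. h k + (- m k - lift d k)))) \<in> borel_measurable (PiM J (\<lambda>_. lborel))"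
        by (rule measurable_compose[OF _ ext_meas]) (intro measurable_restrict, measurable)
      show "(\<lambda>h. ennreal (exp (- QF (ext (\<lambda>k\<in>J. h k + (- m k - lift d k))) / 2))) \<in> borel_measurable (PiM J (\<lambda>_. lborel))"
        by measurable
    qed
    also have "(\<integral>\<^sup>+h. ennreal (exp (- QF (ext (\<lambda>k\<in>J. h k + (- m k - lift d k))) / 2)) \<partial>PiM J (\<lambda>_. lborel)) = ?K0"
      by (rule nn_integral_PiM_translate[OF IJ(3)]) measurable
    also have "(ennreal (exp (- qI d / 2)) * G c) * ?K0 = ?K0 * (ennreal (exp (- qI d / 2)) * G c)"
      by (rule mult.commute)
    finally show "(\<integral>\<^sup>+h. ennreal (exp (- QF (\<lambda>k. merge I J (c, h) k - m k) / 2)) * G (restrict (merge I J (c, h)) I) \<partial>PiM J (\<lambda>_. lborel))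
      = ?K0 * (ennreal (exp (- qI (\<lambda>k. c k - m k) / 2)) * G c)"
      unfolding d_def .
  qed
  also have "\<dots> = ?K0 * (\<integral>\<^sup>+c. ennreal (exp (- qI (\<lambda>k. c k - m k) / 2)) * G c \<partial>PiM I (\<lambda>_. lborel))"
    by (rule nn_integral_cmult) measurable
  finally show ?thesis unfolding IJ(4) .
qed
end

section \<open>Tail asymptotics in abstract form\<close>

text \<open>Finiteness of the one-dimensional factors left by the inactive coordinates. Completing
  the square absorbs exp x into a shifted Gaussian.\<close>

lemma nn_integral_exp_gaussian_finite:
  fixes a m :: real
  assumes a: "a > 0"
  shows "(\<integral>\<^sup>+x. ennreal ((1 + exp x) * exp (- a * (x - m)^2)) \<partial>lborel) < \<infinity>"
proof -
  have gauss: "(\<integral>\<^sup>+x. ennreal (exp (- a * (x - b)^2)) \<partial>lborel) < \<infinity>" for b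
    using nn_integral_gaussian_1d[of "2 * a" "- b"] a by simp
  have sq: "x + - a * (x - m)^2 = (m + 1 / (4 * a)) + - a * (x - (m + 1 / (2 * a)))^2" for x
    using a by (simp add: field_simps power2_eq_square)
  have eq: "(1 + exp x) * exp (- a * (x - m)^2) = exp (- a * (x - m)^2) + exp (m + 1 / (4 * a)) * exp (- a * (x - (m + 1 / (2 * a)))^2)" for x
    unfolding exp_add[symmetric] sq[symmetric] by (simp add: distrib_right exp_add[symmetric])
  show ?thesis
    unfolding eq using gauss
    by (simp add: nn_integral_add nn_integral_cmult ennreal_mult ennreal_mult_less_top)
qed

lemma gaussian_weight_measurable:
  fixes a m :: real
  shows "(\<lambda>x. ennreal ((1 + exp x) * exp (- a * (x - m)^2))) \<in> borel_measurable lborel"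
  by measurable

text \<open>Replaces the slab width, a sum over inactive coordinates, by a product, so that the
  integral over them factorizes.\<close>

lemma sum_exp_le_prod:
  fixes x :: "'i \<Rightarrow> real"
  assumes "finite J"
  shows "(\<Sum>k\<in>J. exp (x k)) \<le> (\<Prod>k\<in>J. 1 + exp (x k))"
proof -
  have "1 + (\<Sum>k\<in>J. exp (x k)) \<le> (\<Prod>k\<in>J. 1 + exp (x k))"
    using assms
  proof (induction J rule: finite_induct)
    case (insert j J)
    have s: "(\<Sum>k\<in>J. exp (x k)) \<ge> 0" by (simp add: sum_nonneg)
    have "1 + (\<Sum>k\<in>insert j J. exp (x k)) \<le> (1 + exp (x j)) * (1 + (\<Sum>k\<in>J. exp (x k)))"
      using insert.hyps s by (simp add: algebra_simps)
    also have "\<dots> \<le> (1 + exp (x j)) * (\<Prod>k\<in>J. 1 + exp (x k))"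
      using insert.IH by (intro mult_left_mono) (auto simp: add_nonneg_nonneg)
    finally show ?case using insert.hyps by simp
  qed simp
  then show ?thesis by simp
qed

lemma slab_weight_measurable:
  fixes K :: "nat set"
  shows "(\<lambda>y. indicator {c. 1 + (\<Sum>k\<in>K. exp (c k)) \<le> exp (c i) \<and> exp (c i) < 1 + (\<Sum>k\<in>K. exp (c k)) + w} y
     * exp (- (\<theta> * y i) + (\<Sum>k\<in>K. \<beta> k * y k)) :: real) \<in> borel_measurable (PiM (insert i K) (\<lambda>_. lborel))"
proof -
  have [measurable]: "Measurable.pred (PiM (insert i K) (\<lambda>_. lborel)) (\<lambda>c. 1 + (\<Sum>k\<in>K. exp (c k)) \<le> exp (c i :: real))"
    unfolding pred_def by (rule borel_measurable_le) measurable
  have [measurable]: "Measurable.pred (PiM (insert i K) (\<lambda>_. lborel)) (\<lambda>c. exp (c i :: real) < 1 + (\<Sum>k\<in>K. exp (c k)) + w)"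
    unfolding pred_def by (rule borel_measurable_less) measurable
  show ?thesis by measurable
qed

text \<open>Shifting by t v makes A = Q v the linear coefficient of the exponent. Since A vanishes
  off the active set and v = 1 on it, v.Qv = S. The event becomes the region minus a thin set:
  \<open>laplace_tilt\<close> treats the region, and the slab bound treats the thin set.\<close>

lemma gaussian_tail_asymptotics:
  fixes B Q P :: "nat \<Rightarrow> nat \<Rightarrow> real" and A m v :: "nat \<Rightarrow> real" and \<kappa>0 Z :: real
  assumes sub: "psd_inverse_sub n B Q (insert i K) P" and reg: "region_tilt K i A"
    and A0: "\<And>k. k < n \<Longrightarrow> k \<notin> insert i K \<Longrightarrow> A k = 0"
    and Qv: "\<And>k. k < n \<Longrightarrow> (\<Sum>j<n. Q k j * v j) = A k"
    and v1: "\<And>k. k \<in> insert i K \<Longrightarrow> v k = 1"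
    and vlt: "\<And>k. k < n \<Longrightarrow> k \<notin> insert i K \<Longrightarrow> v k < 1"
    and \<kappa>0: "\<kappa>0 > 0"
    and mass: "(\<integral>\<^sup>+y. ennreal (\<kappa>0 * exp (- psd_inverse_pair.QF n Q (\<lambda>k. y k - m k) / 2)) \<partial>PiM {..<n} (\<lambda>_. lborel)) = 1"
    and Z: "Z > 0" "(\<integral>\<^sup>+c. ennreal (exp (- (\<Sum>k\<in>insert i K. \<Sum>l\<in>insert i K. P k l * c k * c l) / 2)) \<partial>PiM (insert i K) (\<lambda>_. lborel)) = ennreal Z"
  defines "S \<equiv> sum A (insert i K)"
  defines "main \<equiv> \<lambda>t. exp (- (t^2 * S) / 2 + t * (\<Sum>k\<in>insert i K. A k * m k)) *
      (exp (- (\<Sum>k\<in>insert i K. \<Sum>l\<in>insert i K. P k l * (region_tilt.opt K i A k - m k) * (region_tilt.opt K i A l - m l)) / 2) / Z)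
      * tilt_mass K i A t"
  obtains C T where "T > 0" "\<And>t. t \<ge> T \<Longrightarrow> \<exists>p\<ge>0.
     (\<integral>\<^sup>+y. ennreal (\<kappa>0 * exp (- psd_inverse_pair.QF n Q (\<lambda>k. y k - m k) / 2)) *
        indicator {y. exp (y i) - (\<Sum>k\<in>{..<n} - {i}. exp (y k)) \<ge> exp t} y \<partial>PiM {..<n} (\<lambda>_. lborel)) = ennreal p
     \<and> \<bar>p - main t\<bar> \<le> C / t * main t"
proof -
  interpret G: psd_inverse_sub n B Q "insert i K" P by (rule sub)
  interpret R: region_tilt K i A by (rule reg)
  define I where "I = insert i K"
  define J where "J = {..<n} - I"
  have Jeq: "G.J = J" by (simp add: G.J_def J_def I_def)
  have IJ: "I \<inter> J = {}" "finite I" "finite J" "I \<union> J = {..<n}" "i \<in> I" "i < n"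
    using G.IJ G.I_sub unfolding Jeq I_def by auto
  let ?L = "PiM {..<n} (\<lambda>_. lborel :: real measure)"
  let ?LI = "PiM I (\<lambda>_. lborel :: real measure)"
  let ?LJ = "PiM J (\<lambda>_. lborel :: real measure)"
  define p0 where "p0 y = \<kappa>0 * exp (- G.QF (\<lambda>k. y k - m k) / 2)" for y :: "nat \<Rightarrow> real"
  define \<phi> where "\<phi> c = exp (- G.qI (\<lambda>k. c k - m k) / 2)" for c :: "nat \<Rightarrow> real"
  define E where "E t = {y. exp (y i) - (\<Sum>k\<in>{..<n} - {i}. exp (y k)) \<ge> exp t}" for t :: real
  define tl where "tl t c = exp (- (t * (\<Sum>k\<in>I. A k * c k)))" for t :: real and c :: "nat \<Rightarrow> real"
  \<comment> \<open>The event \<open>E t\<close> after the shift and division by exp t; the factors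
    exp (- t (1 - v k)) are what damps the inactive coordinates.\<close>
  define E' where "E' t = {c. 1 + (\<Sum>k\<in>K. exp (c k)) + (\<Sum>k\<in>J. exp (c k - t * (1 - v k))) \<le> exp (c i)}" for t :: real
  have p0_pos: "p0 y \<ge> 0" for y using \<kappa>0 by (simp add: p0_def)
  have qI_meas[measurable]: "(\<lambda>c. G.qI (\<lambda>k. c k - m k)) \<in> borel_measurable ?LI"
    unfolding G.qI_def I_def by measurable
  have qm[measurable]: "(\<lambda>c. G.qI c) \<in> borel_measurable ?LI"
    unfolding G.qI_def I_def by measurable
  have comp[measurable]: "(\<lambda>y. y k) \<in> borel_measurable ?L" if "k \<in> {..<n}" for k
    using that by measurable
  have KI: "K \<subseteq> {..<n}" "J \<subseteq> {..<n}" "I \<subseteq> {..<n}" using IJ by (auto simp: I_def)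
  have compK[measurable]: "(\<lambda>y. y k) \<in> borel_measurable ?L" if "k \<in> K" for k
    using that KI comp by blast
  have compJ[measurable]: "(\<lambda>y. y k) \<in> borel_measurable ?L" if "k \<in> J" for k
    using that KI comp by blast
  have compI[measurable]: "(\<lambda>y. y k) \<in> borel_measurable ?L" if "k \<in> I" for k
    using that KI comp by blast
  have compi[measurable]: "(\<lambda>y. y i) \<in> borel_measurable ?L" using compI IJ by blast
  have p0_meas[measurable]: "p0 \<in> borel_measurable ?L"
  proof -
    have [measurable]: "(\<lambda>y. G.QF (\<lambda>k. y k - m k)) \<in> borel_measurable ?L"
      by (rule G.QF_measurable) (auto intro!: borel_measurable_diff comp)
    show ?thesis unfolding p0_def by measurable
  qed
  have \<phi>_meas[measurable]: "\<phi> \<in> borel_measurable ?LI"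
    unfolding \<phi>_def by measurable
  have tl_meas[measurable]: "tl t \<in> borel_measurable ?L" for t
    unfolding tl_def by measurable
  have E_meas[measurable]: "Measurable.pred ?L (\<lambda>y. y \<in> E t)" for t
    unfolding E_def mem_Collect_eq pred_def by (rule borel_measurable_le) (auto intro!: borel_measurable_diff borel_measurable_sum borel_measurable_exp comp compi)
  have E'_meas[measurable]: "Measurable.pred ?L (\<lambda>y. y \<in> E' t)" for t
    unfolding E'_def mem_Collect_eq pred_def by (rule borel_measurable_le) measurable
  have reg_meas[measurable]: "Measurable.pred ?L (\<lambda>y. y \<in> region K i)"
    unfolding region_def mem_Collect_eq pred_def by (rule borel_measurable_le) measurable
  define K0 where "K0 = (\<integral>\<^sup>+h. ennreal (exp (- G.QF (G.ext h) / 2)) \<partial>?LJ)"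
  have marg0: "(\<integral>\<^sup>+y. ennreal (p0 y) * F (restrict y I) \<partial>?L) = ennreal \<kappa>0 * (K0 * (\<integral>\<^sup>+c. ennreal (\<phi> c) * F c \<partial>?LI))"
    if F[measurable]: "F \<in> borel_measurable ?LI" for F
  proof -
    have [measurable]: "(\<lambda>y. F (restrict y I)) \<in> borel_measurable ?L"
      by (rule measurable_compose[OF measurable_restrict_subset F]) (rule KI)
    have [measurable]: "(\<lambda>y. G.QF (\<lambda>k. y k - m k)) \<in> borel_measurable ?L"
      by (rule G.QF_measurable) (auto intro!: borel_measurable_diff comp)
    have "(\<integral>\<^sup>+y. ennreal (p0 y) * F (restrict y I) \<partial>?L) = (\<integral>\<^sup>+y. ennreal \<kappa>0 * (ennreal (exp (- G.QF (\<lambda>k. y k - m k) / 2)) * F (restrict y I)) \<partial>?L)"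
      unfolding p0_def using \<kappa>0 by (simp add: ennreal_mult mult.assoc)
    also have "\<dots> = ennreal \<kappa>0 * (\<integral>\<^sup>+y. ennreal (exp (- G.QF (\<lambda>k. y k - m k) / 2)) * F (restrict y I) \<partial>?L)"
      by (rule nn_integral_cmult) measurable
    also have "(\<integral>\<^sup>+y. ennreal (exp (- G.QF (\<lambda>k. y k - m k) / 2)) * F (restrict y I) \<partial>?L) = K0 * (\<integral>\<^sup>+c. ennreal (\<phi> c) * F c \<partial>?LI)"
      unfolding K0_def \<phi>_def I_def Jeq[symmetric] by (rule G.nn_integral_gaussian_marginal) (rule F[unfolded I_def])
    finally show ?thesis .
  qed
  have Z\<phi>: "(\<integral>\<^sup>+c. ennreal (\<phi> c) \<partial>?LI) = ennreal Z"
  proof -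
    have "(\<integral>\<^sup>+c. ennreal (\<phi> c) \<partial>?LI) = (\<integral>\<^sup>+c. ennreal (exp (- G.qI (\<lambda>k\<in>I. c k + (- m k)) / 2)) \<partial>?LI)"
    proof (rule nn_integral_cong)
      fix c :: "nat \<Rightarrow> real"
      have "G.qI (\<lambda>k. c k - m k) = G.qI (\<lambda>k\<in>I. c k + (- m k))"
        by (rule G.qI_cong) (simp add: I_def)
      then show "ennreal (\<phi> c) = ennreal (exp (- G.qI (\<lambda>k\<in>I. c k + (- m k)) / 2))" by (simp add: \<phi>_def)
    qed
    also have "\<dots> = (\<integral>\<^sup>+c. ennreal (exp (- G.qI c / 2)) \<partial>?LI)"
      by (rule nn_integral_PiM_translate[OF IJ(2)]) measurable
    also have "\<dots> = ennreal Z" using Z(2) by (simp add: G.qI_def I_def)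
    finally show ?thesis .
  qed
  \<comment> \<open>\<open>K0\<close> is never computed; the total mass determines it.\<close>
  have \<kappa>K: "ennreal \<kappa>0 * K0 = ennreal (1 / Z)"
  proof -
    have "1 = ennreal \<kappa>0 * (K0 * ennreal Z)"
      using marg0[of "\<lambda>_. 1"] mass Z\<phi> by (simp add: p0_def)
    then have "ennreal (1 / Z) = (ennreal \<kappa>0 * K0) * (ennreal Z * ennreal (1 / Z))"
      by (metis mult.assoc mult_1)
    then show ?thesis using Z by (simp add: ennreal_mult[symmetric])
  qed
  have marg: "(\<integral>\<^sup>+y. ennreal (p0 y) * F (restrict y I) \<partial>?L) = ennreal (1 / Z) * (\<integral>\<^sup>+c. ennreal (\<phi> c) * F c \<partial>?LI)"
    if "F \<in> borel_measurable ?LI" for F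
    unfolding marg0[OF that] \<kappa>K[symmetric] by (simp only: mult.assoc)
  define H where "H t = (\<integral>\<^sup>+c. ennreal (p0 c * tl t c) * indicator (E' t) c \<partial>?L)" for t
  define e1 where "e1 t = exp (- (t^2 * S) / 2 + t * (\<Sum>k\<in>I. A k * m k))" for t :: real
  have sumA: "(\<Sum>k<n. f k * A k) = (\<Sum>k\<in>I. f k * A k)" for f
    using A0 KI by (intro sum.mono_neutral_right) (auto simp: I_def)
  \<comment> \<open>The quadratic form is expanded at t v: its square term is t^2 S, and its cross
    term is linear with coefficients A, hence sees only active coordinates.\<close>
  have sh1: "p0 (\<lambda>k\<in>{..<n}. c k + t * v k) = e1 t * (p0 c * tl t c)" for c t
  proof -
    have Qtv: "(\<Sum>j<n. Q k j * (t * v j)) = t * A k" if "k < n" for k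
      unfolding Qv[OF that, symmetric] sum_distrib_left by (simp add: mult_ac)
    have "G.QF (\<lambda>k. (\<lambda>k\<in>{..<n}. c k + t * v k) k - m k) = G.QF (\<lambda>k. t * v k + (c k - m k))"
      by (rule G.QF_cong) simp
    also have "\<dots> = G.QF (\<lambda>k. t * v k) + 2 * (\<Sum>k<n. (c k - m k) * (\<Sum>j<n. Q k j * (t * v j))) + G.QF (\<lambda>k. c k - m k)"
      by (rule G.QF_add)
    also have "(\<Sum>k<n. (c k - m k) * (\<Sum>j<n. Q k j * (t * v j))) = (\<Sum>k<n. (t * (c k - m k)) * A k)"
      using Qtv by (intro sum.cong) auto
    also have "\<dots> = t * (\<Sum>k\<in>I. A k * c k) - t * (\<Sum>k\<in>I. A k * m k)"
      unfolding sumA by (simp add: sum_distrib_left sum_subtractf algebra_simps)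
    also have "G.QF (\<lambda>k. t * v k) = (\<Sum>k<n. (t * v k * t) * A k)"
      unfolding G.QF_alt using Qtv by (intro sum.cong) auto
    also have "\<dots> = (\<Sum>k\<in>I. t^2 * A k)"
      unfolding sumA using v1 by (intro sum.cong) (auto simp: I_def power2_eq_square)
    also have "\<dots> = t^2 * S" by (simp add: S_def I_def sum_distrib_left)
    finally have eq: "- G.QF (\<lambda>k. (\<lambda>k\<in>{..<n}. c k + t * v k) k - m k) / 2 =
       (- (t^2 * S) / 2 + t * (\<Sum>k\<in>I. A k * m k)) + (- G.QF (\<lambda>k. c k - m k) / 2 + - (t * (\<Sum>k\<in>I. A k * c k)))"
      by (simp add: field_simps)
    show ?thesis unfolding p0_def eq e1_def tl_def exp_add by (simp only: mult_ac)
  qed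
  have sh2: "(\<lambda>k\<in>{..<n}. c k + t * v k) \<in> E t \<longleftrightarrow> c \<in> E' t" for c t
  proof -
    have dis: "{..<n} - {i} = K \<union> J" "K \<inter> J = {}" "finite K"
      using IJ R.K by (auto simp: I_def J_def)
    have "(\<Sum>k\<in>{..<n} - {i}. exp ((\<lambda>k\<in>{..<n}. c k + t * v k) k)) = (\<Sum>k\<in>{..<n} - {i}. exp (c k + t * v k))"
      by (intro sum.cong) auto
    also have "\<dots> = (\<Sum>k\<in>K. exp (c k + t * v k)) + (\<Sum>k\<in>J. exp (c k + t * v k))"
      unfolding dis(1) using dis IJ by (intro sum.union_disjoint) auto
    also have "(\<Sum>k\<in>K. exp (c k + t * v k)) = exp t * (\<Sum>k\<in>K. exp (c k))"
      unfolding sum_distrib_left using v1 by (intro sum.cong) (auto simp: exp_add)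
    also have "(\<Sum>k\<in>J. exp (c k + t * v k)) = exp t * (\<Sum>k\<in>J. exp (c k - t * (1 - v k)))"
      unfolding sum_distrib_left exp_add[symmetric] by (intro sum.cong) (auto simp: algebra_simps)
    finally have "(\<lambda>k\<in>{..<n}. c k + t * v k) \<in> E t \<longleftrightarrow> exp t * (1 + (\<Sum>k\<in>K. exp (c k)) + (\<Sum>k\<in>J. exp (c k - t * (1 - v k)))) \<le> exp t * exp (c i)"
      using IJ(6) v1 by (simp add: E_def exp_add algebra_simps)
    then show ?thesis by (simp add: E'_def)
  qed
  have FH: "(\<integral>\<^sup>+y. ennreal (p0 y) * indicator (E t) y \<partial>?L) = ennreal (e1 t) * H t" for t
  proof -
    have "(\<integral>\<^sup>+y. ennreal (p0 y) * indicator (E t) y \<partial>?L)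
       = (\<integral>\<^sup>+c. ennreal (p0 (\<lambda>k\<in>{..<n}. c k + t * v k)) * indicator (E t) (\<lambda>k\<in>{..<n}. c k + t * v k) \<partial>?L)"
      by (rule nn_integral_PiM_translate[symmetric]) (simp, measurable)
    also have "\<dots> = (\<integral>\<^sup>+c. ennreal (e1 t) * (ennreal (p0 c * tl t c) * indicator (E' t) c) \<partial>?L)"
      unfolding sh1 by (intro nn_integral_cong) (auto simp: indicator_def sh2 ennreal_mult' e1_def)
    also have "\<dots> = ennreal (e1 t) * H t"
      unfolding H_def by (rule nn_integral_cmult) measurable
    finally show ?thesis .
  qed
  \<comment> \<open>\<open>U\<close> integrates over the whole region, \<open>D\<close> over the
    part of it lost to the inactive coordinates, so that H = U - D.\<close>
  define U where "U t = (\<integral>\<^sup>+c. ennreal (p0 c * tilt K i A t c) \<partial>?L)" for t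
  define D where "D t = (\<integral>\<^sup>+c. ennreal (p0 c * tl t c) * indicator (region K i - E' t) c \<partial>?L)" for t
  have tilt_tl: "tilt K i A t c = indicator (region K i) c * tl t c" for t c
    by (simp add: tilt_def tl_def I_def)
  have E'_sub: "c \<in> E' t \<Longrightarrow> c \<in> region K i" for c t
  proof -
    assume "c \<in> E' t"
    moreover have "(\<Sum>k\<in>J. exp (c k - t * (1 - v k))) \<ge> 0" by (simp add: sum_nonneg)
    ultimately show ?thesis by (simp add: E'_def region_def)
  qed
  have UHD: "U t = H t + D t" for t
  proof -
    have "H t + D t = (\<integral>\<^sup>+c. ennreal (p0 c * tl t c) * indicator (E' t) c + ennreal (p0 c * tl t c) * indicator (region K i - E' t) c \<partial>?L)"
      unfolding H_def D_def by (rule nn_integral_add[symmetric]) measurable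
    also have "\<dots> = U t"
      unfolding U_def tilt_tl using E'_sub by (intro nn_integral_cong) (auto simp: indicator_def)
    finally show ?thesis ..
  qed
  have tilt_restr: "tilt K i A t c = tilt K i A t (restrict c I)" for t c
  proof -
    have "(\<Sum>k\<in>insert i K. A k * c k) = (\<Sum>k\<in>insert i K. A k * restrict c I k)"
      by (intro sum.cong) (auto simp: I_def)
    moreover have "(\<Sum>k\<in>K. exp (c k)) = (\<Sum>k\<in>K. exp (restrict c I k))"
      by (intro sum.cong) (auto simp: I_def)
    moreover have "restrict c I i = c i" by (simp add: I_def)
    ultimately show ?thesis by (simp only: tilt_def region_def indicator_def mem_Collect_eq)
  qed
  have U: "U t = ennreal (1 / Z) * (\<integral>\<^sup>+c. ennreal (tilt K i A t c * \<phi> c) \<partial>?LI)" for t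
  proof -
    have "U t = (\<integral>\<^sup>+c. ennreal (p0 c) * ennreal (tilt K i A t (restrict c I)) \<partial>?L)"
      unfolding U_def tilt_restr[symmetric] using p0_pos R.tilt_nonneg by (simp add: ennreal_mult)
    also have "\<dots> = ennreal (1 / Z) * (\<integral>\<^sup>+c. ennreal (\<phi> c) * ennreal (tilt K i A t c) \<partial>?LI)"
    proof (rule marg)
      have [measurable]: "tilt K i A t \<in> borel_measurable ?LI"
        using R.tilt_measurable[of t] by (simp only: I_def)
      show "(\<lambda>c. ennreal (tilt K i A t c)) \<in> borel_measurable ?LI" by measurable
    qed
    finally show ?thesis
      using R.tilt_nonneg by (simp add: ennreal_mult[symmetric] \<phi>_def mult.commute)
  qed
  have qn: "0 \<le> (\<Sum>k\<in>insert i K. \<Sum>l\<in>insert i K. P k l * d k * d l)" for d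
    using G.qI_nonneg by (simp only: G.qI_def)
  have \<phi>_alt: "exp (- (\<Sum>k\<in>insert i K. \<Sum>l\<in>insert i K. P k l * (c k - m k) * (c l - m l)) / 2) = \<phi> c" for c
    by (simp only: \<phi>_def G.qI_def)
  obtain C1 T V where T: "T > 0"
    and V: "\<And>t. t \<ge> T \<Longrightarrow> has_bochner_integral ?LI (\<lambda>c. tilt K i A t c * \<phi> c) (V t)"
    and Vb: "\<And>t. t \<ge> T \<Longrightarrow> \<bar>V t - \<phi> R.opt * tilt_mass K i A t\<bar> \<le> C1 / t * tilt_mass K i A t"
    by (rule R.laplace_tilt[of P m, OF qn, unfolded \<phi>_alt, folded I_def]) (rule that; assumption)
  have UV: "U t = ennreal (V t / Z)" "V t \<ge> 0" if t: "t \<ge> T" for t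
  proof -
    have nn: "0 \<le> tilt K i A t c * \<phi> c" for c using R.tilt_nonneg by (simp add: \<phi>_def)
    have "(\<integral>\<^sup>+c. ennreal (tilt K i A t c * \<phi> c) \<partial>?LI) = ennreal (\<integral>c. tilt K i A t c * \<phi> c \<partial>?LI)"
      using V[OF t] nn by (intro nn_integral_eq_integral) (auto simp: has_bochner_integral_iff)
    also have "(\<integral>c. tilt K i A t c * \<phi> c \<partial>?LI) = V t" using V[OF t] by (simp add: has_bochner_integral_iff)
    finally have 1: "(\<integral>\<^sup>+c. ennreal (tilt K i A t c * \<phi> c) \<partial>?LI) = ennreal (V t)" .
    have "(\<integral>c. tilt K i A t c * \<phi> c \<partial>?LI) \<ge> 0" using nn by (rule Bochner_Integration.integral_nonneg)
    then show V0: "V t \<ge> 0" using V[OF t] by (simp add: has_bochner_integral_iff)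
    show "U t = ennreal (V t / Z)"
      unfolding U 1 using V0 Z by (simp add: ennreal_mult[symmetric])
  qed
  obtain \<kappa> where \<kappa>: "\<kappa> > 0" "\<And>z. G.QF z \<ge> \<kappa> * (\<Sum>k<n. (z k)^2)"
    using G.QF_lower_bound by blast
  \<comment> \<open>The smallest gap 1 - v k, positive by strictness off the active set. The
    inserted 1 keeps \<open>Min\<close> meaningful when J is empty.\<close>
  define \<delta> where "\<delta> = Min (insert 1 ((\<lambda>k. 1 - v k) ` J))"
  have \<delta>: "\<delta> > 0" "\<And>k. k \<in> J \<Longrightarrow> \<delta> \<le> 1 - v k"
  proof -
    have "0 < 1 - v k" if "k \<in> J" for k using vlt[of k] that by (auto simp: J_def I_def)
    then show "\<delta> > 0" unfolding \<delta>_def using IJ(3) by (subst Min_gr_iff) auto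
    show "\<delta> \<le> 1 - v k" if "k \<in> J" for k unfolding \<delta>_def using IJ(3) that by (intro Min_le) auto
  qed
  \<comment> \<open>Half of the lower bound for QF, kept on the inactive coordinates only; on the
    active ones the density is bounded by a constant, so that the slab integral is of Dirichlet
    type.\<close>
  define g where "g k x = exp (- (\<kappa> / 2) * (x - m k)^2)" for k x
  define W where "W t x = exp (- (\<delta> * t)) * (\<Sum>k\<in>J. exp (x k))" for t :: real and x :: "nat \<Rightarrow> real"
  define gI where "gI k = enn2real (\<integral>\<^sup>+x. ennreal ((1 + exp x) * g k x) \<partial>lborel)" for k
  have gI: "(\<integral>\<^sup>+x. ennreal ((1 + exp x) * g k x) \<partial>lborel) = ennreal (gI k)" for k
    using nn_integral_exp_gaussian_finite[of "\<kappa> / 2" "m k"] \<kappa>(1) unfolding gI_def g_def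
    by (simp add: less_top)
  have p0_le: "p0 c \<le> \<kappa>0 * (\<Prod>k\<in>J. g k (c k))" for c
  proof -
    have "\<kappa> * (\<Sum>k\<in>J. (c k - m k)^2) \<le> \<kappa> * (\<Sum>k<n. (c k - m k)^2)"
      using \<kappa>(1) KI by (intro mult_left_mono sum_mono2) auto
    also have "\<dots> \<le> G.QF (\<lambda>k. c k - m k)" by (rule \<kappa>(2))
    finally have "- G.QF (\<lambda>k. c k - m k) / 2 \<le> - (\<kappa> / 2) * (\<Sum>k\<in>J. (c k - m k)^2)"
      by linarith
    then have "- G.QF (\<lambda>k. c k - m k) / 2 \<le> (\<Sum>k\<in>J. - (\<kappa> / 2) * (c k - m k)^2)"
      by (simp only: sum_distrib_left)
    then have "exp (- G.QF (\<lambda>k. c k - m k) / 2) \<le> (\<Prod>k\<in>J. g k (c k))"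
      unfolding g_def exp_sum[OF IJ(3), symmetric] by simp
    then show ?thesis unfolding p0_def using \<kappa>0 by (intro mult_left_mono) auto
  qed
  define slab where "slab w = {c. 1 + (\<Sum>k\<in>K. exp (c k)) \<le> exp (c i) \<and> exp (c i) < 1 + (\<Sum>k\<in>K. exp (c k)) + w}" for w :: real
  have slabI: "c \<in> slab (W t c)" if c: "c \<in> region K i - E' t" and t: "t > 0" for c t
  proof -
    have "(\<Sum>k\<in>J. exp (c k - t * (1 - v k))) \<le> (\<Sum>k\<in>J. exp (- (\<delta> * t)) * exp (c k))"
      unfolding exp_add[symmetric] using \<delta>(2) t by (intro sum_mono) (auto simp: mult.commute)
    then show ?thesis
      using c by (auto simp: slab_def region_def E'_def W_def sum_distrib_left)
  qed
  define f where "f t c = ennreal (\<kappa>0 * (\<Prod>k\<in>J. g k (c k)) * tl t c) * indicator (slab (W t c)) c" for t c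
  have [measurable]: "g k \<in> borel_measurable borel" for k unfolding g_def by measurable
  have gm: "(\<lambda>x. ennreal ((1 + exp x) * g k x)) \<in> borel_measurable lborel" for k
    unfolding g_def by (rule gaussian_weight_measurable)
  have slab_meas: "Measurable.pred ?L (\<lambda>c. c \<in> slab (W t c))" for t
  proof -
    have [measurable]: "Measurable.pred ?L (\<lambda>c. 1 + (\<Sum>k\<in>K. exp (c k)) \<le> exp (c i))"
      unfolding pred_def by (rule borel_measurable_le) measurable
    have [measurable]: "Measurable.pred ?L (\<lambda>c. exp (c i) < 1 + (\<Sum>k\<in>K. exp (c k)) + W t c)"
      unfolding pred_def W_def by (rule borel_measurable_less) measurable
    show ?thesis unfolding slab_def mem_Collect_eq by measurable
  qed
  have f_meas[measurable]: "f t \<in> borel_measurable ?L" for t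
    unfolding f_def using slab_meas[of t] by measurable
  have Ip: "insert i K = I" by (simp add: I_def)
  define Dt where "Dt t = dirichlet_int K (t * A i) (\<lambda>k. - (t * A k))" for t
  have D_le: "D t \<le> ennreal (\<kappa>0 * exp (- (\<delta> * t)) * Dt t * (\<Prod>k\<in>J. gI k))" if t: "t > 0" for t
  proof -
    have Dt0: "Dt t > 0" unfolding Dt_def by (rule dirichlet_int_pos[OF R.weights(1,3)[OF t]])
    have g0: "g k x > 0" for k x by (simp add: g_def)
    have "D t \<le> (\<integral>\<^sup>+c. f t c \<partial>?L)"
      unfolding D_def
    proof (rule nn_integral_mono)
      fix c :: "nat \<Rightarrow> real"
      show "ennreal (p0 c * tl t c) * indicator (region K i - E' t) c \<le> f t c"
      proof (cases "c \<in> region K i - E' t")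
        case True
        then show ?thesis
          using slabI[OF True t] p0_le[of c] unfolding f_def
          by (auto intro!: ennreal_leI mult_right_mono simp: tl_def)
      qed simp
    qed
    also have "\<dots> = (\<integral>\<^sup>+c. f t c \<partial>PiM (J \<union> I) (\<lambda>_. lborel))"
      using IJ(4) by (simp add: Un_commute)
    \<comment> \<open>The slab width depends on the J-coordinates alone. With these fixed, the inner
      integral is a slab integral of constant width.\<close>
    also have "\<dots> = (\<integral>\<^sup>+x. (\<integral>\<^sup>+y. f t (merge J I (x, y)) \<partial>?LI) \<partial>?LJ)"
      by (rule lborel_PiM.product_nn_integral_fold) (use IJ f_meas[of t] in \<open>auto simp: Un_commute\<close>)
    also have "\<dots> \<le> (\<integral>\<^sup>+x. ennreal (\<kappa>0 * exp (- (\<delta> * t)) * Dt t) * (\<Prod>k\<in>J. ennreal ((1 + exp (x k)) * g k (x k))) \<partial>?LJ)"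
    proof (rule nn_integral_mono)
      fix x :: "nat \<Rightarrow> real"
      have W0: "W t x \<ge> 0" by (simp add: W_def sum_nonneg)
      have pg: "(\<Prod>k\<in>J. g k (x k)) \<ge> 0" using g0 by (intro prod_nonneg) (simp add: less_imp_le)
      define s where "s y = indicator (slab (W t x)) y * exp (- (t * A i * y i) + (\<Sum>k\<in>K. - (t * A k) * y k))" for y
      have mi: "merge J I (x, y) k = y k" if "k \<in> I" for y k using that IJ by (auto simp: merge_def)
      have mj: "merge J I (x, y) k = x k" if "k \<in> J" for y k using that IJ by (auto simp: merge_def)
      have f_eq: "f t (merge J I (x, y)) = ennreal (\<kappa>0 * (\<Prod>k\<in>J. g k (x k))) * ennreal (s y)" for y
      proof -
        have "W t (merge J I (x, y)) = W t x" unfolding W_def using mj by simp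
        moreover have "(merge J I (x, y) \<in> slab w) = (y \<in> slab w)" for w
          unfolding slab_def using mi by (simp add: I_def)
        moreover have "tl t (merge J I (x, y)) = exp (- (t * A i * y i) + (\<Sum>k\<in>K. - (t * A k) * y k))"
          unfolding tl_def using mi R.K by (simp add: I_def sum_negf sum_distrib_left algebra_simps)
        moreover have "(\<Prod>k\<in>J. g k (merge J I (x, y) k)) = (\<Prod>k\<in>J. g k (x k))" using mj by simp
        ultimately show ?thesis
          unfolding f_def s_def using \<kappa>0 pg by (auto simp: indicator_def ennreal_mult)
      qed
      have s_meas[measurable]: "s \<in> borel_measurable ?LI"
        unfolding s_def slab_def I_def by (rule slab_weight_measurable)
      have "(\<integral>\<^sup>+y. f t (merge J I (x, y)) \<partial>?LI) = ennreal (\<kappa>0 * (\<Prod>k\<in>J. g k (x k))) * (\<integral>\<^sup>+y. ennreal (s y) \<partial>?LI)"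
        unfolding f_eq by (rule nn_integral_cmult) measurable
      also have "\<dots> \<le> ennreal (\<kappa>0 * (\<Prod>k\<in>J. g k (x k))) * ennreal (W t x * Dt t)"
        unfolding s_def slab_def Dt_def I_def
        by (intro mult_left_mono nn_integral_slab R.K R.weights(1,3)[OF t] W0) auto
      also have "\<dots> = ennreal (\<kappa>0 * (\<Prod>k\<in>J. g k (x k)) * (W t x * Dt t))"
        using \<kappa>0 pg W0 Dt0 by (simp add: ennreal_mult)
      also have "\<dots> \<le> ennreal (\<kappa>0 * (\<Prod>k\<in>J. g k (x k)) * (exp (- (\<delta> * t)) * (\<Prod>k\<in>J. 1 + exp (x k)) * Dt t))"
        unfolding W_def using sum_exp_le_prod[OF IJ(3), of x] \<kappa>0 pg Dt0
        by (intro ennreal_leI mult_left_mono mult_right_mono) auto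
      also have "\<kappa>0 * (\<Prod>k\<in>J. g k (x k)) * (exp (- (\<delta> * t)) * (\<Prod>k\<in>J. 1 + exp (x k)) * Dt t)
        = \<kappa>0 * exp (- (\<delta> * t)) * Dt t * (\<Prod>k\<in>J. (1 + exp (x k)) * g k (x k))"
        by (simp add: prod.distrib)
      also have "ennreal \<dots> = ennreal (\<kappa>0 * exp (- (\<delta> * t)) * Dt t) * (\<Prod>k\<in>J. ennreal ((1 + exp (x k)) * g k (x k)))"
        using \<kappa>0 Dt0 g0 by (subst prod_ennreal) (auto intro!: ennreal_mult prod_nonneg mult_nonneg_nonneg add_nonneg_nonneg simp: less_imp_le)
      finally show "(\<integral>\<^sup>+y. f t (merge J I (x, y)) \<partial>?LI) \<le> ennreal (\<kappa>0 * exp (- (\<delta> * t)) * Dt t) * (\<Prod>k\<in>J. ennreal ((1 + exp (x k)) * g k (x k)))" .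
    qed
    also have "\<dots> = ennreal (\<kappa>0 * exp (- (\<delta> * t)) * Dt t) * (\<integral>\<^sup>+x. (\<Prod>k\<in>J. ennreal ((1 + exp (x k)) * g k (x k))) \<partial>?LJ)"
    proof (rule nn_integral_cmult)
      have [measurable]: "(\<lambda>x. x k) \<in> borel_measurable ?LJ" if "k \<in> J" for k
        using measurable_component_singleton[OF that, of "\<lambda>_. lborel :: real measure"] by simp
      show "(\<lambda>x. \<Prod>k\<in>J. ennreal ((1 + exp (x k)) * g k (x k))) \<in> borel_measurable ?LJ"
        by measurable
    qed
    also have "(\<integral>\<^sup>+x. (\<Prod>k\<in>J. ennreal ((1 + exp (x k)) * g k (x k))) \<partial>?LJ) = (\<Prod>k\<in>J. ennreal (gI k))"
      unfolding gI[symmetric] by (rule lborel_PiM.product_nn_integral_prod[OF IJ(3)]) (rule gm)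
    also have "\<dots> = ennreal (\<Prod>k\<in>J. gI k)"
      by (rule prod_ennreal) (simp add: gI_def)
    also have "ennreal (\<kappa>0 * exp (- (\<delta> * t)) * Dt t) * ennreal (\<Prod>k\<in>J. gI k) = ennreal (\<kappa>0 * exp (- (\<delta> * t)) * Dt t * (\<Prod>k\<in>J. gI k))"
      using \<kappa>0 Dt0 by (intro ennreal_mult[symmetric] prod_nonneg) (auto simp: gI_def)
    finally show ?thesis .
  qed
  \<comment> \<open>\<open>Dt\<close> exceeds \<open>tilt_mass\<close> by the factor t A i, and exp
    (\<delta> t) >= (\<delta> t)^2 / 2 gives t exp (- \<delta> t) <= 2 / (\<delta>^2 t).\<close>
  define C2 where "C2 = \<kappa>0 * A i * (\<Prod>k\<in>J. gI k) * (2 / \<delta>^2)"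
  have gIp: "(\<Prod>k\<in>J. gI k) \<ge> 0" by (intro prod_nonneg) (simp add: gI_def)
  have D_le2: "D t \<le> ennreal (C2 / t * tilt_mass K i A t)" if t: "t > 0" for t
  proof -
    have N: "tilt_mass K i A t > 0" by (rule R.tilt_mass_pos[OF t])
    have Dt: "Dt t = t * A i * tilt_mass K i A t"
      using t R.A_i by (simp add: Dt_def tilt_mass_def)
    have "t * exp (- (\<delta> * t)) \<le> 2 / \<delta>^2 / t"
    proof -
      have "(\<delta> * t)^2 / 2 \<le> exp (\<delta> * t)"
        using exp_lower_Taylor_quadratic[of "\<delta> * t"] \<delta>(1) t by (smt (verit) mult_pos_pos)
      then have "1 / exp (\<delta> * t) \<le> 1 / ((\<delta> * t)^2 / 2)"
        using \<delta>(1) t by (intro divide_left_mono) auto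
      then have "t * exp (- (\<delta> * t)) \<le> t * (1 / ((\<delta> * t)^2 / 2))"
        using t by (intro mult_left_mono) (simp_all only: exp_minus inverse_eq_divide less_imp_le)
      also have "\<dots> = 2 / \<delta>^2 / t" using t \<delta>(1) by (simp add: power_mult_distrib power2_eq_square)
      finally show ?thesis .
    qed
    then have "\<kappa>0 * A i * (\<Prod>k\<in>J. gI k) * tilt_mass K i A t * (t * exp (- (\<delta> * t))) \<le> \<kappa>0 * A i * (\<Prod>k\<in>J. gI k) * tilt_mass K i A t * (2 / \<delta>^2 / t)"
      using \<kappa>0 R.A_i N gIp by (intro mult_left_mono) auto
    then have "\<kappa>0 * exp (- (\<delta> * t)) * Dt t * (\<Prod>k\<in>J. gI k) \<le> C2 / t * tilt_mass K i A t"
      by (simp add: Dt C2_def mult_ac)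
    then show ?thesis using D_le[OF t] ennreal_leI order_trans by blast
  qed
  define \<phi>0 where "\<phi>0 = \<phi> R.opt"
  have \<phi>0: "\<phi>0 > 0" by (simp add: \<phi>0_def \<phi>_def)
  have main: "main t = e1 t * (\<phi>0 / Z) * tilt_mass K i A t" for t
    by (simp add: main_def e1_def \<phi>0_def \<phi>_def G.qI_def I_def)
  \<comment> \<open>The two errors are relative to \<open>tilt_mass\<close>; the factor Z / \<phi>0
    makes them relative to \<open>main\<close>.\<close>
  define C where "C = (C1 / Z + C2) * (Z / \<phi>0)"
  show thesis
  proof (rule that[OF T, of C])
    fix t assume tT: "t \<ge> T"
    then have t: "t > 0" using T by simp
    let ?N = "tilt_mass K i A t"
    have N: "?N > 0" by (rule R.tilt_mass_pos[OF t])
    have e1: "e1 t > 0" by (simp add: e1_def)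
    define Hr where "Hr = enn2real (H t)"
    define Dr where "Dr = enn2real (D t)"
    have UU: "H t + D t = ennreal (V t / Z)" using UHD UV(1)[OF tT] by metis
    then have fin: "H t < \<infinity>" "D t < \<infinity>"
      by (metis ennreal_add_eq_top ennreal_less_top infinity_ennreal_def less_top)+
    have Hr: "H t = ennreal Hr" "Hr \<ge> 0" and Dr: "D t = ennreal Dr" "Dr \<ge> 0"
      using fin by (auto simp: Hr_def Dr_def less_top)
    have VH: "V t / Z = Hr + Dr"
      using UU UV(2)[OF tT] Z(1) Hr(2) Dr(2) unfolding Hr(1) Dr(1) by (simp flip: ennreal_plus)
    have Dr_le: "Dr \<le> C2 / t * ?N"
    proof -
      have "0 \<le> C2 / t * ?N" using \<kappa>0 R.A_i gIp t N by (auto simp: C2_def)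
      then show ?thesis using D_le2[OF t] unfolding Dr(1) by (simp add: ennreal_le_iff)
    qed
    have "\<bar>V t / Z - \<phi>0 * ?N / Z\<bar> \<le> C1 / t * ?N / Z"
      using divide_right_mono[OF Vb[OF tT], of Z] Z(1) by (simp add: \<phi>0_def flip: diff_divide_distrib)
    then have Hb: "\<bar>Hr - \<phi>0 * ?N / Z\<bar> \<le> C1 / t * ?N / Z + C2 / t * ?N"
      using VH Dr_le Dr(2) by linarith
    show "\<exists>p\<ge>0. (\<integral>\<^sup>+y. ennreal (\<kappa>0 * exp (- G.QF (\<lambda>k. y k - m k) / 2)) *
        indicator {y. exp (y i) - (\<Sum>k\<in>{..<n} - {i}. exp (y k)) \<ge> exp t} y \<partial>?L) = ennreal p
       \<and> \<bar>p - main t\<bar> \<le> C / t * main t"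
    proof (intro exI conjI)
      show "0 \<le> e1 t * Hr" using e1 Hr by simp
      show "(\<integral>\<^sup>+y. ennreal (\<kappa>0 * exp (- G.QF (\<lambda>k. y k - m k) / 2)) *
        indicator {y. exp (y i) - (\<Sum>k\<in>{..<n} - {i}. exp (y k)) \<ge> exp t} y \<partial>?L) = ennreal (e1 t * Hr)"
        using FH[of t] e1 Hr by (simp add: p0_def E_def ennreal_mult)
      have "e1 t * Hr - main t = e1 t * (Hr - \<phi>0 * ?N / Z)"
        unfolding main right_diff_distrib by simp
      then have "\<bar>e1 t * Hr - main t\<bar> = e1 t * \<bar>Hr - \<phi>0 * ?N / Z\<bar>"
        using e1 by (simp add: abs_mult)
      also have "\<dots> \<le> e1 t * (C1 / t * ?N / Z + C2 / t * ?N)"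
        using Hb e1 by (intro mult_left_mono) auto
      also have "\<dots> = C / t * main t"
        using \<phi>0 Z(1) t by (simp add: C_def main field_simps)
      finally show "\<bar>e1 t * Hr - main t\<bar> \<le> C / t * main t" .
    qed
  qed
qed

section \<open>Optimality conditions for the minimizer\<close>

text \<open>A nonzero determinant excludes \<open>None\<close> in \<open>mat_inverse\<close>, so
  \<open>the\<close> returns a genuine inverse.\<close>

lemma minv_inverse:
  assumes A: "A \<in> carrier_mat n n" and det: "det A \<noteq> 0"
  shows "A * minv A = 1\<^sub>m n" "minv A * A = 1\<^sub>m n" "minv A \<in> carrier_mat n n"
proof -
  have "A \<in> Units (ring_mat TYPE(real) n ())"
    by (rule det_non_zero_imp_unit[OF A det])
  then have "mat_inverse A \<noteq> None" using mat_inverse(1)[OF A, of "()"] by blast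
  then obtain C where C: "mat_inverse A = Some C" by blast
  with mat_inverse(2)[OF A C] show "A * minv A = 1\<^sub>m n" "minv A * A = 1\<^sub>m n" "minv A \<in> carrier_mat n n"
    by (auto simp: minv_def)
qed

lemma minv_sym:
  assumes A: "A \<in> carrier_mat n n" and det: "det A \<noteq> 0"
    and sym: "\<And>i j. i < n \<Longrightarrow> j < n \<Longrightarrow> A $$ (i, j) = A $$ (j, i)"
    and ij: "i < n" "j < n"
  shows "minv A $$ (i, j) = minv A $$ (j, i)"
proof -
  note inv = minv_inverse[OF A det]
  have At: "transpose_mat A = A" using A sym by (intro eq_matI) auto
  have "transpose_mat (A * minv A) = transpose_mat (minv A) * transpose_mat A"
    by (rule transpose_mult[OF A inv(3)])
  then have 1: "transpose_mat (minv A) * A = 1\<^sub>m n" unfolding inv(1) At by simp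
  have "transpose_mat (minv A) = transpose_mat (minv A) * (A * minv A)"
    using inv by simp
  also have "\<dots> = transpose_mat (minv A) * A * minv A"
    using A inv by (subst assoc_mult_mat[of _ n n _ n _ n]) auto
  also have "\<dots> = minv A" using inv 1 by simp
  finally have "transpose_mat (minv A) = minv A" .
  then have "transpose_mat (minv A) $$ (j, i) = minv A $$ (j, i)" by simp
  then show ?thesis using ij inv(3) by simp
qed

lemma minv_sum:
  assumes A: "A \<in> carrier_mat n n" and det: "det A \<noteq> 0" and ik: "i < n" "k < n"
  shows "(\<Sum>j<n. A $$ (i, j) * minv A $$ (j, k)) = (if i = k then 1 else 0)"
proof -
  note inv = minv_inverse[OF A det]
  have "(A * minv A) $$ (i, k) = (\<Sum>j<n. A $$ (i, j) * minv A $$ (j, k))"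
    using A inv(3) ik by (simp add: scalar_prod_def atLeast0LessThan)
  then show ?thesis using inv(1) ik by simp
qed

lemma psd_inverse_pair_minv:
  assumes A: "A \<in> carrier_mat n n" and det: "det A \<noteq> 0"
    and sym: "\<And>i j. i < n \<Longrightarrow> j < n \<Longrightarrow> A $$ (i, j) = A $$ (j, i)"
    and psd: "\<And>z. (\<Sum>i<n. \<Sum>j<n. A $$ (i, j) * z i * z j) \<ge> 0"
  shows "psd_inverse_pair n (\<lambda>i j. A $$ (i, j)) (\<lambda>i j. minv A $$ (i, j))"
  by unfold_locales (use assms minv_sym[OF A det] minv_sum[OF A det] in auto)

context psd_inverse_pair begin

text \<open>Since z = Q (B z), the form z.Bz equals QF at B z, and B z is nonzero when z is.\<close>

lemma B_pd:
  assumes "\<exists>k<n. z k \<noteq> 0"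
  shows "(\<Sum>i<n. \<Sum>j<n. B i j * z i * z j) > 0"
proof -
  define h where "h i = (\<Sum>j<n. B i j * z j)" for i
  have Qh: "(\<Sum>j<n. Q i j * h j) = z i" if "i < n" for i
    unfolding h_def by (rule Q_mult_B_mult[OF that])
  have eq: "(\<Sum>i<n. \<Sum>j<n. B i j * z i * z j) = QF h"
  proof -
    have "QF h = (\<Sum>i<n. h i * z i)" unfolding QF_alt using Qh by simp
    also have "\<dots> = (\<Sum>i<n. \<Sum>j<n. B i j * z i * z j)"
      unfolding h_def sum_distrib_right by (simp add: mult_ac)
    finally show ?thesis ..
  qed
  obtain \<kappa> where \<kappa>: "\<kappa> > 0" "\<And>z. QF z \<ge> \<kappa> * (\<Sum>i<n. (z i)^2)" using QF_lower_bound by blast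
  obtain k where k: "k < n" "z k \<noteq> 0" using assms by blast
  have "\<exists>j<n. h j \<noteq> 0"
  proof (rule ccontr)
    assume "\<not> ?thesis"
    then have "(\<Sum>j<n. Q k j * h j) = 0" by (intro sum.neutral) auto
    then show False using Qh[OF k(1)] k(2) by simp
  qed
  then obtain j where j: "j < n" "h j \<noteq> 0" by blast
  have "0 < (h j)^2" using j by simp
  also have "\<dots> \<le> (\<Sum>i<n. (h i)^2)" using j by (intro member_le_sum) auto
  finally have "0 < \<kappa> * (\<Sum>i<n. (h i)^2)" using \<kappa>(1) by simp
  then show ?thesis using \<kappa>(2)[of h] eq by simp
qed

lemma Q_pd:
  assumes "\<exists>k<n. z k \<noteq> 0"
  shows "(\<Sum>i<n. \<Sum>j<n. Q i j * z i * z j) > 0"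
proof -
  obtain \<kappa> where \<kappa>: "\<kappa> > 0" "\<And>z. QF z \<ge> \<kappa> * (\<Sum>i<n. (z i)^2)" using QF_lower_bound by blast
  obtain j where j: "j < n" "z j \<noteq> 0" using assms by blast
  have "0 < (z j)^2" using j by simp
  also have "\<dots> \<le> (\<Sum>i<n. (z i)^2)" using j by (intro member_le_sum) auto
  finally have "0 < \<kappa> * (\<Sum>i<n. (z i)^2)" using \<kappa>(1) by simp
  then show ?thesis using \<kappa>(2)[of z] by (simp add: QF_def)
qed

end

lemma quad_form_alt: "quad_form n B u v = (\<Sum>i<n. u i * (\<Sum>j<n. B $$ (i, j) * v j))"
  unfolding quad_form_def by (simp add: sum_distrib_left mult_ac)

lemma quad_form_alt': "quad_form n B z z = (\<Sum>i<n. \<Sum>j<n. B $$ (i, j) * z i * z j)"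
  unfolding quad_form_def by (simp add: mult_ac)

locale delta_minimizer =
  fixes n :: nat and B :: "real mat" and w :: "nat \<Rightarrow> real"
  assumes n: "n \<ge> 1"
    and B_carrier: "B \<in> carrier_mat n n"
    and B_sym: "\<forall>i<n. \<forall>j<n. B $$ (i, j) = B $$ (j, i)"
    and B_psd: "\<forall>v. quad_form n B v v \<ge> 0"
    and B_det: "det B > 0"
    and w_Delta: "w \<in> Delta1 n"
    and w_min: "\<forall>v\<in>Delta1 n. quad_form n B w w \<le> quad_form n B v v"
    and A1: "\<forall>i\<in>{..<n} - Ibar n w. quad_form n B (\<lambda>k. unit_vec i k - w k) w \<noteq> 0"
begin

definition lam :: real where "lam = quad_form n B w w"

text \<open>Half the gradient of the quadratic form at the minimizer.\<close>

definition h :: "nat \<Rightarrow> real" where "h i = (\<Sum>j<n. B $$ (i, j) * w j)"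

sublocale pair: psd_inverse_pair n "\<lambda>i j. B $$ (i, j)" "\<lambda>i j. minv B $$ (i, j)"
  using B_carrier B_det B_sym B_psd by (intro psd_inverse_pair_minv) (auto simp: quad_form_alt')

text \<open>The first bound follows from the other two and shows that index 0 is always
  active.\<close>

lemma w_props: "w 0 \<ge> 1" "\<And>k. k \<in> {1..<n} \<Longrightarrow> w k \<le> 0" "sum w {..<n} = 1"
proof -
  show k: "\<And>k. k \<in> {1..<n} \<Longrightarrow> w k \<le> 0" and s: "sum w {..<n} = 1"
    using w_Delta by (auto simp: Delta1_def)
  have "{..<n} = insert 0 {1..<n}" using n by auto
  then have "1 = w 0 + sum w {1..<n}" using s by simp
  moreover have "sum w {1..<n} \<le> 0" using k by (intro sum_nonpos) auto
  ultimately show "w 0 \<ge> 1" by simp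
qed

text \<open>One-sided variational inequality: a feasible direction cannot decrease the form to first
  order.\<close>

lemma first_order:
  assumes e: "\<epsilon> > 0" and dir: "\<And>s. 0 < s \<Longrightarrow> s \<le> \<epsilon> \<Longrightarrow> (\<lambda>k. w k + s * d k) \<in> Delta1 n"
  shows "(\<Sum>i<n. d i * h i) \<ge> 0"
proof (rule ccontr)
  assume neg: "\<not> ?thesis"
  define g where "g = (\<Sum>i<n. d i * h i)"
  define q where "q = quad_form n B d d"
  have q: "q \<ge> 0" using B_psd by (simp add: q_def)
  have exp: "quad_form n B (\<lambda>k. w k + s * d k) (\<lambda>k. w k + s * d k) = lam + 2 * s * g + s^2 * q" for s
  proof -
    have "(\<Sum>i<n. \<Sum>j<n. w i * B $$ (i, j) * d j) = (\<Sum>i<n. \<Sum>j<n. w j * B $$ (j, i) * d i)"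
      by (rule sum.swap)
    also have "\<dots> = g"
      unfolding g_def h_def sum_distrib_left using B_sym by (intro sum.cong refl) (auto simp: mult_ac)
    finally have 1: "(\<Sum>i<n. \<Sum>j<n. w i * B $$ (i, j) * d j) = g" .
    have 2: "(\<Sum>i<n. \<Sum>j<n. d i * B $$ (i, j) * w j) = g"
      unfolding g_def h_def sum_distrib_left by (simp add: mult_ac)
    have "quad_form n B (\<lambda>k. w k + s * d k) (\<lambda>k. w k + s * d k) =
      lam + s * (\<Sum>i<n. \<Sum>j<n. w i * B $$ (i, j) * d j) + s * (\<Sum>i<n. \<Sum>j<n. d i * B $$ (i, j) * w j) + s^2 * q"
      unfolding quad_form_def lam_def q_def sum_distrib_left sum.distrib[symmetric]
      by (intro sum.cong refl) (simp add: algebra_simps power2_eq_square)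
    then show ?thesis unfolding 1 2 by simp
  qed
  have g: "g < 0" using neg by (simp add: g_def)
  \<comment> \<open>The + 1 avoids a zero denominator. This step gives s q <= - g, so 2 g + s q <= g
    < 0, contradicting minimality.\<close>
  define s where "s = min \<epsilon> (- g / (q + 1))"
  have s: "s > 0" "s \<le> \<epsilon>" using e g q by (auto simp: s_def divide_neg_pos)
  have "lam \<le> lam + 2 * s * g + s^2 * q"
    using bspec[OF w_min dir[OF s]] unfolding exp lam_def[symmetric] .
  then have "0 \<le> s * (2 * g + s * q)" by (simp add: algebra_simps power2_eq_square)
  then have "0 \<le> 2 * g + s * q" using s by (simp add: zero_le_mult_iff)
  moreover have "s * q \<le> - g"
  proof -
    have "s * q \<le> s * (q + 1)" using s by simp
    also have "\<dots> \<le> - g / (q + 1) * (q + 1)" using q by (intro mult_right_mono) (auto simp: s_def)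
    also have "\<dots> = - g" using q by simp
    finally show ?thesis .
  qed
  ultimately show False using g by simp
qed

lemma sum_unit: "i < n \<Longrightarrow> (\<Sum>k<n. unit_vec i k * f k) = f i"
  by (simp add: unit_vec_def if_distrib[of "\<lambda>x. x * _"] cong: if_cong)

lemma wh: "(\<Sum>i<n. w i * h i) = lam"
  by (simp add: lam_def quad_form_alt h_def)

text \<open>Moving away from the i-th unit vector, in direction w - e^i, is feasible for every i: w
  0 >= 1 stays nonnegative and the nonpositive coordinates only decrease or grow in size.\<close>

lemma h_le:
  assumes i: "i < n"
  shows "h i \<le> lam"
proof -
  have "(\<Sum>k<n. (w k - unit_vec i k) * h k) \<ge> 0"
  proof (rule first_order[of 1])
    fix s :: real assume s: "0 < s" "s \<le> 1"
    have "(\<Sum>k<n. w k + s * (w k - unit_vec i k)) = sum w {..<n} + s * (sum w {..<n} - (\<Sum>k<n. unit_vec i k * 1))"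
      by (simp add: sum.distrib sum_subtractf flip: sum_distrib_left)
    then have "(\<Sum>k<n. w k + s * (w k - unit_vec i k)) = 1"
      using sum_unit[OF i, of "\<lambda>_. 1"] w_props(3) by simp
    moreover have "w 0 + s * (w 0 - unit_vec i 0) \<ge> 0"
      using w_props(1) s by (auto simp: unit_vec_def intro!: add_nonneg_nonneg mult_nonneg_nonneg)
    moreover have "w k + s * (w k - unit_vec i k) \<le> 0" if "k \<in> {1..<n}" for k
      using w_props(2)[OF that] s by (intro add_nonpos_nonpos mult_nonneg_nonpos) (auto simp: unit_vec_def)
    ultimately show "(\<lambda>k. w k + s * (w k - unit_vec i k)) \<in> Delta1 n"
      by (simp add: Delta1_def)
  qed simp
  then show ?thesis
    using sum_unit[OF i, of h] wh by (simp add: left_diff_distrib sum_subtractf)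
qed

text \<open>For an active index the opposite direction e^i - w is feasible as well, for short
  steps.\<close>

lemma h_ge:
  assumes i: "i \<in> Ibar n w"
  shows "h i \<ge> lam"
proof -
  have iN: "i < n" and wi: "w i \<noteq> 0" using i by (auto simp: Ibar_def)
  \<comment> \<open>For i > 0 the value - w i / (1 - w i) is the step at which coordinate i reaches
    zero.\<close>
  define \<epsilon> where "\<epsilon> = (if i = 0 then 1 else min 1 (- w i / (1 - w i)))"
  have wi': "i \<noteq> 0 \<Longrightarrow> w i < 0" using w_props(2)[of i] wi iN by force
  have e: "\<epsilon> > 0" "\<epsilon> \<le> 1" using wi' by (auto simp: \<epsilon>_def divide_neg_pos)
  have "(\<Sum>k<n. (unit_vec i k - w k) * h k) \<ge> 0"
  proof (rule first_order[OF e(1)])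
    fix s :: real assume s: "0 < s" "s \<le> \<epsilon>"
    have s1: "s \<le> 1" using s e by simp
    have "(\<Sum>k<n. w k + s * (unit_vec i k - w k)) = sum w {..<n} + s * ((\<Sum>k<n. unit_vec i k * 1) - sum w {..<n})"
      by (simp add: sum.distrib sum_subtractf flip: sum_distrib_left)
    then have "(\<Sum>k<n. w k + s * (unit_vec i k - w k)) = 1"
      using sum_unit[OF iN, of "\<lambda>_. 1"] w_props(3) by simp
    moreover have "w 0 + s * (unit_vec i 0 - w 0) \<ge> 0"
    proof -
      have "w 0 + s * (unit_vec i 0 - w 0) = (1 - s) * w 0 + s * unit_vec i 0" by (simp add: algebra_simps)
      also have "\<dots> \<ge> 0" using w_props(1) s s1 by (intro add_nonneg_nonneg mult_nonneg_nonneg) (auto simp: unit_vec_def)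
      finally show ?thesis .
    qed
    moreover have "w k + s * (unit_vec i k - w k) \<le> 0" if k: "k \<in> {1..<n}" for k
    proof (cases "k = i")
      case True
      then have i0: "i \<noteq> 0" using k by auto
      have wneg: "w i < 0" using wi'[OF i0] .
      have "s \<le> - w i / (1 - w i)" using s i0 by (simp add: \<epsilon>_def)
      then have "s * (1 - w i) \<le> - w i / (1 - w i) * (1 - w i)" using wneg by (intro mult_right_mono) auto
      also have "\<dots> = - w i" using wneg by simp
      finally have "s * (1 - w i) \<le> - w i" .
      then show ?thesis using True by (simp add: unit_vec_def)
    next
      case False
      have "w k + s * (unit_vec i k - w k) = (1 - s) * w k" using False by (simp add: unit_vec_def algebra_simps)
      also have "\<dots> \<le> 0" using w_props(2)[OF k] s1 by (intro mult_nonneg_nonpos) auto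
      finally show ?thesis .
    qed
    ultimately show "(\<lambda>k. w k + s * (unit_vec i k - w k)) \<in> Delta1 n"
      by (simp add: Delta1_def)
  qed
  then show ?thesis
    using sum_unit[OF iN, of h] wh by (simp add: left_diff_distrib sum_subtractf)
qed

lemma h_eq: "i \<in> Ibar n w \<Longrightarrow> h i = lam"
  using h_le[of i] h_ge[of i] by (force simp: Ibar_def)

text \<open>Here Assumption A1 enters: it excludes equality in \<open>h_le\<close>, so that v < 1
  strictly off the active set.\<close>

lemma h_less:
  assumes "i < n" "i \<notin> Ibar n w"
  shows "h i < lam"
proof -
  have "quad_form n B (\<lambda>k. unit_vec i k - w k) w = h i - lam"
    unfolding quad_form_alt h_def[symmetric]
    using sum_unit[OF assms(1), of h] wh by (simp add: left_diff_distrib sum_subtractf)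
  then have "h i \<noteq> lam" using A1 assms by force
  then show ?thesis using h_le[OF assms(1)] by simp
qed

lemma lam_pos: "lam > 0"
  unfolding lam_def quad_form_alt'
  by (rule pair.B_pd) (use w_props(1) n in \<open>auto intro!: exI[of _ 0]\<close>)

end

section \<open>Identification of the constants\<close>

context delta_minimizer begin

abbreviation I where "I \<equiv> Ibar n w"
abbreviation nb where "nb \<equiv> nbar n w"
abbreviation f where "f \<equiv> \<lambda>i. idx n w ! i"

definition K where "K = I - {0}"
text \<open>\<open>Abar\<close> in the original labels, extended by zero off the active set; see
  \<open>Abar_eq\<close>.\<close>

definition A where "A k = w k / lam"
text \<open>Inverse of the enumeration \<open>idx\<close>. It carries the block inverse from
  positions below nb back to the original labels, so the active set need not be an initial
  segment.\<close>

definition pos where "pos = inv_into {..<nb} f"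
definition P where "P k l = abar n B w (pos k) (pos l)"
text \<open>Normalizing constant of the Gaussian marginal on the active coordinates, whose precision
  array is P.\<close>

definition Z where "Z = sqrt ((2 * pi) ^ nb * det (Bbar n B w))"

lemma I_finite: "finite I" by (simp add: Ibar_def)

lemma I_insert: "I = insert 0 K" "0 \<notin> K" "finite K"
  using w_props(1) n I_finite by (auto simp: K_def Ibar_def)

lemma nb_card: "nb = Suc (card K)"
  unfolding nbar_def I_insert(1) using I_insert by simp

lemma f_bij: "bij_betw f {..<nb} I"
proof -
  have "distinct (idx n w)" "set (idx n w) = I" "length (idx n w) = nb"
    using I_finite by (auto simp: idx_def nbar_def)
  then show ?thesis by (metis bij_betw_nth)
qed

lemma f_I: "i < nb \<Longrightarrow> f i \<in> I"
  using f_bij by (auto simp: bij_betw_def)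

lemma f_lt: "i < nb \<Longrightarrow> f i < n"
  using f_I by (auto simp: Ibar_def)

lemma f_inj: "inj_on f {..<nb}" using f_bij by (simp add: bij_betw_def)

lemma pos_f: "i < nb \<Longrightarrow> pos (f i) = i"
  unfolding pos_def using f_inj by (intro inv_into_f_f) auto

lemma pos_lt: "k \<in> I \<Longrightarrow> pos k < nb" and f_pos: "k \<in> I \<Longrightarrow> f (pos k) = k"
  using f_bij inv_into_into[of k f "{..<nb}"] f_inv_into_f[of k f "{..<nb}"]
  by (auto simp: pos_def bij_betw_def)

lemma sum_f: "(\<Sum>i<nb. g (f i)) = sum g I"
  by (rule sum.reindex_bij_betw[OF f_bij])

lemma prod_f: "(\<Prod>i<nb. g (f i)) = prod g I"
  by (rule prod.reindex_bij_betw[OF f_bij])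

lemma Bbar_carrier: "Bbar n B w \<in> carrier_mat nb nb" by (simp add: Bbar_def)

lemma Bbar_entry: "i < nb \<Longrightarrow> j < nb \<Longrightarrow> Bbar n B w $$ (i, j) = B $$ (f i, f j)"
  by (simp add: Bbar_def)

lemma Bbar_sym: "i < nb \<Longrightarrow> j < nb \<Longrightarrow> Bbar n B w $$ (i, j) = Bbar n B w $$ (j, i)"
  using B_sym f_lt by (simp add: Bbar_entry)

text \<open>Extension by zero lets the block inherit (semi)definiteness from B.\<close>

lemma Bbar_quad: "(\<Sum>i<nb. \<Sum>j<nb. Bbar n B w $$ (i, j) * z i * z j) =
   (\<Sum>k<n. \<Sum>l<n. B $$ (k, l) * (if k \<in> I then z (pos k) else 0) * (if l \<in> I then z (pos l) else 0))"
proof -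
  have "(\<Sum>i<nb. \<Sum>j<nb. Bbar n B w $$ (i, j) * z i * z j) = (\<Sum>i<nb. \<Sum>j<nb. B $$ (f i, f j) * z (pos (f i)) * z (pos (f j)))"
    by (intro sum.cong refl) (simp add: Bbar_entry pos_f)
  also have "\<dots> = (\<Sum>i<nb. \<Sum>l\<in>I. B $$ (f i, l) * z (pos (f i)) * z (pos l))"
    by (rule sum.cong[OF refl]) (rule sum_f)
  also have "\<dots> = (\<Sum>k\<in>I. \<Sum>l\<in>I. B $$ (k, l) * z (pos k) * z (pos l))"
    by (rule sum_f)
  also have "\<dots> = (\<Sum>k\<in>I. \<Sum>l\<in>I. B $$ (k, l) * (if k \<in> I then z (pos k) else 0) * (if l \<in> I then z (pos l) else 0))"
    by (intro sum.cong) auto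
  also have "\<dots> = (\<Sum>k\<in>I. \<Sum>l<n. B $$ (k, l) * (if k \<in> I then z (pos k) else 0) * (if l \<in> I then z (pos l) else 0))"
    by (intro sum.cong refl sum.mono_neutral_left) (auto simp: Ibar_def)
  also have "\<dots> = (\<Sum>k<n. \<Sum>l<n. B $$ (k, l) * (if k \<in> I then z (pos k) else 0) * (if l \<in> I then z (pos l) else 0))"
    by (intro sum.mono_neutral_left) (auto simp: Ibar_def)
  finally show ?thesis .
qed

lemma Bbar_pd:
  assumes "\<exists>i<nb. z i \<noteq> 0"
  shows "(\<Sum>i<nb. \<Sum>j<nb. Bbar n B w $$ (i, j) * z i * z j) > 0"
proof -
  obtain i where i: "i < nb" "z i \<noteq> 0" using assms by blast
  have "f i \<in> I" using f_I[OF i(1)] .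
  then show ?thesis
    unfolding Bbar_quad using i f_lt[OF i(1)] pos_f[OF i(1)]
    by (intro pair.B_pd exI[of _ "f i"]) auto
qed

text \<open>Read off from \<open>gaussian_integral\<close>, applied to the block itself with
  identity labelling.\<close>

lemma Bbar_det: "det (Bbar n B w) > 0"
proof -
  have "det (mat nb nb (\<lambda>(i, j). Bbar n B w $$ (i, j))) > 0"
    using gaussian_integral[of id nb "\<lambda>i j. Bbar n B w $$ (i, j)"] Bbar_sym Bbar_pd by auto
  moreover have "mat nb nb (\<lambda>(i, j). Bbar n B w $$ (i, j)) = Bbar n B w"
    using Bbar_carrier by (intro eq_matI) auto
  ultimately show ?thesis by simp
qed

sublocale bar: psd_inverse_pair nb "\<lambda>i j. Bbar n B w $$ (i, j)" "abar n B w"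
proof -
  have "psd_inverse_pair nb (\<lambda>i j. Bbar n B w $$ (i, j)) (\<lambda>i j. minv (Bbar n B w) $$ (i, j))"
  proof (rule psd_inverse_pair_minv[OF Bbar_carrier _ Bbar_sym])
    show "(\<Sum>i<nb. \<Sum>j<nb. Bbar n B w $$ (i, j) * z i * z j) \<ge> 0" for z
      unfolding Bbar_quad using B_psd by (simp add: quad_form_alt')
  qed (use Bbar_det in auto)
  moreover have "abar n B w = (\<lambda>i j. minv (Bbar n B w) $$ (i, j))" by (intro ext) (simp add: abar_def)
  ultimately show "psd_inverse_pair nb (\<lambda>i j. Bbar n B w $$ (i, j)) (abar n B w)" by simp
qed

lemma sum_P: "(\<Sum>i<nb. \<Sum>j<nb. abar n B w i j * u (f i) * u (f j)) = (\<Sum>k\<in>I. \<Sum>l\<in>I. P k l * u k * u l)"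
proof -
  have "(\<Sum>i<nb. \<Sum>j<nb. abar n B w i j * u (f i) * u (f j)) = (\<Sum>i<nb. \<Sum>j<nb. P (f i) (f j) * u (f i) * u (f j))"
    by (intro sum.cong refl) (simp add: P_def pos_f)
  also have "\<dots> = (\<Sum>i<nb. \<Sum>l\<in>I. P (f i) l * u (f i) * u l)"
    by (rule sum.cong[OF refl]) (rule sum_f)
  also have "\<dots> = (\<Sum>k\<in>I. \<Sum>l\<in>I. P k l * u k * u l)" by (rule sum_f)
  finally show ?thesis .
qed

lemma sub_pair: "psd_inverse_sub n (\<lambda>i j. B $$ (i, j)) (\<lambda>i j. minv B $$ (i, j)) I P"
proof unfold_locales
  show "I \<subseteq> {..<n}" by (auto simp: Ibar_def)
  fix k l assume k: "k \<in> I" and l: "l \<in> I"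
  have "(\<Sum>m\<in>I. B $$ (k, m) * P m l) = (\<Sum>j<nb. B $$ (k, f j) * P (f j) l)"
    by (rule sum_f[symmetric])
  also have "\<dots> = (\<Sum>j<nb. Bbar n B w $$ (pos k, j) * abar n B w j (pos l))"
    using k l by (intro sum.cong refl) (simp add: P_def pos_f Bbar_entry pos_lt f_pos)
  also have "\<dots> = (if pos k = pos l then 1 else 0)"
    by (rule bar.BQ) (use k l pos_lt in auto)
  also have "pos k = pos l \<longleftrightarrow> k = l" using f_pos k l by metis
  finally show "(\<Sum>m\<in>I. B $$ (k, m) * P m l) = (if k = l then 1 else 0)" .
qed

lemma A_sum: "sum A I = 1 / lam"
proof -
  have "sum w I = sum w {..<n}" by (intro sum.mono_neutral_left) (auto simp: Ibar_def)
  then show ?thesis using w_props(3) by (simp add: A_def[abs_def] flip: sum_divide_distrib)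
qed

lemma region_tilt: "region_tilt K 0 A"
proof
  show "A k < 0" if "k \<in> K" for k
    using that w_props(2)[of k] lam_pos by (auto simp: K_def Ibar_def A_def divide_neg_pos)
  show "sum A (insert 0 K) > 0" using A_sum lam_pos by (simp flip: I_insert(1))
qed (use I_insert in auto)

sublocale tilt: region_tilt K 0 A by (rule region_tilt)

text \<open>By \<open>h_eq\<close> the block of B maps A to the all-ones vector; the block inverse
  of that vector is the vector of row sums.\<close>

lemma Abar_eq: "i < nb \<Longrightarrow> Abar n B w i = A (f i)"
proof -
  assume i: "i < nb"
  have 1: "(\<Sum>j<nb. Bbar n B w $$ (k, j) * A (f j)) = 1" if k: "k < nb" for k
  proof -
    have "(\<Sum>j<nb. Bbar n B w $$ (k, j) * A (f j)) = (\<Sum>j<nb. B $$ (f k, f j) * A (f j))"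
      using k by (intro sum.cong refl) (simp add: Bbar_entry)
    also have "\<dots> = (\<Sum>l\<in>I. B $$ (f k, l) * A l)" by (rule sum_f)
    also have "\<dots> = (\<Sum>l<n. B $$ (f k, l) * A l)"
      by (intro sum.mono_neutral_left) (auto simp: Ibar_def A_def)
    also have "\<dots> = h (f k) / lam" by (simp add: h_def A_def sum_divide_distrib)
    finally show ?thesis using h_eq[OF f_I[OF k]] lam_pos by simp
  qed
  have "Abar n B w i = (\<Sum>j<nb. abar n B w i j * (\<Sum>l<nb. Bbar n B w $$ (j, l) * A (f l)))"
    using 1 by (simp add: Abar_def)
  also have "\<dots> = A (f i)" by (rule bar.Q_mult_B_mult[OF i])
  finally show ?thesis .
qed

lemma Sbar_eq: "Sbar n B w = sum A I"
  unfolding Sbar_def sum_f[of A, symmetric] by (intro sum.cong) (auto simp: Abar_eq)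

text \<open>The logarithm in \<open>Lbar\<close> is minus the concentration point. In the quadratic
  form of \<open>Cconst\<close> the overall sign drops out, so it is the Gaussian exponent at
  \<open>opt\<close>.\<close>

lemma Lbar_eq: "i < nb \<Longrightarrow> Lbar n mu B w i = mu (f i) - tilt.opt (f i)"
proof -
  assume i: "i < nb"
  have nz: "\<bar>A (f i)\<bar> > 0" using tilt.A_nz f_I[OF i] by (auto simp: I_insert(1))
  have S: "sum A I > 0" using A_sum lam_pos by simp
  have "ln (sum A I / \<bar>A (f i)\<bar>) = - ln (\<bar>A (f i)\<bar> / sum A I)"
    using nz S by (simp add: ln_div)
  then show ?thesis
    using i by (simp add: Lbar_def Sbar_eq Abar_eq mubar_def tilt.opt_def I_insert(1)[symmetric] del: sum.insert)
qed

lemma Z_pos: "Z > 0" unfolding Z_def using Bbar_det by simp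

lemma Z_integral:
  "(\<integral>\<^sup>+c. ennreal (exp (- (\<Sum>k\<in>I. \<Sum>l\<in>I. P k l * c k * c l) / 2)) \<partial>PiM I (\<lambda>_. lborel)) = ennreal Z"
proof -
  have "(\<integral>\<^sup>+c. ennreal (exp (- (\<Sum>i<nb. \<Sum>j<nb. abar n B w i j * c (f i) * c (f j)) / 2)) \<partial>PiM (f ` {..<nb}) (\<lambda>_. lborel))
    = ennreal (sqrt ((2 * pi) ^ nb / det (mat nb nb (\<lambda>(i, j). abar n B w i j))))"
    using gaussian_integral[of f nb "abar n B w"] f_inj bar.Q_sym bar.Q_pd by blast
  moreover have "mat nb nb (\<lambda>(i, j). abar n B w i j) = minv (Bbar n B w)"
    using minv_inverse(3)[OF Bbar_carrier] Bbar_det by (intro eq_matI) (auto simp: abar_def)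
  moreover have "det (minv (Bbar n B w)) = 1 / det (Bbar n B w)"
  proof -
    have inv: "Bbar n B w * minv (Bbar n B w) = 1\<^sub>m nb" "minv (Bbar n B w) \<in> carrier_mat nb nb"
      using minv_inverse[OF Bbar_carrier] Bbar_det by auto
    then have "det (Bbar n B w) * det (minv (Bbar n B w)) = 1"
      using det_mult[OF Bbar_carrier inv(2)] by simp
    then show ?thesis using Bbar_det by (simp add: field_simps)
  qed
  moreover have "f ` {..<nb} = I" using f_bij by (simp add: bij_betw_def)
  ultimately show ?thesis by (simp add: sum_P Z_def)
qed

text \<open>Both sides are written as one exponential and the exponents compared. The factor (2
  pi)^(card K / 2) from Stirling and the power nb / 2 in Z leave (2 pi)^(-1/2), as nb = card K +
  1.\<close>

lemma main_term_eq:
  assumes t: "t > 0"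
  shows "exp (- (t^2 * sum A I) / 2 + t * (\<Sum>k\<in>I. A k * mu k)) *
      (exp (- (\<Sum>k\<in>I. \<Sum>l\<in>I. P k l * (tilt.opt k - mu k) * (tilt.opt l - mu l)) / 2) / Z) * tilt.tilt_mass_main t
    = main_term n mu B w (exp t)"
proof -
  define S where "S = sum A I"
  define D where "D = det (Bbar n B w)"
  have S: "S > 0" using A_sum lam_pos by (simp add: S_def)
  have D: "D > 0" using Bbar_det by (simp add: D_def)
  have Anz: "A k \<noteq> 0" if "k \<in> I" for k using tilt.A_nz that by (simp add: I_insert(1))
  define q where "q = (\<Sum>k\<in>I. \<Sum>l\<in>I. P k l * (tilt.opt k - mu k) * (tilt.opt l - mu l))"
  define \<sigma> where "\<sigma> = (\<Sum>k\<in>I. ln \<bar>A k\<bar>)"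
  have q: "(\<Sum>i<nb. \<Sum>m<nb. abar n B w i m * Lbar n mu B w i * Lbar n mu B w m) = q"
  proof -
    have "(\<Sum>i<nb. \<Sum>m<nb. abar n B w i m * Lbar n mu B w i * Lbar n mu B w m)
      = (\<Sum>i<nb. \<Sum>m<nb. abar n B w i m * (tilt.opt (f i) - mu (f i)) * (tilt.opt (f m) - mu (f m)))"
      by (intro sum.cong refl) (simp add: Lbar_eq algebra_simps)
    then show ?thesis using sum_P[of "\<lambda>k. tilt.opt k - mu k"] by (simp add: q_def)
  qed
  have AL: "(\<Sum>i<nb. Abar n B w i * Lbar n mu B w i) = (\<Sum>k\<in>I. A k * mu k) - (\<Sum>k\<in>I. A k * tilt.opt k)"
  proof -
    have "(\<Sum>i<nb. Abar n B w i * Lbar n mu B w i) = (\<Sum>i<nb. A (f i) * (mu (f i) - tilt.opt (f i)))"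
      by (intro sum.cong refl) (simp add: Abar_eq Lbar_eq)
    also have "\<dots> = (\<Sum>k\<in>I. A k * (mu k - tilt.opt k))" by (rule sum_f)
    finally show ?thesis by (simp add: right_diff_distrib sum_subtractf)
  qed
  have pA: "(\<Prod>i<nb. \<bar>Abar n B w i\<bar>) = exp \<sigma>"
  proof -
    have "(\<Prod>i<nb. \<bar>Abar n B w i\<bar>) = (\<Prod>i<nb. \<bar>A (f i)\<bar>)" by (intro prod.cong refl) (simp add: Abar_eq)
    also have "\<dots> = (\<Prod>k\<in>I. \<bar>A k\<bar>)" by (rule prod_f)
    also have "\<dots> = (\<Prod>k\<in>I. exp (ln \<bar>A k\<bar>))" using Anz by (intro prod.cong refl) simp
    finally show ?thesis by (simp add: \<sigma>_def exp_sum I_finite)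
  qed
  have sqrt_exp: "sqrt (exp x) = exp (x / 2)" for x
    by (rule real_sqrt_unique) (simp_all add: power2_eq_square flip: exp_add)
  define a where "a = ln (2 * pi)"
  have a: "2 * pi = exp a" by (simp add: a_def)
  have De: "D = exp (ln D)" and Se: "S = exp (ln S)" using D S by auto
  have Zexp: "Z = exp ((real nb * a + ln D) / 2)"
  proof -
    have "(2 * pi) ^ nb * D = exp (real nb * a + ln D)"
      unfolding a using D by (simp add: exp_add exp_of_nat_mult)
    then show ?thesis by (simp add: Z_def D_def[symmetric] sqrt_exp)
  qed
  have nbK: "real nb = card K + 1" by (simp add: nb_card)
  have main: "main_term n mu B w (exp t) =
     1 / sqrt (2 * pi * D) * sqrt (S / exp \<sigma>) * exp (- (1/2) * q) / S * t powr (- (1 + real nb) / 2)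
       * exp t powr ((\<Sum>k\<in>I. A k * mu k) - (\<Sum>k\<in>I. A k * tilt.opt k)) * exp (- (1/2) * S * t^2)"
    unfolding main_term_def Cconst_def q AL pA Sbar_eq S_def[symmetric] D_def[symmetric] by simp
  also have "1 / sqrt (2 * pi * D) = exp (- (a + ln D) / 2)"
  proof -
    have "2 * pi * D = exp (a + ln D)" using D a by (simp add: exp_add)
    then have "1 / sqrt (2 * pi * D) = 1 / exp ((a + ln D) / 2)" by (simp only: sqrt_exp)
    also have "\<dots> = exp (- ((a + ln D) / 2))" by (simp only: exp_minus inverse_eq_divide)
    finally show ?thesis unfolding minus_divide_left .
  qed
  also have "sqrt (S / exp \<sigma>) = exp ((ln S - \<sigma>) / 2)"
    by (subst Se) (simp add: sqrt_exp flip: exp_diff)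
  also have "t powr (- (1 + real nb) / 2) = exp (- (1 + real nb) / 2 * ln t)"
    using t by (simp add: powr_def)
  also have "exp t powr ((\<Sum>k\<in>I. A k * mu k) - (\<Sum>k\<in>I. A k * tilt.opt k)) = exp (t * ((\<Sum>k\<in>I. A k * mu k) - (\<Sum>k\<in>I. A k * tilt.opt k)))"
    by (simp add: powr_def mult.commute)
  also have "exp (- (a + ln D) / 2) * exp ((ln S - \<sigma>) / 2) * exp (- (1/2) * q) / S * exp (- (1 + real nb) / 2 * ln t)
       * exp (t * ((\<Sum>k\<in>I. A k * mu k) - (\<Sum>k\<in>I. A k * tilt.opt k))) * exp (- (1/2) * S * t^2)
     = exp (- (a + ln D) / 2 + (ln S - \<sigma>) / 2 + (- (1/2) * q) - ln S + (- (1 + real nb) / 2 * ln t)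
       + t * ((\<Sum>k\<in>I. A k * mu k) - (\<Sum>k\<in>I. A k * tilt.opt k)) + (- (1/2) * S * t^2))"
    using S by (simp only: exp_add exp_diff exp_ln)
  finally have R: "main_term n mu B w (exp t) = exp (- (a + ln D) / 2 + (ln S - \<sigma>) / 2 + (- (1/2) * q) - ln S + (- (1 + real nb) / 2 * ln t)
       + t * ((\<Sum>k\<in>I. A k * mu k) - (\<Sum>k\<in>I. A k * tilt.opt k)) + (- (1/2) * S * t^2))" .
  have M: "tilt.tilt_mass_main t = exp (card K / 2 * a - (card K + 2) / 2 * ln t - ln S / 2 - \<sigma> / 2 - t * (\<Sum>k\<in>I. A k * tilt.opt k))"
    unfolding tilt.tilt_mass_main_def I_insert(1)[symmetric] S_def \<sigma>_def a_def by simp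
  have "exp (- (t^2 * S) / 2 + t * (\<Sum>k\<in>I. A k * mu k)) * (exp (- q / 2) / Z) * tilt.tilt_mass_main t
    = exp (- (t^2 * S) / 2 + t * (\<Sum>k\<in>I. A k * mu k) + (- q / 2 - (real nb * a + ln D) / 2)
       + (card K / 2 * a - (card K + 2) / 2 * ln t - ln S / 2 - \<sigma> / 2 - t * (\<Sum>k\<in>I. A k * tilt.opt k)))"
    unfolding M Zexp by (simp only: exp_add exp_diff)
  also have "\<dots> = main_term n mu B w (exp t)"
    unfolding R nbK by (rule arg_cong[where f = exp]) (simp add: field_simps)
  finally show ?thesis by (simp only: S_def q_def)
qed

end

section \<open>Relative errors and the conclusion\<close>

lemma abs_exp_minus_one_le:
  fixes s :: real
  assumes "\<bar>s\<bar> \<le> 1"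
  shows "\<bar>exp s - 1\<bar> \<le> 3 * \<bar>s\<bar>"
proof (cases "s \<ge> 0")
  case True
  have "exp s * (1 - s) \<le> exp s * exp (- s)"
    using exp_ge_add_one_self[of "- s"] by (intro mult_left_mono) auto
  then have "exp s - 1 \<le> exp s * s" by (simp add: algebra_simps flip: exp_add)
  also have "\<dots> \<le> 3 * s"
    using True assms exp_le order_trans[of "exp s" "exp 1" 3] by (intro mult_right_mono) auto
  finally show ?thesis using True by simp
next
  case False
  moreover have "exp s < 1" using False by simp
  ultimately show ?thesis using exp_ge_add_one_self[of s] by linarith
qed

text \<open>Composes the Laplace error 1 + O(1/t) with the Stirling error exp (O(1/t)).\<close>

lemma relative_error_bigo:
  fixes p main mt :: "real \<Rightarrow> real" and C1 C2 T :: real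
  assumes T: "T > 0"
    and p: "\<And>t. t \<ge> T \<Longrightarrow> \<bar>p t - main t\<bar> \<le> C1 / t * main t"
    and main: "\<And>t. t > 0 \<Longrightarrow> \<exists>s. main t = mt t * exp s \<and> \<bar>s\<bar> \<le> C2 / t"
    and mt: "\<And>t. t > 0 \<Longrightarrow> mt t > 0"
  shows "(\<lambda>t. p t / mt t - 1) \<in> O[at_top](\<lambda>t. 1 / t)"
proof (rule bigoI)
  show "\<forall>\<^sub>F t in at_top. norm (p t / mt t - 1) \<le> (3 * \<bar>C1\<bar> + 3 * \<bar>C2\<bar>) * norm (1 / t)"
    \<comment> \<open>Beyond |C2| the exponent satisfies |s| <= 1, so exp s <= 3, the origin of both
      factors 3.\<close>
    using eventually_ge_at_top[of "max T \<bar>C2\<bar>"]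
  proof eventually_elim
    case (elim t)
    then have t: "t > 0" "t \<ge> T" "t \<ge> \<bar>C2\<bar>" using T by auto
    obtain s where s: "main t = mt t * exp s" "\<bar>s\<bar> \<le> C2 / t" using main[OF t(1)] by blast
    have "C2 / t \<le> \<bar>C2\<bar> / t" using t by (intro divide_right_mono) auto
    then have s2: "\<bar>s\<bar> \<le> \<bar>C2\<bar> / t" using s by linarith
    also have "\<dots> \<le> 1" using t by simp
    finally have s1: "\<bar>s\<bar> \<le> 1" .
    have e3: "exp s \<le> 3" using s1 exp_le order_trans[of "exp s" "exp 1" 3] by simp
    have "\<bar>p t / mt t - exp s\<bar> = \<bar>p t - main t\<bar> / mt t"
      using mt[OF t(1)] unfolding s(1) by (simp add: diff_divide_distrib[symmetric] field_simps)
    also have "\<dots> \<le> C1 / t * main t / mt t"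
      using p[OF t(2)] mt[OF t(1)] by (intro divide_right_mono) auto
    also have "\<dots> = C1 / t * exp s" using mt[OF t(1)] s(1) by simp
    also have "\<dots> \<le> \<bar>C1\<bar> / t * 3" using t e3 by (intro mult_mono divide_right_mono) auto
    finally have 1: "\<bar>p t / mt t - exp s\<bar> \<le> \<bar>C1\<bar> / t * 3" .
    have "\<bar>exp s - 1\<bar> \<le> 3 * (\<bar>C2\<bar> / t)"
      using abs_exp_minus_one_le[OF s1] s2 by linarith
    then have "\<bar>p t / mt t - 1\<bar> \<le> \<bar>C1\<bar> / t * 3 + 3 * (\<bar>C2\<bar> / t)"
      using 1 by linarith
    also have "\<dots> = (3 * \<bar>C1\<bar> + 3 * \<bar>C2\<bar>) * norm (1 / t)"
      using t by (simp add: add_divide_distrib)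
    finally show ?case by simp
  qed
qed

theorem theorem2:
  fixes M :: "'a measure" and Y :: "'a \<Rightarrow> nat \<Rightarrow> real"
    and n :: nat and mu :: "nat \<Rightarrow> real" and B :: "real mat" and wbar :: "nat \<Rightarrow> real"
  assumes "prob_space M"
    and "n \<ge> 1"
    and "B \<in> carrier_mat n n"
    and "\<forall>i<n. \<forall>j<n. B $$ (i, j) = B $$ (j, i)"
    and "\<forall>v. quad_form n B v v \<ge> 0"
    and "det B > 0"
    and "distributed M (PiM {..<n} (\<lambda>_. lborel)) Y (\<lambda>y. ennreal (gauss_density n mu B y))"
    and "wbar \<in> Delta1 n"
    and "\<forall>v\<in>Delta1 n. quad_form n B wbar wbar \<le> quad_form n B v v"
    and A1: "\<forall>i\<in>{..<n} - Ibar n wbar.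
               quad_form n B (\<lambda>k. unit_vec i k - wbar k) wbar \<noteq> 0"
  shows "\<exists>h. h \<in> O[at_top](\<lambda>x. 1 / ln x) \<and>
           (\<forall>\<^sub>F x in at_top.
              measure M {\<omega> \<in> space M. exp (Y \<omega> 0) - (\<Sum>k\<in>{1..<n}. exp (Y \<omega> k)) \<ge> x}
              = main_term n mu B wbar x * (1 + h x))"
proof -
  interpret delta_minimizer n B wbar
    using assms by unfold_locales auto
  interpret prob_space M by fact
  let ?L = "PiM {..<n} (\<lambda>_. lborel :: real measure)"
  define \<kappa>0 where "\<kappa>0 = 1 / sqrt ((2 * pi) ^ n * det B)"
  define dens where "dens y = \<kappa>0 * exp (- pair.QF (\<lambda>k. y k - mu k) / 2)" for y
  have \<kappa>0: "\<kappa>0 > 0" using B_det by (simp add: \<kappa>0_def)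
  have dens: "gauss_density n mu B y = dens y" for y
    unfolding gauss_density_def dens_def \<kappa>0_def quad_form_alt' pair.QF_def by simp
  have dist: "distributed M ?L Y (\<lambda>y. ennreal (dens y))"
    using assms(7) unfolding dens .
  \<comment> \<open>Obtained from M being a probability space rather than from the n-dimensional
    Gaussian integral.\<close>
  have mass: "(\<integral>\<^sup>+y. ennreal (dens y) \<partial>?L) = 1"
  proof -
    have "emeasure M (Y -` space ?L \<inter> space M) = (\<integral>\<^sup>+y. ennreal (dens y) * indicator (space ?L) y \<partial>?L)"
      by (rule distributed_emeasure[OF dist]) simp
    also have "Y -` space ?L \<inter> space M = space M"
      using distributed_measurable[OF dist] by (auto dest: measurable_space)
    also have "(\<integral>\<^sup>+y. ennreal (dens y) * indicator (space ?L) y \<partial>?L) = (\<integral>\<^sup>+y. ennreal (dens y) \<partial>?L)"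
      by (rule nn_integral_cong) simp
    finally show ?thesis by (simp add: emeasure_space_1)
  qed
  \<comment> \<open>v = B w / lam, so the precision matrix maps it to w / lam = A.\<close>
  define v where "v k = h k / lam" for k
  have Qv: "(\<Sum>j<n. minv B $$ (k, j) * v j) = A k" if "k < n" for k
  proof -
    have "(\<Sum>j<n. minv B $$ (k, j) * v j) = (\<Sum>j<n. minv B $$ (k, j) * h j) / lam"
      by (simp add: v_def sum_divide_distrib)
    also have "(\<Sum>j<n. minv B $$ (k, j) * h j) = wbar k"
      unfolding h_def by (rule pair.Q_mult_B_mult[OF that])
    finally show ?thesis by (simp add: A_def)
  qed
  define mn where "mn t = exp (- (t^2 * sum A I) / 2 + t * (\<Sum>k\<in>I. A k * mu k)) *
      (exp (- (\<Sum>k\<in>I. \<Sum>l\<in>I. P k l * (tilt.opt k - mu k) * (tilt.opt l - mu l)) / 2) / Z)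
      * tilt_mass K 0 A t" for t
  obtain C1 T where T: "T > 0" and asy: "\<And>t. t \<ge> T \<Longrightarrow> \<exists>p\<ge>0.
     (\<integral>\<^sup>+y. ennreal (dens y) * indicator {y. exp (y 0) - (\<Sum>k\<in>{..<n} - {0}. exp (y k)) \<ge> exp t} y \<partial>?L) = ennreal p
     \<and> \<bar>p - mn t\<bar> \<le> C1 / t * mn t"
  proof (rule gaussian_tail_asymptotics[OF sub_pair[unfolded I_insert(1)] region_tilt _ Qv, of \<kappa>0 mu Z, folded I_insert(1)])
    show "A k = 0" if "k < n" "k \<notin> I" for k using that by (simp add: A_def Ibar_def)
    show "v k = 1" if "k \<in> I" for k using h_eq[OF that] lam_pos by (simp add: v_def)
    show "v k < 1" if "k < n" "k \<notin> I" for k using h_less[OF that] lam_pos by (simp add: v_def)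
    show "(\<integral>\<^sup>+y. ennreal (\<kappa>0 * exp (- pair.QF (\<lambda>k. y k - mu k) / 2)) \<partial>?L) = 1"
      using mass by (simp add: dens_def)
  qed (use \<kappa>0 Z_pos Z_integral in \<open>auto simp: dens_def mn_def\<close>)
  define pr where "pr x = measure M {\<omega> \<in> space M. exp (Y \<omega> 0) - (\<Sum>k\<in>{1..<n}. exp (Y \<omega> k)) \<ge> x}" for x
  have pr_bound: "\<bar>pr (exp t) - mn t\<bar> \<le> C1 / t * mn t" if t: "t \<ge> T" for t
  proof -
    let ?E = "{y. exp (y 0) - (\<Sum>k\<in>{..<n} - {0}. exp (y k)) \<ge> exp t}"
    obtain p where p: "p \<ge> 0" "(\<integral>\<^sup>+y. ennreal (dens y) * indicator ?E y \<partial>?L) = ennreal p"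
      "\<bar>p - mn t\<bar> \<le> C1 / t * mn t" using asy[OF t] by blast
    have E: "?E \<inter> space ?L \<in> sets ?L"
    proof -
      have "(\<lambda>y. exp (y 0) - (\<Sum>k\<in>{..<n} - {0}. exp (y k))) \<in> borel_measurable ?L"
        using n by (intro borel_measurable_diff borel_measurable_sum measurable_compose[OF _ borel_measurable_exp]) (auto intro!: measurable_component_singleton[of _ _ "\<lambda>_. lborel", simplified])
      then have "{y \<in> space ?L. exp t \<le> exp (y 0) - (\<Sum>k\<in>{..<n} - {0}. exp (y k))} \<in> sets ?L"
        by (intro borel_measurable_le) auto
      then show ?thesis by (simp add: Int_def conj_commute)
    qed
    have "{1..<n} = {..<n} - {0}" by auto
    then have ev: "{\<omega> \<in> space M. exp (Y \<omega> 0) - (\<Sum>k\<in>{1..<n}. exp (Y \<omega> k)) \<ge> exp t} = Y -` (?E \<inter> space ?L) \<inter> space M"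
      using distributed_measurable[OF dist] by (auto dest: measurable_space)
    have "emeasure M (Y -` (?E \<inter> space ?L) \<inter> space M) = (\<integral>\<^sup>+y. ennreal (dens y) * indicator (?E \<inter> space ?L) y \<partial>?L)"
      by (rule distributed_emeasure[OF dist E])
    also have "\<dots> = (\<integral>\<^sup>+y. ennreal (dens y) * indicator ?E y \<partial>?L)"
      by (rule nn_integral_cong) (simp add: indicator_def)
    finally have "pr (exp t) = p"
      unfolding pr_def ev using p by (simp add: measure_def)
    then show ?thesis using p by simp
  qed
  obtain C2 where C2: "\<And>t. t > 0 \<Longrightarrow> \<exists>s. tilt_mass K 0 A t = tilt.tilt_mass_main t * exp s \<and> \<bar>s\<bar> \<le> C2 / t"
    using tilt.tilt_mass_stirling by blast
  have mn_main: "\<exists>s. mn t = main_term n mu B wbar (exp t) * exp s \<and> \<bar>s\<bar> \<le> C2 / t" if t: "t > 0" for t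
  proof -
    obtain s where s: "tilt_mass K 0 A t = tilt.tilt_mass_main t * exp s" "\<bar>s\<bar> \<le> C2 / t"
      using C2[OF t] by blast
    have "mn t = main_term n mu B wbar (exp t) * exp s"
      unfolding mn_def s(1) main_term_eq[OF t, symmetric] by (simp only: mult.assoc)
    then show ?thesis using s(2) by blast
  qed
  have main_pos: "main_term n mu B wbar (exp t) > 0" if t: "t > 0" for t
    unfolding main_term_eq[OF t, symmetric] using Z_pos by (simp add: tilt.tilt_mass_main_def)
  \<comment> \<open>The relative error as a function of t = ln x; composing with \<open>ln\<close>
    turns O(1/t) into O(1 / ln x).\<close>
  define H where "H t = pr (exp t) / main_term n mu B wbar (exp t) - 1" for t
  have H: "H \<in> O[at_top](\<lambda>t. 1 / t)"
    unfolding H_def by (rule relative_error_bigo[OF T pr_bound mn_main main_pos])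
  show ?thesis
  proof (intro exI conjI)
    show "(\<lambda>x. H (ln x)) \<in> O[at_top](\<lambda>x. 1 / ln x)"
      by (rule landau_o.big.compose[OF H ln_at_top])
    show "\<forall>\<^sub>F x in at_top. measure M {\<omega> \<in> space M. exp (Y \<omega> 0) - (\<Sum>k\<in>{1..<n}. exp (Y \<omega> k)) \<ge> x}
      = main_term n mu B wbar x * (1 + H (ln x))"
      using eventually_gt_at_top[of 1]
    proof eventually_elim
      case (elim x)
      then have "ln x > 0" "exp (ln x) = x" by auto
      then show ?case using main_pos[of "ln x"] by (simp add: H_def pr_def)
    qed
  qed
qed

end
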